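(* For any integer $k\ge 2$ and all $x\ge 3$, $$S(x;\mathbb{Z}_2^k)=\frac{3}{2\,(k-2)!}\,\frac{x(\log\log x)^{k-2}}{\log x}\left(1+O_k\!\left(\frac{1}{\log\log x}\right)\right).$$
   Context: For a positive integer $m$, $\mathbb{Z}_m$ denotes the cyclic group of order $m$, and $\mathbb{Z}_n^\times$ denotes the group of units of the ring $\mathbb{Z}/n\mathbb{Z}$. For a finite abelian group $G$, $G\le \mathbb{Z}_n^\times$ means that $\mathbb{Z}_n^\times$ has a subgroup isomorphic to $G$, and $G\nleq\mathbb{Z}_n^\times$ is its negation. Define $$S(x;G)=\#\{n\le x: G\nleq\mathbb{Z}_n^\times\},$$ where $n$ runs over positive integers. The implied constant in $O_k$ depends only on $k$. *)

theory Defs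
  imports Complex_Main "HOL-Algebra.IntRing" "HOL-Algebra.Product_Groups"
    "HOL-Algebra.Elementary_Groups"
begin

text \<open>
  The unit group is taken in the quotient ring \<^term>\<open>ZFact (int n)\<close>. The locale-style ring
  \<open>residue_ring\<close> would be wrong at \<open>n = 1\<close>: there its \<open>one\<close> lies outside the carrier, so it has
  no units, whereas the unit group of the zero ring is trivial but nonempty.
\<close>
definition unit_group_mod :: "nat \<Rightarrow> int set monoid" where
  "unit_group_mod n = units_of (ZFact (int n))"

definition embeds_in :: "('a, 'c) monoid_scheme \<Rightarrow> ('b, 'd) monoid_scheme \<Rightarrow> bool" where
  "embeds_in G K \<longleftrightarrow> (\<exists>H. subgroup H K \<and> G \<cong> K\<lparr>carrier := H\<rparr>)"

definition S :: "real \<Rightarrow> ('a, 'c) monoid_scheme \<Rightarrow> nat" where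
  "S x G = card {n::nat. 0 < n \<and> real n \<le> x \<and> \<not> embeds_in G (unit_group_mod n)}"

definition cyclic_power :: "nat \<Rightarrow> nat \<Rightarrow> (nat \<Rightarrow> int) monoid" where
  "cyclic_power m k = product_group {..<k} (\<lambda>_. integer_mod_group m)"

end

theory Submission
  imports Defs "HOL-Complex_Analysis.Complex_Analysis" "HOL-Number_Theory.Number_Theory"
    "HOL-Probability.Probability" "HOL-Real_Asymp.Real_Asymp"
begin

text \<open>The 2-torsion of \<open>\<int>\<^sub>n\<^sup>\<times>\<close> has rank equal to the number of odd primes dividing \<open>n\<close>, plus 0, 1 or 2 according to
  the power of 2 in \<open>n\<close>. So \<open>S(x; \<int>\<^sub>2\<^sup>k)\<close> counts integers whose odd part has few prime factors, and the main term
  comes from the odd and the twice odd integers with exactly \<open>k - 1\<close> odd primes (densities \<open>1\<close> and \<open>1/2\<close>). These are counted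
  as in Landau's theorem: ordered factorisations into primes are weighted by the logarithm, which by symmetry reduces
  the count to a Chebyshev sum over the last prime. The prime number theorem with a power-of-log saving is
  needed there; it follows from polynomial bounds for \<open>\<zeta>\<close> and \<open>1/\<zeta>\<close> on \<open>Re s > 1\<close>, which control a Gaussian average of
  \<open>\<psi>(exp u) exp(-u)\<close>, and the monotonicity of \<open>\<psi>\<close>.\<close>

section \<open>The Riemann zeta function to the right of the line Re s = 1\<close>

text \<open>The Fourier argument stays on \<open>Re s > 1\<close>; what matters is that the bounds
  for the Laplace transform and its derivative do not deteriorate as \<open>Re s\<close> tends to 1.
  A Gaussian factor of width 1/\<delta> restores convergence at the price of a power of 1/\<delta>,
  one integration by parts gains 1/u, and balancing the two leaves the exponent 1/60. Any fixed
  positive exponent would serve, since it only has to beat powers of the iterated logarithm and to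
  make the error in the Mertens sum converge. The relative error 1/ln ln x has one origin. A
  repeated odd prime, or a factor 4 (which raises the 2-rank), leaves after removal of a prime power
  \<open>p ^ e\<close> with \<open>e \<ge> 2\<close> a cofactor with at most \<open>k - 2\<close>
  odd primes. Such cofactors are rarer by a factor ln ln x, and the loss is summable over all prime
  powers. The same observation drives the induction on the number of primes.\<close>

definition dirichlet :: "(nat \<Rightarrow> real) \<Rightarrow> complex \<Rightarrow> complex" where
  "dirichlet c s = (\<Sum>n. of_real (c n) * of_nat n powr (-s))"

lemma norm_nat_powr: "norm ((of_nat n :: complex) powr s) = real n powr Re s"
  by (simp add: norm_powr_real_powr)

text \<open>One majorant serves all series below: the coefficients 1, \<open>ln n\<close>,
  \<open>mangoldt n\<close> and \<open>mangoldt n / ln n\<close> are at most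
  \<open>1 + ln n\<close>. The index 0 is harmless because \<open>ln 0 = 0\<close> and
  \<open>0 powr _ = 0\<close>.\<close>

lemma summable_ln_powr:
  fixes \<sigma> :: real
  assumes "\<sigma> > 1"
  shows "summable (\<lambda>n. (1 + ln (real n)) * real n powr (-\<sigma>))"
proof (rule summable_comparison_test_ev)
  \<comment> \<open>Half of the surplus \<sigma> - 1 absorbs the logarithm, the other half keeps the
    exponent beyond 1.\<close>
  define e where "e = (\<sigma> - 1) / 2"
  have e: "e > 0" using assms by (simp add: e_def)
  have "\<forall>\<^sub>F n in sequentially. 1 + ln (real n) \<le> real n powr e"
    using e by real_asymp
  then show "\<forall>\<^sub>F n in sequentially. norm ((1 + ln (real n)) * real n powr (-\<sigma>)) \<le> real n powr (e - \<sigma>)"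
    using eventually_gt_at_top[of 0]
  proof eventually_elim
    case (elim n)
    have "(1 + ln (real n)) * real n powr (-\<sigma>) \<le> real n powr e * real n powr (-\<sigma>)"
      using elim by (intro mult_right_mono) auto
    then show ?case using elim by (simp add: powr_add [symmetric])
  qed
  show "summable (\<lambda>n. real n powr (e - \<sigma>))"
    using assms by (simp add: summable_real_powr_iff e_def field_simps)
qed

lemma dirichlet_term_bound:
  assumes "\<bar>c n\<bar> \<le> 1 + ln (real n)" "\<sigma> \<le> Re s"
  shows "norm (of_real (c n) * (of_nat n :: complex) powr (-s)) \<le> (1 + ln (real n)) * real n powr (-\<sigma>)"
proof -
  have "real n powr (-Re s) \<le> real n powr (-\<sigma>)"
    using assms by (cases "n = 0") (auto intro!: powr_mono)
  moreover have "0 \<le> 1 + ln (real n)"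
    using assms(1) by linarith
  ultimately show ?thesis using assms
    by (simp add: norm_mult norm_nat_powr mult_mono)
qed

lemma summable_norm_dirichlet:
  assumes "\<And>n. \<bar>c n\<bar> \<le> 1 + ln (real n)" "Re s > 1"
  shows "summable (\<lambda>n. norm (of_real (c n) * (of_nat n :: complex) powr (-s)))"
  by (rule summable_comparison_test'[OF summable_ln_powr[OF assms(2)], of 0])
     (use dirichlet_term_bound[where c = c and s = s and \<sigma> = "Re s"] assms(1) in auto)

lemma dirichlet_sums:
  assumes "\<And>n. \<bar>c n\<bar> \<le> 1 + ln (real n)" "Re s > 1"
  shows "(\<lambda>n. of_real (c n) * (of_nat n :: complex) powr (-s)) sums dirichlet c s"
  unfolding dirichlet_def
  by (rule summable_sums, rule summable_norm_cancel, rule summable_norm_dirichlet[OF assms])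

text \<open>Holomorphic terms with a uniform majorant may be differentiated one by one. The
  half-plane bounded by the midpoint of 1 and \<open>Re s\<close> is a neighbourhood of
  \<open>s\<close> with such a majorant.\<close>

lemma dirichlet_deriv:
  assumes "\<And>n. \<bar>c n\<bar> \<le> 1 + ln (real n)" "Re s > 1"
  shows "(dirichlet c has_field_derivative dirichlet (\<lambda>n. - c n * ln (real n)) s) (at s)"
proof -
  define \<sigma> where "\<sigma> = (1 + Re s) / 2"
  have \<sigma>: "1 < \<sigma>" "\<sigma> < Re s" using assms(2) by (auto simp: \<sigma>_def)
  let ?S = "{z. Re z > \<sigma>}"
  have "open ?S" by (rule open_halfspace_Re_gt)
  obtain g g' where g: "\<forall>x\<in>?S. ((\<lambda>n. of_real (c n) * (of_nat n :: complex) powr (-x)) sums g x) \<and>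
      ((\<lambda>n. of_real (- c n * ln (real n)) * (of_nat n :: complex) powr (-x)) sums g' x) \<and>
      (g has_field_derivative g' x) (at x)"
  proof (rule series_and_derivative_comparison[OF \<open>open ?S\<close> summable_ln_powr[OF \<sigma>(1)]])
    fix n :: nat and x :: complex
    assume "x \<in> ?S"
    show "((\<lambda>s. of_real (c n) * (of_nat n :: complex) powr (-s)) has_field_derivative
        of_real (- c n * ln (real n)) * (of_nat n :: complex) powr (-x)) (at x)"
    proof (cases "n = 0")
      case False
      then show ?thesis
        unfolding powr_def
        by (auto intro!: derivative_eq_intros simp: Ln_of_nat)
    qed simp
  next
    show "\<forall>\<^sub>F n in sequentially. \<forall>x\<in>?S. norm (of_real (c n) * (of_nat n :: complex) powr (-x))
        \<le> (1 + ln (real n)) * real n powr (-\<sigma>)"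
      by (intro always_eventually allI ballI dirichlet_term_bound[OF assms(1)]) auto
  qed
  have gd: "g x = dirichlet c x" if "x \<in> ?S" for x
    using g that unfolding dirichlet_def by (auto simp: sums_iff)
  have s: "s \<in> ?S" using \<sigma> by auto
  have g': "g' s = dirichlet (\<lambda>n. - c n * ln (real n)) s"
    using g s unfolding dirichlet_def by (auto simp: sums_iff)
  have "(g has_field_derivative g' s) (at s)" using g s by blast
  then show ?thesis
    unfolding g' by (rule has_field_derivative_transform_within_open[OF _ \<open>open ?S\<close> s gd])
qed

section \<open>The logarithmic derivative and a logarithm of zeta\<close>

definition zeta :: "complex \<Rightarrow> complex" where "zeta = dirichlet (\<lambda>_. 1)"
definition vm_series :: "complex \<Rightarrow> complex" where "vm_series = dirichlet mangoldt"

lemma mangoldt_growth: "\<bar>mangoldt n\<bar> \<le> 1 + ln (real n)"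
  using mangoldt_le[of n] by (cases "n = 0") auto

lemma one_growth: "\<bar>1::real\<bar> \<le> 1 + ln (real n)"
  by (cases "n = 0") auto

lemma ln_growth: "\<bar>ln (real n)\<bar> \<le> 1 + ln (real n)"
  by (cases "n = 0") auto

text \<open>The values of \<open>mangoldt\<close> over the divisors of \<open>n\<close> add up to
  \<open>ln n\<close>. Sorting the absolutely convergent double series along
  \<open>n = a * b\<close> turns this convolution into a product.\<close>

lemma zeta_mult_vm_series:
  assumes s: "Re s > 1"
  shows "zeta s * vm_series s = dirichlet (\<lambda>n. ln (real n)) s"
proof -
  define f where "f = (\<lambda>n::nat. (of_nat n :: complex) powr (-s))"
  define g where "g = (\<lambda>n::nat. of_real (mangoldt n) * (of_nat n :: complex) powr (-s))"
  have f: "summable (\<lambda>n. norm (f n))"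
    using summable_norm_dirichlet[OF one_growth s] by (simp add: f_def)
  have g: "summable (\<lambda>n. norm (g n))"
    using summable_norm_dirichlet[OF mangoldt_growth s] by (simp add: g_def)
  have fs: "f summable_on UNIV" "(\<lambda>n. norm (f n)) summable_on UNIV"
    using f norm_summable_imp_summable_on summable_on_iff_abs_summable_on_complex by blast+
  have gs: "g summable_on UNIV" "(\<lambda>n. norm (g n)) summable_on UNIV"
    using g norm_summable_imp_summable_on summable_on_iff_abs_summable_on_complex by blast+
  have F: "(f has_sum zeta s) UNIV"
  proof -
    have "f sums zeta s"
      using dirichlet_sums[OF one_growth s] by (simp add: f_def zeta_def)
    then show ?thesis
      using f norm_summable_imp_has_sum by blast
  qed
  have G: "(g has_sum vm_series s) UNIV"
  proof -
    have "g sums vm_series s"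
      using dirichlet_sums[OF mangoldt_growth s] by (simp add: g_def vm_series_def)
    then show ?thesis
      using g norm_summable_imp_has_sum by blast
  qed
  define P where "P = {(a,b). a > (0::nat) \<and> b > (0::nat)}"
  have abs: "(\<lambda>x. norm ((\<lambda>(a,b). f a * g b) x)) summable_on UNIV \<times> UNIV"
  proof -
    define h where "h = (\<lambda>(a,b). f a * g b)"
    have "(\<lambda>y. norm (h (x, y))) summable_on UNIV" for x
      using gs by (auto simp: h_def norm_mult intro!: summable_on_cmult_right)
    moreover have "(\<lambda>x. norm (\<Sum>\<^sub>\<infinity>y. norm (h (x, y)))) summable_on UNIV"
      using fs by (auto simp: h_def norm_mult infsum_cmult_right' abs_mult intro!: summable_on_cmult_left)
    ultimately have "(\<lambda>x. norm (h x)) summable_on UNIV \<times> UNIV"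
      unfolding Infinite_Sum.abs_summable_on_Sigma_iff by blast
    then show ?thesis unfolding h_def .
  qed
  then have abs': "(\<lambda>(a,b). f a * g b) summable_on UNIV \<times> UNIV"
    by (simp add: abs_summable_summable)
  have "(\<Sum>\<^sub>\<infinity>(a,b)\<in>UNIV \<times> UNIV. f a * g b) = (\<Sum>\<^sub>\<infinity>a. \<Sum>\<^sub>\<infinity>b. f a * g b)"
    using infsum_Sigma'_banach[of "\<lambda>a b. f a * g b" UNIV "\<lambda>_. UNIV"] abs' by simp
  also have "\<dots> = zeta s * vm_series s"
    using infsumI[OF F] infsumI[OF G] by (simp add: infsum_cmult_right' infsum_cmult_left')
  finally have "((\<lambda>(a,b). f a * g b) has_sum (zeta s * vm_series s)) (UNIV \<times> UNIV)"
    using abs' by (metis has_sum_infsum)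
  \<comment> \<open>Pairs with a zero entry contribute 0, since \<open>0 powr _ = 0\<close>. Without
    them, \<open>(a, b)\<close> corresponds bijectively to a positive \<open>n = a * b\<close> with
    a chosen divisor \<open>b\<close>.\<close>
  then have "((\<lambda>(a,b). f a * g b) has_sum (zeta s * vm_series s)) P"
    by (subst has_sum_cong_neutral[where T = "UNIV \<times> UNIV" and g = "\<lambda>(a,b). f a * g b"])
       (auto simp: P_def f_def g_def)
  also have "?this \<longleftrightarrow> ((\<lambda>(n,d). f (n div d) * g d) has_sum (zeta s * vm_series s)) (SIGMA n:{0<..}. {d. d dvd n})"
    by (rule has_sum_reindex_bij_witness[where j = "\<lambda>(a,b). (a*b,b)" and i = "\<lambda>(n,d). (n div d, d)"])
       (auto simp: P_def intro!: Nat.gr0I)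
  finally have H: "((\<lambda>(n,d). f (n div d) * g d) has_sum (zeta s * vm_series s)) (SIGMA n:{0<..}. {d. d dvd n})" .
  have "((\<lambda>n. of_real (ln (real n)) * of_nat n powr (-s)) has_sum (zeta s * vm_series s)) {0<..}"
  proof (rule has_sum_SigmaD[OF H])
    fix n :: nat assume n: "n \<in> {0<..}"
    have "(\<Sum>d | d dvd n. f (n div d) * g d) = (\<Sum>d | d dvd n. mangoldt d * of_nat n powr (-s))"
    proof (rule sum.cong)
      fix d assume "d \<in> {d. d dvd n}"
      then obtain a where a: "n = d * a" by auto
      with n have "d > 0" "a > 0" by auto
      then have "(of_nat n :: complex) powr (-s) = of_nat d powr (-s) * of_nat a powr (-s)"
        using powr_times_real[of "of_nat d" "of_nat a" "-s"] by (simp add: a)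
      then show "f (n div d) * g d = mangoldt d * of_nat n powr (-s)"
        using \<open>d > 0\<close> by (simp add: f_def g_def a)
    qed simp
    also have "\<dots> = of_real (ln (real n)) * of_nat n powr (-s)"
      using n by (simp add: sum_distrib_right [symmetric] mangoldt_sum)
    finally have "((\<lambda>d. f (n div d) * g d) has_sum of_real (ln (real n)) * of_nat n powr (-s)) {d. d dvd n}"
      using n by (intro has_sum_finiteI) auto
    then show "((\<lambda>d. (\<lambda>(n,d). f (n div d) * g d) (n, d)) has_sum of_real (ln (real n)) * of_nat n powr (-s)) {d. d dvd n}"
      by simp
  qed
  then have "((\<lambda>n. of_real (ln (real n)) * of_nat n powr (-s)) has_sum (zeta s * vm_series s)) UNIV"
    by (subst (asm) has_sum_cong_neutral[where T = "UNIV" and g = "\<lambda>n. of_real (ln (real n)) * of_nat n powr (-s)"]) auto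
  then have "(\<lambda>n. of_real (ln (real n)) * of_nat n powr (-s)) sums (zeta s * vm_series s)"
    by (rule has_sum_imp_sums)
  then show ?thesis unfolding dirichlet_def by (simp add: sums_iff)
qed

lemma zeta_deriv:
  assumes "Re s > 1"
  shows "(zeta has_field_derivative - zeta s * vm_series s) (at s)"
proof -
  have "dirichlet (\<lambda>n. - 1 * ln (real n)) s = - dirichlet (\<lambda>n. ln (real n)) s"
    using dirichlet_sums[OF ln_growth assms] unfolding dirichlet_def
    by (simp add: sums_iff suminf_minus)
  then show ?thesis
    using dirichlet_deriv[of "\<lambda>_. 1", OF one_growth assms] zeta_mult_vm_series[OF assms]
    by (simp add: zeta_def)
qed

text \<open>A termwise antiderivative of \<open>- vm_series\<close>, hence a logarithm of
  \<open>zeta\<close> up to an additive constant, for which no branch has to be chosen. At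
  \<open>n = 1\<close> the coefficient is \<open>0 / 0 = 0\<close>.\<close>

definition log_zeta :: "complex \<Rightarrow> complex" where
  "log_zeta = dirichlet (\<lambda>n. mangoldt n / ln (real n))"

lemma mangoldt_div_ln: "0 \<le> mangoldt n / ln (real n)" "mangoldt n / ln (real n) \<le> 1"
proof -
  have "mangoldt n / ln (real n) \<le> 1 \<and> 0 \<le> mangoldt n / ln (real n)"
  proof (cases "n > 1")
    case True
    then show ?thesis using mangoldt_le[of n] mangoldt_nonneg[of n] by (simp add: divide_simps)
  next
    case False
    then have "n = 0 \<or> n = 1" by auto
    then show ?thesis by auto
  qed
  then show "0 \<le> mangoldt n / ln (real n)" "mangoldt n / ln (real n) \<le> 1" by auto
qed

lemma log_zeta_growth: "\<bar>mangoldt n / ln (real n)\<bar> \<le> 1 + ln (real n)"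
  using mangoldt_div_ln[of n] one_growth[of n] by linarith

lemma log_zeta_deriv:
  assumes "Re s > 1"
  shows "(log_zeta has_field_derivative - vm_series s) (at s)"
proof -
  have *: "- (mangoldt n / ln (real n)) * ln (real n) = - mangoldt n" for n :: nat
  proof (cases "n > 1")
    case False
    then have "n = 0 \<or> n = 1" by auto
    then show ?thesis by auto
  qed simp
  have "dirichlet (\<lambda>n. - mangoldt n) s = - vm_series s"
    using dirichlet_sums[OF mangoldt_growth assms] unfolding dirichlet_def vm_series_def
    by (simp add: sums_iff suminf_minus)
  then show ?thesis
    using dirichlet_deriv[OF log_zeta_growth assms] by (simp only: * log_zeta_def)
qed

lemma zeta_2_nonzero: "zeta 2 \<noteq> 0"
proof -
  have s: "Re 2 > 1" by simp
  have "(\<lambda>n. Re (of_real 1 * (of_nat n :: complex) powr (-2))) sums Re (zeta 2)"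
    using dirichlet_sums[OF one_growth, of 2] unfolding zeta_def by (intro sums_Re) auto
  also have "(\<lambda>n. Re (of_real 1 * (of_nat n :: complex) powr (-2))) = (\<lambda>n. real n powr (-2))"
  proof
    fix n :: nat
    show "Re (of_real 1 * (of_nat n :: complex) powr (-2)) = real n powr (-2)"
    proof -
      have "(of_nat n :: complex) powr (-2) = of_real (real n powr (-2))"
        using powr_of_real[of "real n" "-2"] by simp
      then show ?thesis by simp
    qed
  qed
  finally have *: "(\<lambda>n. real n powr (-2)) sums Re (zeta 2)" .
  have "(\<Sum>n\<in>{1}. real n powr (-2)) \<le> (\<Sum>n. real n powr (-2))"
    by (rule sum_le_suminf) (use * in \<open>auto simp: sums_iff\<close>)
  then have "Re (zeta 2) \<ge> 1" using * by (simp add: sums_iff)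
  then show ?thesis by auto
qed

text \<open>\<open>zeta s * exp (- log_zeta s)\<close> has derivative 0 on a connected half-plane,
  and its constant value is nonzero because \<open>zeta 2\<close> is.\<close>

lemma zeta_eq_exp:
  "\<exists>K. K \<noteq> 0 \<and> (\<forall>s. Re s > 1 \<longrightarrow> zeta s = K * exp (log_zeta s))"
proof -
  let ?S = "{s. Re s > 1}"
  have "(\<lambda>s. zeta s * exp (- log_zeta s)) constant_on ?S"
  proof (rule has_field_derivative_0_imp_constant_on)
    fix s assume "s \<in> ?S"
    then have s: "Re s > 1" by simp
    show "((\<lambda>s. zeta s * exp (- log_zeta s)) has_field_derivative 0) (at s)"
      by (auto intro!: derivative_eq_intros zeta_deriv[OF s] log_zeta_deriv[OF s] simp: algebra_simps)
  qed (auto simp: open_halfspace_Re_gt convex_connected convex_halfspace_Re_gt)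
  then obtain K where K: "\<And>s. Re s > 1 \<Longrightarrow> zeta s * exp (- log_zeta s) = K"
    unfolding constant_on_def by auto
  have "K \<noteq> 0" using K[of 2] zeta_2_nonzero by auto
  moreover have "zeta s = K * exp (log_zeta s)" if "Re s > 1" for s
  proof -
    have "zeta s = zeta s * exp (- log_zeta s) * exp (log_zeta s)"
      by (simp add: exp_minus)
    then show ?thesis unfolding K[OF that] .
  qed
  ultimately show ?thesis by blast
qed

lemma zeta_nonzero:
  assumes "Re s > 1"
  shows "zeta s \<noteq> 0"
proof -
  obtain K where "K \<noteq> 0" "\<And>s. Re s > 1 \<Longrightarrow> zeta s = K * exp (log_zeta s)"
    using zeta_eq_exp by blast
  then show ?thesis using assms by simp
qed

section \<open>The 3-4-1 inequality\<close>

lemma trig_341: "3 + 4 * cos x + cos (2 * x) \<ge> (0::real)"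
proof -
  have "3 + 4 * cos x + cos (2 * x) = 2 * (1 + cos x)\<^sup>2"
    unfolding cos_double_cos by (simp add: power2_eq_square algebra_simps)
  then show ?thesis by simp
qed

lemma Re_nat_powr: "n > 0 \<Longrightarrow> Re ((of_nat n :: complex) powr (- Complex \<sigma> t)) = real n powr (-\<sigma>) * cos (t * ln (real n))"
  by (simp add: powr_def Re_exp Ln_of_nat)

text \<open>The coefficients of \<open>log_zeta\<close> are nonnegative, so the inequality for
  cosines survives summation, with the angle \<open>t * ln n\<close> in the \<open>n\<close>-th
  term.\<close>

lemma log_zeta_341:
  assumes "\<sigma> > 1"
  shows "3 * Re (log_zeta (Complex \<sigma> 0)) + 4 * Re (log_zeta (Complex \<sigma> t)) + Re (log_zeta (Complex \<sigma> (2 * t))) \<ge> 0"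
proof -
  define a where "a = (\<lambda>n::nat. mangoldt n / ln (real n) :: real)"
  define f where "f = (\<lambda>t n. Re (of_real (a n) * (of_nat n :: complex) powr (- Complex \<sigma> t)))"
  have f: "f t sums Re (log_zeta (Complex \<sigma> t))" for t
    unfolding f_def a_def log_zeta_def using assms
    by (intro sums_Re dirichlet_sums log_zeta_growth) auto
  have "(\<lambda>n. 3 * f 0 n + 4 * f t n + f (2 * t) n) sums
     (3 * Re (log_zeta (Complex \<sigma> 0)) + 4 * Re (log_zeta (Complex \<sigma> t)) + Re (log_zeta (Complex \<sigma> (2 * t))))"
    by (intro sums_add sums_mult f)
  moreover have "0 \<le> 3 * f 0 n + 4 * f t n + f (2 * t) n" for n
  proof (cases "n = 0")
    case False
    have "3 * f 0 n + 4 * f t n + f (2 * t) n = a n * real n powr (-\<sigma>) * (3 + 4 * cos (t * ln n) + cos (2 * (t * ln n)))"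
      using False by (simp add: f_def Re_nat_powr algebra_simps)
    also have "\<dots> \<ge> 0"
      using trig_341[of "t * ln n"] mangoldt_div_ln(1)[of n] unfolding a_def by (intro mult_nonneg_nonneg) auto
    finally show ?thesis .
  qed (simp add: f_def)
  ultimately show ?thesis by (rule sums_le[OF _ sums_zero, rotated])
qed

text \<open>Exponentiation of \<open>log_zeta_341\<close>. The weights 3, 4 and 1 add up to 8,
  whence the constant \<open>norm K ^ 8\<close>.\<close>

lemma zeta_341:
  "\<exists>c>0. \<forall>\<sigma>>1. \<forall>t.
    norm (zeta (Complex \<sigma> 0)) ^ 3 * norm (zeta (Complex \<sigma> t)) ^ 4 * norm (zeta (Complex \<sigma> (2 * t))) \<ge> c"
proof -
  obtain K where K: "K \<noteq> 0" "\<And>s. Re s > 1 \<Longrightarrow> zeta s = K * exp (log_zeta s)"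
    using zeta_eq_exp by blast
  have "norm (zeta (Complex \<sigma> 0)) ^ 3 * norm (zeta (Complex \<sigma> t)) ^ 4 * norm (zeta (Complex \<sigma> (2 * t))) \<ge> norm K ^ 8"
    if "\<sigma> > 1" for \<sigma> t
  proof -
    let ?r = "\<lambda>t. Re (log_zeta (Complex \<sigma> t))"
    have "norm (zeta (Complex \<sigma> t)) = norm K * exp (?r t)" for t
      using K(2)[of "Complex \<sigma> t"] that by (simp add: norm_mult)
    then have "norm (zeta (Complex \<sigma> 0)) ^ 3 * norm (zeta (Complex \<sigma> t)) ^ 4 * norm (zeta (Complex \<sigma> (2 * t)))
       = (norm K * exp (?r 0)) ^ 3 * (norm K * exp (?r t)) ^ 4 * (norm K * exp (?r (2 * t)))"
      by simp
    also have "\<dots> = norm K ^ 8 * (exp (?r 0) ^ 3 * exp (?r t) ^ 4 * exp (?r (2 * t)))"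
    proof -
      have "(k * a) ^ 3 * (k * b) ^ 4 * (k * c) = k ^ 8 * (a ^ 3 * b ^ 4 * c)" for k a b c :: real
        by (simp add: power_mult_distrib eval_nat_numeral mult_ac)
      then show ?thesis .
    qed
    also have "exp (?r 0) ^ 3 * exp (?r t) ^ 4 * exp (?r (2 * t)) = exp (3 * ?r 0 + 4 * ?r t + ?r (2 * t))"
      using exp_of_nat_mult[of 3 "?r 0"] exp_of_nat_mult[of 4 "?r t"] by (simp add: exp_add)
    also have "norm K ^ 8 * \<dots> \<ge> norm K ^ 8 * 1"
      using log_zeta_341[OF that, of t] by (intro mult_left_mono) auto
    finally show ?thesis by simp
  qed
  then show ?thesis using K(1) by (intro exI[of _ "norm K ^ 8"]) auto
qed

section \<open>The function (s - 1) zeta(s) up to the line Re s = 1\<close>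

definition zeta_reg_term :: "nat \<Rightarrow> complex \<Rightarrow> complex" where
  "zeta_reg_term n s = (s - 1) * of_nat (Suc n) powr (-s) + of_nat (Suc (Suc n)) powr (1 - s) - of_nat (Suc n) powr (1 - s)"

lemma closed_segment_complex_of_real:
  assumes "z \<in> closed_segment (complex_of_real a) (of_real b)" "a \<le> b"
  shows "\<exists>x. z = of_real x \<and> a \<le> x \<and> x \<le> b"
proof -
  have "closed_segment (complex_of_real a) (of_real b) = of_real ` {a..b}"
    using assms(2) by (simp only: closed_segment_of_real closed_segment_eq_real_ivl if_True)
  then show ?thesis using assms(1) by auto
qed

lemma powr_diff_bound:
  assumes "0 < a" "a \<le> x" "Re s > 0"
  shows "norm (of_real x powr (-s) - of_real a powr (-s)) \<le> norm s * a powr (- Re s - 1) * (x - a)"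
proof -
  have "norm (of_real x powr (-s) - of_real a powr (-s)) \<le> norm s * a powr (- Re s - 1) * norm (of_real x - of_real a :: complex)"
  proof (rule field_differentiable_bound[of "closed_segment (of_real a) (of_real x)" _ "\<lambda>z. -s * z powr (-s - 1)"])
    fix z :: complex assume "z \<in> closed_segment (of_real a) (of_real x)"
    then obtain y where y: "z = of_real y" "a \<le> y" "y \<le> x"
      using closed_segment_complex_of_real assms(2) by blast
    have "z \<notin> \<real>\<^sub>\<le>\<^sub>0" using y assms by auto
    then show "((\<lambda>z. z powr (-s)) has_field_derivative -s * z powr (-s - 1)) (at z within closed_segment (of_real a) (of_real x))"
      by (rule has_field_derivative_at_within[OF has_field_derivative_powr])
    have "norm (z powr (-s - 1)) = y powr (- Re s - 1)"
      using y assms by (simp add: norm_powr_real_powr)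
    also have "\<dots> \<le> a powr (- Re s - 1)"
      using y assms by (intro powr_mono2') auto
    finally show "norm (-s * z powr (-s - 1)) \<le> norm s * a powr (- Re s - 1)"
      by (simp add: norm_mult mult_left_mono)
  qed auto
  also have "norm (of_real x - of_real a :: complex) = x - a"
    using assms by (simp flip: of_real_diff)
  finally show ?thesis .
qed

lemma zeta_reg_term_bound:
  assumes "Re s > 0"
  shows "norm (zeta_reg_term n s) \<le> norm (s - 1) * norm s * real (Suc n) powr (- Re s - 1)"
proof -
  define a where "a = real (Suc n)"
  have a: "a \<ge> 1" by (simp add: a_def)
  \<comment> \<open>The increment of this function over [a, a + 1] is
    \<open>zeta_reg_term n s\<close>, and its derivative is \<open>s - 1\<close> times a difference
    of nearby values of \<open>z powr (-s)\<close>. The mean value inequality therefore gains a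
    factor 1/a.\<close>
  define \<phi> where "\<phi> = (\<lambda>x. (s - 1) * (x - of_real a) * of_real a powr (-s) + x powr (1 - s))"
  have "norm (\<phi> (of_real (a + 1)) - \<phi> (of_real a)) \<le> norm (s - 1) * (norm s * a powr (- Re s - 1)) * norm (of_real (a + 1) - of_real a :: complex)"
  proof (rule field_differentiable_bound[of "closed_segment (of_real a) (of_real (a + 1))" _ "\<lambda>z. (s - 1) * (of_real a powr (-s) - z powr (-s))"])
    fix z :: complex assume "z \<in> closed_segment (of_real a) (of_real (a + 1))"
    then obtain y where y: "z = of_real y" "a \<le> y" "y \<le> a + 1"
      using closed_segment_complex_of_real[of z a "a + 1"] by auto
    have "z \<notin> \<real>\<^sub>\<le>\<^sub>0" using y a by auto
    then have "(\<phi> has_field_derivative (s - 1) * (of_real a powr (-s) - z powr (-s))) (at z)"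
      unfolding \<phi>_def by (auto intro!: derivative_eq_intros simp: algebra_simps)
    then show "(\<phi> has_field_derivative (s - 1) * (of_real a powr (-s) - z powr (-s))) (at z within closed_segment (of_real a) (of_real (a + 1)))"
      by (rule has_field_derivative_at_within)
    have "norm (of_real a powr (-s) - z powr (-s)) \<le> norm s * a powr (- Re s - 1) * (y - a)"
      using powr_diff_bound[of a y s] y a assms by (simp add: norm_minus_commute)
    also have "\<dots> \<le> norm s * a powr (- Re s - 1) * 1"
      using y by (intro mult_left_mono) auto
    finally show "norm ((s - 1) * (of_real a powr (-s) - z powr (-s))) \<le> norm (s - 1) * (norm s * a powr (- Re s - 1))"
      by (simp add: norm_mult mult_left_mono)
  qed auto
  also have "\<phi> (of_real (a + 1)) - \<phi> (of_real a) = zeta_reg_term n s"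
  proof -
    have "of_nat (Suc n) = (of_real a :: complex)" "of_nat (Suc (Suc n)) = (of_real (a + 1) :: complex)"
      by (simp_all add: a_def)
    then show ?thesis unfolding \<phi>_def zeta_reg_term_def by (simp add: add_ac)
  qed
  finally show ?thesis by (simp add: a_def mult_ac)
qed

lemma summable_Z_maj: "summable (\<lambda>n. real (Suc n) powr (-3/2))"
proof -
  have "summable (\<lambda>n. real n powr (-3/2))" by (simp add: summable_real_powr_iff)
  then show ?thesis using summable_Suc_iff[of "\<lambda>n. real n powr (-3/2)"] by blast
qed

text \<open>This is (s - 1) zeta(s): \<open>zeta_reg_term n s\<close> is \<open>s - 1\<close> times
  the integral of \<open>(n + 1) powr (-s) - x powr (-s)\<close> over [n + 1, n + 2], which compares
  the series with an integral. For \<open>Re s > 1\<close> the differences of powers with exponent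
  \<open>1 - s\<close> telescope to -1, and the leading 1 compensates for that.\<close>

definition zeta_reg :: "complex \<Rightarrow> complex" where "zeta_reg s = 1 + (\<Sum>n. zeta_reg_term n s)"

lemma zeta_reg_term_bound':
  assumes "Re s \<ge> 1/2"
  shows "norm (zeta_reg_term n s) \<le> norm (s - 1) * norm s * real (Suc n) powr (-3/2)"
proof -
  have "real (Suc n) powr (- Re s - 1) \<le> real (Suc n) powr (-3/2)"
    using assms by (intro powr_mono) auto
  then have "norm (s - 1) * norm s * real (Suc n) powr (- Re s - 1) \<le> norm (s - 1) * norm s * real (Suc n) powr (-3/2)"
    by (rule mult_left_mono) simp
  then show ?thesis
    using zeta_reg_term_bound[of s n] assms by linarith
qed

text \<open>One of the two linear factors is explicit in the terms, the other comes from
  differentiating \<open>x powr (-s)\<close>. The half-plane extends to 1/2 so that discs around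
  points of the line \<open>Re s = 1\<close> fit inside it.\<close>

lemma zeta_reg_growth: "\<exists>C>0. \<forall>s. Re s \<ge> 1/2 \<longrightarrow> norm (zeta_reg s) \<le> 1 + C * norm (s - 1) * norm s"
proof -
  define C where "C = (\<Sum>n. real (Suc n) powr (-3/2))"
  have "C > 0" unfolding C_def by (rule suminf_pos[OF summable_Z_maj]) auto
  moreover have "norm (zeta_reg s) \<le> 1 + C * norm (s - 1) * norm s" if "Re s \<ge> 1/2" for s
  proof -
    have sm: "summable (\<lambda>n. norm (s - 1) * norm s * real (Suc n) powr (-3/2))"
      by (intro summable_mult summable_Z_maj)
    have "norm (\<Sum>n. zeta_reg_term n s) \<le> (\<Sum>n. norm (s - 1) * norm s * real (Suc n) powr (-3/2))"
      by (rule norm_suminf_le[OF zeta_reg_term_bound'[OF that] sm])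
    also have "\<dots> = norm (s - 1) * norm s * C"
      unfolding C_def by (rule suminf_mult[OF summable_Z_maj])
    finally have "norm (\<Sum>n. zeta_reg_term n s) \<le> norm (s - 1) * norm s * C" .
    then show ?thesis unfolding zeta_reg_def
      by (intro order.trans[OF norm_triangle_ineq]) (simp add: mult_ac)
  qed
  ultimately show ?thesis by blast
qed

lemma zeta_reg_1 [simp]: "zeta_reg 1 = 1"
  by (simp add: zeta_reg_def zeta_reg_term_def del: of_nat_Suc)

lemma zeta_reg_holomorphic: "zeta_reg holomorphic_on {s. Re s > 1/2}"
proof -
  let ?S = "{s::complex. Re s > 1/2}"
  define Z_term' where "Z_term' = (\<lambda>n. deriv (zeta_reg_term n))"
  have opn: "open ?S" by (rule open_halfspace_Re_gt)
  have "\<exists>g g'. \<forall>x\<in>?S. (\<lambda>n. zeta_reg_term n x) sums g x \<and> (\<lambda>n. Z_term' n x) sums g' x \<and> (g has_field_derivative g' x) (at x)"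
  proof (rule series_and_derivative_comparison_local[OF opn])
    fix n x
    show "(zeta_reg_term n has_field_derivative Z_term' n x) (at x)"
      unfolding Z_term'_def
      by (intro holomorphic_derivI[of _ UNIV]) (auto simp: zeta_reg_term_def[abs_def] intro!: holomorphic_intros)
  next
    fix x :: complex
    assume "x \<in> ?S"
    have "norm (zeta_reg_term n y) \<le> (norm x + 2) * (norm x + 2) * real (Suc n) powr (-3/2)" if y: "y \<in> ball x 1 \<inter> ?S" for y n
    proof -
      have "norm y \<le> norm x + 1" using y norm_triangle_ineq4[of x "x - y"] by (auto simp: dist_norm)
      moreover have "norm (y - 1) \<le> norm y + 1" using norm_triangle_ineq4[of y 1] by simp
      ultimately have "norm (y - 1) * norm y * real (Suc n) powr (-3/2) \<le> (norm x + 2) * (norm x + 2) * real (Suc n) powr (-3/2)"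
        by (intro mult_right_mono mult_mono) auto
      moreover have "Re y \<ge> 1/2" using y by simp
      ultimately show ?thesis using order.trans[OF zeta_reg_term_bound'] by blast
    qed
    then show "\<exists>d h. 0 < d \<and> summable h \<and> (\<forall>\<^sub>F n in sequentially. \<forall>y\<in>ball x d \<inter> ?S. norm (zeta_reg_term n y) \<le> h n)"
      by (intro exI[of _ 1] exI[of _ "\<lambda>n. (norm x + 2) * (norm x + 2) * real (Suc n) powr (-3/2)"] conjI always_eventually summable_mult summable_Z_maj) auto
  qed
  then obtain g g' where g: "\<And>x. x \<in> ?S \<Longrightarrow> (\<lambda>n. zeta_reg_term n x) sums g x" "\<And>x. x \<in> ?S \<Longrightarrow> (g has_field_derivative g' x) (at x)"
    by blast
  have "(\<lambda>x. 1 + g x) holomorphic_on ?S"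
    using g(2) opn by (intro holomorphic_intros) (auto simp: holomorphic_on_open)
  moreover have "1 + g x = zeta_reg x" if "x \<in> ?S" for x
    using g(1)[OF that] by (simp add: zeta_reg_def sums_iff)
  ultimately show ?thesis by (rule holomorphic_transform)
qed

lemma zeta_reg_eq_zeta:
  assumes s: "Re s > 1"
  shows "zeta_reg s = (s - 1) * zeta s"
proof -
  have "(\<lambda>n. of_real 1 * (of_nat n :: complex) powr (-s)) sums zeta s"
    unfolding zeta_def by (rule dirichlet_sums[OF one_growth s])
  then have "(\<lambda>n. (of_nat n :: complex) powr (-s)) sums zeta s" by simp
  then have 1: "(\<lambda>n. (of_nat (Suc n) :: complex) powr (-s)) sums zeta s"
    using sums_Suc_iff[of "\<lambda>n. (of_nat n :: complex) powr (-s)" "zeta s"] by simp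
  have "(\<lambda>n. (of_nat (Suc n) :: complex) powr (1 - s)) \<longlonglongrightarrow> 0"
  proof (rule tendsto_norm_zero_cancel)
    have "(\<lambda>n. real (Suc n) powr (1 - Re s)) \<longlonglongrightarrow> 0"
      using s by real_asymp
    then show "(\<lambda>n. norm ((of_nat (Suc n) :: complex) powr (1 - s))) \<longlonglongrightarrow> 0"
      by (simp only: norm_nat_powr) simp
  qed
  from telescope_sums[OF this]
  have "(\<lambda>n. of_nat (Suc (Suc n)) powr (1 - s) - of_nat (Suc n) powr (1 - s)) sums (0 - 1)"
    by simp
  from sums_add[OF sums_mult[OF 1, of "s - 1"] \<open>(\<lambda>n. of_nat (Suc (Suc n)) powr (1 - s) - of_nat (Suc n) powr (1 - s)) sums (0 - 1)\<close>]
  have "(\<lambda>n. zeta_reg_term n s) sums ((s - 1) * zeta s - 1)"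
    by (simp add: zeta_reg_term_def[abs_def] algebra_simps)
  then show ?thesis by (simp add: zeta_reg_def sums_iff)
qed

text \<open>Cauchy estimates on discs of radius 1/4, which keep the real part above 1/2. The factor
  32 is \<open>fact 2 * 4 ^ 2\<close>, from the second derivative.\<close>

lemma zeta_reg_deriv_bounds:
  "\<exists>C\<ge>1. \<forall>s. 1 \<le> Re s \<and> Re s \<le> 2 \<longrightarrow>
     norm (zeta_reg s) \<le> C * (1 + \<bar>Im s\<bar>)\<^sup>2 \<and>
     norm (deriv zeta_reg s) \<le> C * (1 + \<bar>Im s\<bar>)\<^sup>2 \<and>
     norm (deriv (deriv zeta_reg) s) \<le> C * (1 + \<bar>Im s\<bar>)\<^sup>2"
proof -
  obtain C where C: "C > 0" "\<And>s. Re s \<ge> 1/2 \<Longrightarrow> norm (zeta_reg s) \<le> 1 + C * norm (s - 1) * norm s"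
    using zeta_reg_growth by blast
  \<comment> \<open>12 is the product of the factors in \<open>norm (w - 1) \<le> 4 * q\<close> and
    \<open>norm w \<le> 3 * q\<close> below; 2 in place of 1 makes the inequality strict, as
    membership in an open ball requires.\<close>
  define B where "B = 2 + 12 * C"
  have B: "B > 0" using C by (simp add: B_def)
  have "norm (zeta_reg s) \<le> 32 * B * (1 + \<bar>Im s\<bar>)\<^sup>2 \<and>
     norm (deriv zeta_reg s) \<le> 32 * B * (1 + \<bar>Im s\<bar>)\<^sup>2 \<and>
     norm (deriv (deriv zeta_reg) s) \<le> 32 * B * (1 + \<bar>Im s\<bar>)\<^sup>2"
    if s: "1 \<le> Re s" "Re s \<le> 2" for s
  proof -
    define q where "q = 1 + \<bar>Im s\<bar>"
    have q: "q \<ge> 1" by (simp add: q_def)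
    then have q2: "q\<^sup>2 \<ge> 1" by simp
    have near: "Re w > 1/2" "norm (zeta_reg w) < B * q\<^sup>2" if w: "w \<in> cball s (1/4)" for w
    proof -
      have d: "norm (s - w) \<le> 1/4" using w by (simp add: dist_norm)
      then have re: "\<bar>Re (s - w)\<bar> \<le> 1/4" and im: "\<bar>Im (s - w)\<bar> \<le> 1/4"
        using abs_Re_le_cmod[of "s - w"] abs_Im_le_cmod[of "s - w"] by linarith+
      then show r: "Re w > 1/2" using s unfolding minus_complex.sel by linarith
      have "norm w \<le> \<bar>Re w\<bar> + \<bar>Im w\<bar>" by (rule cmod_le)
      moreover have "\<bar>Re w\<bar> \<le> 9/4" "\<bar>Im w\<bar> \<le> \<bar>Im s\<bar> + 1/4"
        using re im s unfolding minus_complex.sel by linarith+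
      ultimately have w3: "norm w \<le> 3 * q" by (simp add: q_def)
      then have w4: "norm (w - 1) \<le> 4 * q"
        using norm_triangle_ineq4[of w 1] q by simp
      have "C * (norm (w - 1) * norm w) \<le> C * (4 * q * (3 * q))"
        using C(1) w3 w4 q by (intro mult_left_mono mult_mono) auto
      then have "norm (zeta_reg w) \<le> 1 + 12 * C * q\<^sup>2"
        using C(2)[of w] r by (simp add: power2_eq_square algebra_simps)
      then show "norm (zeta_reg w) < B * q\<^sup>2"
        using q2 unfolding B_def distrib_right by linarith
    qed
    have hol: "zeta_reg holomorphic_on cball s (1/4)"
      by (rule holomorphic_on_subset[OF zeta_reg_holomorphic]) (use near in auto)
    have b: "cmod ((deriv ^^ n) zeta_reg s) \<le> fact n * (B * q\<^sup>2) / (1/4) ^ n" if "n > 0" for n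
    proof (rule Cauchy_higher_deriv_bound[of zeta_reg s "1/4" 0])
      show "zeta_reg holomorphic_on ball s (1/4)" by (rule holomorphic_on_subset[OF hol]) auto
      show "continuous_on (cball s (1/4)) zeta_reg" by (rule holomorphic_on_imp_continuous_on[OF hol])
      show "zeta_reg w \<in> ball 0 (B * q\<^sup>2)" if "w \<in> ball s (1/4)" for w
        using near(2)[of w] that by simp
    qed (use that in auto)
    have Bq: "B * q\<^sup>2 \<ge> 0" using B by simp
    have "norm (deriv zeta_reg s) \<le> 4 * (B * q\<^sup>2)"
      using b[of 1] by simp
    moreover have "norm (deriv (deriv zeta_reg) s) \<le> 32 * (B * q\<^sup>2)"
      using b[of 2] by (simp add: numeral_2_eq_2)
    ultimately show ?thesis
      using near(2)[of s] Bq unfolding q_def[symmetric] mult.assoc by auto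
  qed
  moreover have "32 * B \<ge> 1" using C(1) by (simp add: B_def)
  ultimately show ?thesis by blast
qed

section \<open>A polynomial lower bound for (s - 1) zeta(s)\<close>

lemma holomorphic_mvt_horizontal:
  assumes "f holomorphic_on A" "open A" "\<And>x. a \<le> x \<Longrightarrow> x \<le> b \<Longrightarrow> Complex x t \<in> A"
    "\<And>x. a \<le> x \<Longrightarrow> x \<le> b \<Longrightarrow> norm (deriv f (Complex x t)) \<le> B" "a \<le> b"
  shows "norm (f (Complex b t) - f (Complex a t)) \<le> B * (b - a)"
proof -
  have seg: "\<exists>x. z = Complex x t \<and> a \<le> x \<and> x \<le> b" if "z \<in> closed_segment (Complex a t) (Complex b t)" for z
  proof -
    from that obtain u where u: "0 \<le> u" "u \<le> 1" "z = (1 - u) *\<^sub>R Complex a t + u *\<^sub>R Complex b t"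
      by (auto simp: in_segment)
    have "z = Complex (a + u * (b - a)) t"
      by (auto simp: u(3) complex_eq_iff algebra_simps)
    moreover have "u * (b - a) \<le> 1 * (b - a)" "0 \<le> u * (b - a)"
      using u assms(5) by (intro mult_right_mono mult_nonneg_nonneg; simp)+
    ultimately show ?thesis by (intro exI[of _ "a + u * (b - a)"]) auto
  qed
  have "norm (f (Complex b t) - f (Complex a t)) \<le> B * norm (Complex b t - Complex a t)"
  proof (rule field_differentiable_bound[of "closed_segment (Complex a t) (Complex b t)" f "deriv f"])
    fix z assume "z \<in> closed_segment (Complex a t) (Complex b t)"
    then obtain x where x: "z = Complex x t" "a \<le> x" "x \<le> b" using seg by blast
    then have "z \<in> A" using assms(3) by blast
    then show "(f has_field_derivative deriv f z) (at z within closed_segment (Complex a t) (Complex b t))"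
      by (intro has_field_derivative_at_within[OF holomorphic_derivI[OF assms(1,2)]])
    show "norm (deriv f z) \<le> B" using assms(4)[OF x(2,3)] x(1) by simp
  qed auto
  also have "norm (Complex b t - Complex a t) = b - a"
    using assms(5) by (simp add: complex_diff norm_complex_def)
  finally show ?thesis .
qed

text \<open>Near 1 the 3-4-1 inequality degenerates, because \<open>zeta_reg\<close> carries the
  factor \<open>s - 1\<close>. Continuity and the value 1 at the point 1 cover this disc
  instead.\<close>

lemma zeta_reg_near_1: "\<exists>r>0. r \<le> 1 \<and> (\<forall>s. norm (s - 1) < r \<longrightarrow> norm (zeta_reg s) \<ge> 1/2)"
proof -
  have "isCont zeta_reg 1"
    using holomorphic_on_imp_continuous_on[OF zeta_reg_holomorphic] open_halfspace_Re_gt[of "1/2"]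
    by (auto simp: continuous_on_eq_continuous_at)
  then obtain d where d: "d > 0" "\<And>s. dist s 1 < d \<Longrightarrow> dist (zeta_reg s) (zeta_reg 1) < 1/2"
    unfolding continuous_at_eps_delta by (metis half_gt_zero zero_less_one)
  have "norm (zeta_reg s) \<ge> 1/2" if "norm (s - 1) < min d 1" for s
  proof -
    have "norm (zeta_reg s - 1) < 1/2" using d(2)[of s] that by (simp add: dist_norm)
    then show ?thesis using norm_triangle_ineq3[of "zeta_reg s" 1] by simp
  qed
  then show ?thesis using d(1) by (intro exI[of _ "min d 1"]) auto
qed

lemma zeta_reg_341:
  "\<exists>c>0. \<forall>\<sigma> t. 1 < \<sigma> \<and> \<sigma> \<le> 2 \<and> r \<le> norm (Complex \<sigma> t - 1) \<longrightarrow>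
     norm (zeta_reg (Complex \<sigma> t)) ^ 4 \<ge> c * (\<sigma> - 1) ^ 3 / (1 + \<bar>t\<bar>)\<^sup>2" if r: "r > 0"
proof -
  obtain k where k: "k > 0" "\<And>\<sigma> t. \<sigma> > 1 \<Longrightarrow>
    norm (zeta (Complex \<sigma> 0)) ^ 3 * norm (zeta (Complex \<sigma> t)) ^ 4 * norm (zeta (Complex \<sigma> (2 * t))) \<ge> k"
    using zeta_341 by blast
  obtain C where C: "C \<ge> 1" "\<And>s. 1 \<le> Re s \<Longrightarrow> Re s \<le> 2 \<Longrightarrow> norm (zeta_reg s) \<le> C * (1 + \<bar>Im s\<bar>)\<^sup>2"
    using zeta_reg_deriv_bounds by blast
  \<comment> \<open>\<open>r ^ 5\<close> bounds from below the factors \<open>norm (s - 1)\<close>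
    at height \<open>t\<close> (to the fourth power) and at height \<open>2 * t\<close>. In the
    denominator, \<open>C ^ 3\<close> belongs to height 0 and \<open>4 * C\<close> to height
    \<open>2 * t\<close>.\<close>
  define c where "c = k * r ^ 5 / (4 * C ^ 4)"
  have c: "c > 0" using k C r by (simp add: c_def)
  have "c * (\<sigma> - 1) ^ 3 / (1 + \<bar>t\<bar>)\<^sup>2 \<le> norm (zeta_reg (Complex \<sigma> t)) ^ 4"
    if s: "1 < \<sigma>" "\<sigma> \<le> 2" "r \<le> norm (Complex \<sigma> t - 1)" for \<sigma> t
  proof -
    define q where "q = 1 + \<bar>t\<bar>"
    have q: "q \<ge> 1" by (simp add: q_def)
    define A where "A = norm (zeta_reg (Complex \<sigma> t))"
    have Z: "norm (zeta_reg (Complex \<sigma> y)) = norm (Complex \<sigma> y - 1) * norm (zeta (Complex \<sigma> y))" for y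
      using s zeta_reg_eq_zeta[of "Complex \<sigma> y"] by (simp add: norm_mult)
    have n0: "norm (Complex \<sigma> 0 - 1) = \<sigma> - 1"
      using s by (simp add: cmod_def)
    have n2: "norm (Complex \<sigma> (2 * t) - 1) \<ge> r"
    proof (rule order.trans[OF s(3)])
      have "t\<^sup>2 \<le> (2 * t)\<^sup>2" by (simp add: power_mult_distrib)
      then show "norm (Complex \<sigma> t - 1) \<le> norm (Complex \<sigma> (2 * t) - 1)" by (simp add: cmod_def)
    qed
    have b0: "norm (zeta_reg (Complex \<sigma> 0)) \<le> C" using C(2)[of "Complex \<sigma> 0"] s by simp
    have "norm (zeta_reg (Complex \<sigma> (2 * t))) \<le> C * (1 + \<bar>2 * t\<bar>)\<^sup>2"
      using C(2)[of "Complex \<sigma> (2 * t)"] s by simp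
    also have "\<dots> \<le> C * (2 * q)\<^sup>2"
      using C(1) by (intro mult_left_mono power_mono) (auto simp: q_def)
    finally have b2: "norm (zeta_reg (Complex \<sigma> (2 * t))) \<le> 4 * C * q\<^sup>2" by (simp add: power_mult_distrib)
    have "k * ((\<sigma> - 1) ^ 3 * norm (Complex \<sigma> t - 1) ^ 4 * norm (Complex \<sigma> (2 * t) - 1))
       \<le> norm (zeta (Complex \<sigma> 0)) ^ 3 * norm (zeta (Complex \<sigma> t)) ^ 4 * norm (zeta (Complex \<sigma> (2 * t)))
         * ((\<sigma> - 1) ^ 3 * norm (Complex \<sigma> t - 1) ^ 4 * norm (Complex \<sigma> (2 * t) - 1))"
      using s by (intro mult_right_mono k(2)) auto
    also have "\<dots> = norm (zeta_reg (Complex \<sigma> 0)) ^ 3 * A ^ 4 * norm (zeta_reg (Complex \<sigma> (2 * t)))"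
      unfolding A_def Z n0 power_mult_distrib by (simp add: mult_ac)
    also have "\<dots> \<le> C ^ 3 * A ^ 4 * (4 * C * q\<^sup>2)"
      using b0 b2 C(1) by (intro mult_mono power_mono) (auto simp: A_def)
    finally have "k * ((\<sigma> - 1) ^ 3 * norm (Complex \<sigma> t - 1) ^ 4 * norm (Complex \<sigma> (2 * t) - 1))
       \<le> C ^ 3 * A ^ 4 * (4 * C * q\<^sup>2)" .
    moreover have "k * ((\<sigma> - 1) ^ 3 * r ^ 4 * r) \<le> k * ((\<sigma> - 1) ^ 3 * norm (Complex \<sigma> t - 1) ^ 4 * norm (Complex \<sigma> (2 * t) - 1))"
      using k(1) s r n2 by (intro mult_left_mono mult_mono power_mono) auto
    ultimately have "k * ((\<sigma> - 1) ^ 3 * r ^ 4 * r) \<le> C ^ 3 * A ^ 4 * (4 * C * q\<^sup>2)" by linarith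
    moreover have "C ^ 3 * A ^ 4 * (4 * C * q\<^sup>2) = A ^ 4 * (4 * C ^ 4 * q\<^sup>2)"
      by (simp add: eval_nat_numeral)
    moreover have "k * ((\<sigma> - 1) ^ 3 * r ^ 4 * r) = k * r ^ 5 * (\<sigma> - 1) ^ 3"
      by (simp add: eval_nat_numeral)
    ultimately have "k * r ^ 5 * (\<sigma> - 1) ^ 3 \<le> A ^ 4 * (4 * C ^ 4 * q\<^sup>2)" by simp
    then show ?thesis
      using C(1) q unfolding c_def A_def[symmetric] q_def[symmetric]
      by (simp add: field_simps)
  qed
  then show ?thesis using c by blast
qed

text \<open>At distance at least \<eta>^4 from the line the 3-4-1 inequality gives a lower bound.
  Nearer to the line, the value is compared with the point of the same height at distance exactly
  \<eta>^4. The derivative bound makes this cost at most half of the lower bound there.\<close>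

lemma zeta_reg_lower: "\<exists>c>0. \<forall>s. 1 < Re s \<and> Re s \<le> 2 \<longrightarrow> norm (zeta_reg s) \<ge> c / (1 + \<bar>Im s\<bar>) ^ 10"
proof -
  obtain r where r: "r > 0" "r \<le> 1" "\<And>s. norm (s - 1) < r \<Longrightarrow> norm (zeta_reg s) \<ge> 1/2"
    using zeta_reg_near_1 by blast
  obtain c where c: "c > 0" "\<And>\<sigma> t. 1 < \<sigma> \<Longrightarrow> \<sigma> \<le> 2 \<Longrightarrow> r \<le> norm (Complex \<sigma> t - 1) \<Longrightarrow>
     norm (zeta_reg (Complex \<sigma> t)) ^ 4 \<ge> c * (\<sigma> - 1) ^ 3 / (1 + \<bar>t\<bar>)\<^sup>2"
    using zeta_reg_341[OF r(1)] by blast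
  obtain C where C: "C \<ge> 1" "\<And>s. 1 \<le> Re s \<Longrightarrow> Re s \<le> 2 \<Longrightarrow> norm (deriv zeta_reg s) \<le> C * (1 + \<bar>Im s\<bar>)\<^sup>2"
    using zeta_reg_deriv_bounds by blast
  define a where "a = min 1 (c / (16 * C ^ 4))"
  have a: "0 < a" "a \<le> 1" "16 * C ^ 4 * a ^ 4 \<le> c"
  proof -
    show a0: "0 < a" "a \<le> 1" using c C by (auto simp: a_def)
    have "a ^ 4 \<le> a" using a0 power_decreasing[of 1 4 a] by simp
    also have "\<dots> \<le> c / (16 * C ^ 4)" by (simp add: a_def)
    finally show "16 * C ^ 4 * a ^ 4 \<le> c" using C(1) by (simp add: field_simps)
  qed
  have "norm (zeta_reg s) \<ge> (C * a ^ 4 / 2) / (1 + \<bar>Im s\<bar>) ^ 10 \<or> norm (zeta_reg s) \<ge> 1/2" if s: "1 < Re s" "Re s \<le> 2" for s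
  proof (cases "norm (s - 1) < r")
    case True
    then show ?thesis using r(3) by blast
  next
    case False
    define t where "t = Im s"
    define q where "q = 1 + \<bar>t\<bar>"
    have q: "q \<ge> 1" by (simp add: q_def)
    \<comment> \<open>Taking the critical distance as a fourth power avoids roots when fourth powers
      are compared. That comparison requires \<eta>^16 q^8 to be at most a constant times \<eta>^12
      / q^2, that is, \<eta>^4 q^10 to be bounded. The choice a / q^3 achieves this and makes the
      lower bound \<eta>^4 q^2 of order 1 / q^10.\<close>
    define \<eta> where "\<eta> = a / q ^ 3"
    have \<eta>: "0 < \<eta>" "\<eta> \<le> 1"
      using a q order.trans[OF a(2) one_le_power[of q 3]] by (auto simp: \<eta>_def field_simps)
    have e4: "0 < \<eta> ^ 4" "\<eta> ^ 4 \<le> 1"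
      using \<eta> by (auto simp: power_le_one)
    have key: "2 * C * \<eta> ^ 4 * q\<^sup>2 \<le> norm (zeta_reg (Complex \<sigma> t))"
      if \<sigma>: "1 + \<eta> ^ 4 \<le> \<sigma>" "\<sigma> \<le> 2" "r \<le> norm (Complex \<sigma> t - 1)" for \<sigma>
    proof (rule power_le_imp_le_base[of _ 3])
      have "(2 * C * \<eta> ^ 4 * q\<^sup>2) ^ 4 = 16 * C ^ 4 * (\<eta> ^ 4 * q ^ 10) * \<eta> ^ 12 / q\<^sup>2"
        using q by (simp add: power_mult_distrib flip: power_mult power_add) (simp add: field_simps flip: power_add)
      also have "\<eta> ^ 4 * q ^ 10 = a ^ 4 / q\<^sup>2"
        using q by (simp add: \<eta>_def power_divide flip: power_mult) (simp add: field_simps flip: power_add)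
      also have "16 * C ^ 4 * (a ^ 4 / q\<^sup>2) * \<eta> ^ 12 / q\<^sup>2 \<le> c * \<eta> ^ 12 / q\<^sup>2"
      proof (intro divide_right_mono mult_right_mono)
        have "16 * C ^ 4 * (a ^ 4 / q\<^sup>2) = 16 * C ^ 4 * a ^ 4 / q\<^sup>2" by simp
        also have "\<dots> \<le> 16 * C ^ 4 * a ^ 4 / 1"
          using q a C(1) by (intro divide_left_mono) auto
        finally show "16 * C ^ 4 * (a ^ 4 / q\<^sup>2) \<le> c" using a(3) by simp
      qed (use \<eta> q in auto)
      also have "\<dots> = c * (\<eta> ^ 4) ^ 3 / q\<^sup>2" by (simp flip: power_mult)
      also have "\<dots> \<le> c * (\<sigma> - 1) ^ 3 / q\<^sup>2"
        using \<sigma> c(1) e4 q by (intro divide_right_mono mult_left_mono power_mono) auto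
      also have "\<dots> \<le> norm (zeta_reg (Complex \<sigma> t)) ^ 4"
        using c(2)[of \<sigma> t] \<sigma> e4 unfolding q_def by simp
      finally show "(2 * C * \<eta> ^ 4 * q\<^sup>2) ^ Suc 3 \<le> norm (zeta_reg (Complex \<sigma> t)) ^ Suc 3"
        by (simp add: numeral_eq_Suc)
    qed simp
    have sC: "s = Complex (Re s) t" by (simp add: t_def)
    have "C * \<eta> ^ 4 * q\<^sup>2 \<le> norm (zeta_reg s)"
    proof (cases "1 + \<eta> ^ 4 \<le> Re s")
      case True
      have "2 * (C * \<eta> ^ 4 * q\<^sup>2) \<le> norm (zeta_reg s)"
        using key[of "Re s"] True False s sC by (simp add: mult.assoc)
      moreover have "0 \<le> C * \<eta> ^ 4 * q\<^sup>2" using C(1) e4 by simp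
      ultimately show ?thesis by linarith
    next
      case less: False
      define \<sigma> where "\<sigma> = 1 + \<eta> ^ 4"
      have "norm (s - 1) \<le> norm (Complex \<sigma> t - 1)"
      proof -
        have "(Re s - 1)\<^sup>2 \<le> (\<sigma> - 1)\<^sup>2" using less s by (intro power_mono) (auto simp: \<sigma>_def)
        then show ?thesis by (simp add: cmod_def t_def)
      qed
      then have "2 * C * \<eta> ^ 4 * q\<^sup>2 \<le> norm (zeta_reg (Complex \<sigma> t))"
        using False e4 by (intro key) (auto simp: \<sigma>_def)
      moreover have "norm (zeta_reg (Complex \<sigma> t) - zeta_reg (Complex (Re s) t)) \<le> C * q\<^sup>2 * (\<sigma> - Re s)"
        using less s e4
        by (intro holomorphic_mvt_horizontal[OF zeta_reg_holomorphic open_halfspace_Re_gt])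
           (auto simp: \<sigma>_def q_def intro!: C(2)[of "Complex _ t", simplified])
      moreover have "C * q\<^sup>2 * (\<sigma> - Re s) \<le> C * q\<^sup>2 * \<eta> ^ 4"
        using C(1) s by (intro mult_left_mono) (auto simp: \<sigma>_def)
      moreover have "norm (zeta_reg (Complex \<sigma> t)) \<le> norm (zeta_reg s) + norm (zeta_reg (Complex \<sigma> t) - zeta_reg s)"
        using norm_triangle_ineq[of "zeta_reg s" "zeta_reg (Complex \<sigma> t) - zeta_reg s"] by simp
      ultimately show ?thesis using sC by (simp add: mult_ac)
    qed
    also have "C * \<eta> ^ 4 * q\<^sup>2 = C * a ^ 4 / q ^ 10"
      using q by (simp add: \<eta>_def power_divide flip: power_mult) (simp add: field_simps flip: power_add)
    finally have "C * a ^ 4 / q ^ 10 \<le> norm (zeta_reg s)" .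
    moreover have "(C * a ^ 4 / 2) / q ^ 10 \<le> C * a ^ 4 / q ^ 10"
      using C(1) a q by (intro divide_right_mono) auto
    ultimately show ?thesis by (simp add: q_def t_def)
  qed
  moreover have "min (C * a ^ 4 / 2) (1/2) / (1 + \<bar>Im s\<bar>) ^ 10 \<le> (C * a ^ 4 / 2) / (1 + \<bar>Im s\<bar>) ^ 10"
    "min (C * a ^ 4 / 2) (1/2) / (1 + \<bar>Im s\<bar>) ^ 10 \<le> 1/2" for s
  proof -
    show "min (C * a ^ 4 / 2) (1/2) / (1 + \<bar>Im s\<bar>) ^ 10 \<le> (C * a ^ 4 / 2) / (1 + \<bar>Im s\<bar>) ^ 10"
      by (intro divide_right_mono) auto
    have "min (C * a ^ 4 / 2) (1/2) / (1 + \<bar>Im s\<bar>) ^ 10 \<le> (1/2) / 1"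
      by (intro frac_le one_le_power) auto
    then show "min (C * a ^ 4 / 2) (1/2) / (1 + \<bar>Im s\<bar>) ^ 10 \<le> 1/2" by simp
  qed
  ultimately have "\<And>s. 1 < Re s \<Longrightarrow> Re s \<le> 2 \<Longrightarrow> norm (zeta_reg s) \<ge> min (C * a ^ 4 / 2) (1/2) / (1 + \<bar>Im s\<bar>) ^ 10"
    using order.trans by blast
  moreover have "min (C * a ^ 4 / 2) (1/2) > 0" using C(1) a by simp
  ultimately show ?thesis by blast
qed

section \<open>Laplace transform of the prime counting error\<close>

text \<open>The Laplace transform of \<open>Psi (exp v) - exp v\<close> over \<open>v > 0\<close>.
  The subtracted term removes the pole at 1.\<close>

definition laplace_error :: "complex \<Rightarrow> complex" where
  "laplace_error s = vm_series s / s - 1 / (s - 1)"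

text \<open>The logarithmic derivative of \<open>(s - 1) * zeta s\<close> is
  \<open>1 / (s - 1) - vm_series s\<close>, so the poles cancel and the bounds for
  \<open>zeta_reg\<close> apply.\<close>

lemma laplace_error_eq:
  assumes s: "Re s > 1"
  shows "laplace_error s = - (1 + deriv zeta_reg s / zeta_reg s) / s" "zeta_reg s \<noteq> 0"
proof -
  have s1: "s \<noteq> 1" "s \<noteq> 0" using s by auto
  show nz: "zeta_reg s \<noteq> 0"
    using zeta_reg_eq_zeta[OF s] zeta_nonzero[OF s] s1 by simp
  have "((\<lambda>s. (s - 1) * zeta s) has_field_derivative (zeta s + (s - 1) * (- zeta s * vm_series s))) (at s)"
    by (auto intro!: derivative_eq_intros zeta_deriv[OF s] simp: algebra_simps)
  then have "(zeta_reg has_field_derivative (zeta s + (s - 1) * (- zeta s * vm_series s))) (at s)"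
    by (rule has_field_derivative_transform_within_open[OF _ open_halfspace_Re_gt[of 1]])
       (use s zeta_reg_eq_zeta in auto)
  then have "deriv zeta_reg s = zeta s + (s - 1) * (- zeta s * vm_series s)"
    by (rule DERIV_imp_deriv)
  then have "deriv zeta_reg s / zeta_reg s = (zeta s + (s - 1) * (- zeta s * vm_series s)) / ((s - 1) * zeta s)"
    using zeta_reg_eq_zeta[OF s] by simp
  also have "\<dots> = 1 / (s - 1) - vm_series s"
    using zeta_nonzero[OF s] s1 by (simp add: divide_simps) (simp add: algebra_simps)
  finally have "deriv zeta_reg s / zeta_reg s = 1 / (s - 1) - vm_series s" .
  moreover have "- (1 + (1 / (s - 1) - v)) / s = v / s - 1 / (s - 1)" for v
  proof -
    have *: "1 + (1 / (s - 1) - v) = s / (s - 1) - v" using s1 by (simp add: field_simps)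
    show ?thesis
      unfolding * using s1 by (simp add: diff_divide_distrib)
  qed
  ultimately show "laplace_error s = - (1 + deriv zeta_reg s / zeta_reg s) / s"
    unfolding laplace_error_def by simp
qed

lemma laplace_error_holomorphic: "laplace_error holomorphic_on {s. Re s > 1}"
proof (rule holomorphic_transform)
  have "zeta_reg holomorphic_on {s. Re s > 1}" "deriv zeta_reg holomorphic_on {s. Re s > 1}"
    using zeta_reg_holomorphic holomorphic_deriv[OF zeta_reg_holomorphic open_halfspace_Re_gt]
    by (auto elim!: holomorphic_on_subset)
  then show "(\<lambda>s. - (1 + deriv zeta_reg s / zeta_reg s) / s) holomorphic_on {s. Re s > 1}"
    using laplace_error_eq(2) by (intro holomorphic_intros) (auto simp: open_halfspace_Re_gt)
qed (use laplace_error_eq in auto)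

text \<open>With \<open>q = 1 + \<bar>Im s\<bar>\<close>, a division by \<open>zeta_reg\<close>
  turns \<open>q ^ 2\<close> into \<open>q ^ 12\<close>. The derivative contains the square of the
  logarithmic derivative, which doubles the exponent to 24. Divisions by \<open>s\<close> are
  dropped since \<open>norm s \<ge> 1\<close>. Powers of \<open>1 + t^2\<close> replace those of
  \<open>q\<close> to suit the Gaussian weight.\<close>

lemma laplace_error_bounds:
  "\<exists>C>0. \<forall>s. 1 < Re s \<and> Re s \<le> 2 \<longrightarrow>
     norm (laplace_error s) \<le> C * (1 + (Im s)\<^sup>2) ^ 12 \<and> norm (deriv laplace_error s) \<le> C * (1 + (Im s)\<^sup>2) ^ 12"
proof -
  obtain C where C: "C \<ge> 1" "\<And>s. 1 \<le> Re s \<Longrightarrow> Re s \<le> 2 \<Longrightarrow> norm (deriv zeta_reg s) \<le> C * (1 + \<bar>Im s\<bar>)\<^sup>2"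
     "\<And>s. 1 \<le> Re s \<Longrightarrow> Re s \<le> 2 \<Longrightarrow> norm (deriv (deriv zeta_reg) s) \<le> C * (1 + \<bar>Im s\<bar>)\<^sup>2"
    using zeta_reg_deriv_bounds by blast
  obtain c where c: "c > 0" "\<And>s. 1 < Re s \<Longrightarrow> Re s \<le> 2 \<Longrightarrow> norm (zeta_reg s) \<ge> c / (1 + \<bar>Im s\<bar>) ^ 10"
    using zeta_reg_lower by blast
  define K where "K = C / c"
  have K: "K > 0" using C c by (simp add: K_def)
  define B where "B = 1 + 2 * K + K\<^sup>2"
  have main: "norm (laplace_error s) \<le> B * (1 + \<bar>Im s\<bar>) ^ 24 \<and> norm (deriv laplace_error s) \<le> B * (1 + \<bar>Im s\<bar>) ^ 24"
    if s: "1 < Re s" "Re s \<le> 2" for s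
  proof -
    define q where "q = 1 + \<bar>Im s\<bar>"
    have q: "q \<ge> 1" by (simp add: q_def)
    have quot: "norm (w / zeta_reg s) \<le> K * q ^ 12" if "norm w \<le> C * q\<^sup>2" for w
    proof -
      have "norm (w / zeta_reg s) \<le> (C * q\<^sup>2) / (c / q ^ 10)"
        unfolding norm_divide using that c C(1) q s by (intro frac_le) (auto simp: q_def)
      also have "\<dots> = K * q ^ 12" using q by (simp add: K_def field_simps flip: power_add)
      finally show ?thesis .
    qed
    define a where "a = deriv zeta_reg s / zeta_reg s"
    define b where "b = deriv (deriv zeta_reg) s / zeta_reg s"
    have a: "norm a \<le> K * q ^ 12" and b: "norm b \<le> K * q ^ 12"
      using quot C(2,3)[of s] s unfolding a_def b_def q_def by auto
    have s1: "norm s \<ge> 1" using abs_Re_le_cmod[of s] s by linarith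
    have dZ: "(zeta_reg has_field_derivative deriv zeta_reg s) (at s)" "(deriv zeta_reg has_field_derivative deriv (deriv zeta_reg) s) (at s)"
      using s by (auto intro!: holomorphic_derivI[OF zeta_reg_holomorphic open_halfspace_Re_gt]
          holomorphic_derivI[OF holomorphic_deriv[OF zeta_reg_holomorphic open_halfspace_Re_gt] open_halfspace_Re_gt])
    have "((\<lambda>s. - (1 + deriv zeta_reg s / zeta_reg s) / s) has_field_derivative ((1 + a) / s\<^sup>2 - (b - a\<^sup>2) / s)) (at s)"
    proof -
      have nz: "zeta_reg s \<noteq> 0" "s \<noteq> 0" using laplace_error_eq(2)[OF s(1)] s by auto
      have "((\<lambda>s. deriv zeta_reg s / zeta_reg s) has_field_derivative
          (deriv (deriv zeta_reg) s * zeta_reg s - deriv zeta_reg s * deriv zeta_reg s) / (zeta_reg s * zeta_reg s)) (at s)"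
        using nz by (intro DERIV_divide dZ)
      also have "(deriv (deriv zeta_reg) s * zeta_reg s - deriv zeta_reg s * deriv zeta_reg s) / (zeta_reg s * zeta_reg s) = b - a\<^sup>2"
        using nz by (simp add: a_def b_def field_simps power2_eq_square)
      finally have "((\<lambda>s. deriv zeta_reg s / zeta_reg s) has_field_derivative (b - a\<^sup>2)) (at s)" .
      moreover have "((\<lambda>s. - (1 + L s) / s) has_field_derivative ((1 + a) / s\<^sup>2 - (b - a\<^sup>2) / s)) (at s)"
        if "(L has_field_derivative (b - a\<^sup>2)) (at s)" "L s = a" for L
        using nz that by (auto intro!: derivative_eq_intros simp: field_simps power2_eq_square)
      ultimately show ?thesis by (simp add: a_def)
    qed
    then have "(laplace_error has_field_derivative ((1 + a) / s\<^sup>2 - (b - a\<^sup>2) / s)) (at s)"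
      by (rule has_field_derivative_transform_within_open[OF _ open_halfspace_Re_gt[of 1]])
         (use s laplace_error_eq in auto)
    then have dG: "deriv laplace_error s = (1 + a) / s\<^sup>2 - (b - a\<^sup>2) / s"
      by (rule DERIV_imp_deriv)
    have div: "norm (w / s ^ n) \<le> norm w" for w n
    proof -
      have "norm w / norm s ^ n \<le> norm w / 1"
        using one_le_power[OF s1, of n] by (intro divide_left_mono) auto
      then show ?thesis by (simp add: norm_divide norm_power)
    qed
    have q12: "1 \<le> q ^ 12" "q ^ 12 \<le> q ^ 24" using q by (auto intro!: power_increasing)
    then have q24: "1 \<le> q ^ 24" by linarith
    have K12: "K * q ^ 12 \<le> K * q ^ 24" using K q12 by simp
    have "norm (laplace_error s) \<le> norm (1 + a)"
      using div[of "1 + a" 1] unfolding laplace_error_eq(1)[OF s(1)] a_def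
      by (simp only: minus_divide_left[symmetric] norm_minus_cancel power_one_right)
    also have "\<dots> \<le> 1 + K * q ^ 12" using a norm_triangle_ineq[of 1 a] by simp
    finally have n1: "norm (laplace_error s) \<le> 1 + K * q ^ 12" .
    have "norm (a\<^sup>2) \<le> (K * q ^ 12)\<^sup>2" unfolding norm_power by (intro power_mono a) auto
    also have "\<dots> = K\<^sup>2 * q ^ 24" by (simp add: power_mult_distrib flip: power_mult)
    finally have a2: "norm (a\<^sup>2) \<le> K\<^sup>2 * q ^ 24" .
    have "norm (deriv laplace_error s) \<le> norm ((1 + a) / s\<^sup>2) + norm ((b - a\<^sup>2) / s)"
      unfolding dG by (rule norm_triangle_ineq4)
    also have "\<dots> \<le> norm (1 + a) + norm (b - a\<^sup>2)"
      using div[of "1 + a" 2] div[of "b - a\<^sup>2" 1] by simp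
    also have "\<dots> \<le> (1 + norm a) + (norm b + norm (a\<^sup>2))"
      using norm_triangle_ineq[of 1 a] norm_triangle_ineq4[of b "a\<^sup>2"] by simp
    finally have n2: "norm (deriv laplace_error s) \<le> 1 + K * q ^ 12 + K * q ^ 12 + K\<^sup>2 * q ^ 24"
      using a b a2 by linarith
    have "0 \<le> K\<^sup>2 * q ^ 24" "0 \<le> K * q ^ 24" using K q by auto
    then show ?thesis using n1 n2 K12 q24 unfolding B_def q_def[symmetric] distrib_right mult.assoc
      by (intro conjI) linarith+
  qed
  have q: "(1 + \<bar>t\<bar>) ^ 24 \<le> 2 ^ 12 * (1 + t\<^sup>2) ^ 12" for t :: real
  proof -
    have "(1 + \<bar>t\<bar>)\<^sup>2 \<le> 2 * (1 + t\<^sup>2)"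
      using sum_squares_bound[of 1 "\<bar>t\<bar>"] by (simp add: power2_eq_square algebra_simps)
    then have "((1 + \<bar>t\<bar>)\<^sup>2) ^ 12 \<le> (2 * (1 + t\<^sup>2)) ^ 12" by (intro power_mono) auto
    then show ?thesis unfolding power_mult_distrib power_mult [symmetric] by simp
  qed
  have B: "B > 0" using K by (simp add: B_def add_pos_pos)
  have "norm (laplace_error s) \<le> (B * 2 ^ 12) * (1 + (Im s)\<^sup>2) ^ 12 \<and> norm (deriv laplace_error s) \<le> (B * 2 ^ 12) * (1 + (Im s)\<^sup>2) ^ 12"
    if "1 < Re s" "Re s \<le> 2" for s
  proof -
    have "B * (1 + \<bar>Im s\<bar>) ^ 24 \<le> (B * 2 ^ 12) * (1 + (Im s)\<^sup>2) ^ 12"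
      using mult_left_mono[OF q[of "Im s"], of B] B by (simp add: mult.assoc)
    then show ?thesis using main[OF that] by linarith
  qed
  then show ?thesis using B by (intro exI[of _ "B * 2 ^ 12"]) auto
qed

text \<open>The inequality is strict so that \<open>real n < exp v\<close> matches the open ray
  \<open>{ln n<..}\<close> and the Laplace integrand splits pointwise, without exceptional
  points.\<close>

definition Psi :: "real \<Rightarrow> real" where "Psi x = (\<Sum>n | real n < x. mangoldt n)"

lemma finite_nat_less_real: "finite {n::nat. real n < x}"
  by (rule finite_subset[of _ "{..nat \<lceil>x\<rceil>}"]) (auto, linarith)

lemma Psi_mono: "x \<le> y \<Longrightarrow> Psi x \<le> Psi y"
  unfolding Psi_def by (intro sum_mono2 finite_nat_less_real) (auto simp: mangoldt_nonneg)

lemma Psi_nonneg: "0 \<le> Psi x"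
  unfolding Psi_def by (intro sum_nonneg mangoldt_nonneg)

lemma laplace_exp:
  assumes s: "Re s > 0" and a: "a \<ge> 0"
  shows "has_bochner_integral lborel (\<lambda>v. indicator {a<..} v *\<^sub>R exp (- s * of_real v)) (exp (- s * of_real a) / s)"
proof -
  have s0: "s \<noteq> 0" using s by auto
  have "set_integrable lborel {0<..} (\<lambda>v. exp (- (v * Re s)))"
    by (rule integrable_I0i_exp_mscale[OF s])
  then have i1: "set_integrable lborel {a<..} (\<lambda>v. exp (- (v * Re s)))"
    by (rule set_integrable_subset) (use a in auto)
  have i2: "set_integrable lborel {a<..} (\<lambda>v. exp (- s * complex_of_real v))"
    unfolding set_integrable_def
    by (rule Bochner_Integration.integrable_bound[OF i1[unfolded set_integrable_def]])
       (auto simp: mult.commute)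
  have "(LBINT v=ereal a..\<infinity>. exp (- s * complex_of_real v)) = 0 - (- exp (- s * of_real a) / s)"
  proof (rule interval_integral_FTC_integrable[where F = "\<lambda>v. - exp (- s * of_real v) / s"])
    show "((\<lambda>v. - exp (- s * complex_of_real v) / s) has_vector_derivative exp (- s * of_real x)) (at x)" for x
    proof (rule has_vector_derivative_real_field)
      show "((\<lambda>z. - exp (- s * z) / s) has_field_derivative exp (- s * of_real x)) (at (of_real x))"
        using s0 by (auto intro!: derivative_eq_intros)
    qed
    show "isCont (\<lambda>v. exp (- s * complex_of_real v)) x" for x
      by (intro continuous_intros)
    show "set_integrable lborel (einterval (ereal a) \<infinity>) (\<lambda>v. exp (- s * complex_of_real v))"
      using i2 by simp
    have "isCont (\<lambda>v. - exp (- s * complex_of_real v) / s) a"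
      by (intro continuous_intros s0)
    then have "((\<lambda>v. - exp (- s * complex_of_real v) / s) \<longlongrightarrow> - exp (- s * of_real a) / s) (at_right a)"
      unfolding isCont_def by (rule filterlim_mono) (auto simp: at_le)
    then show "(((\<lambda>v. - exp (- s * complex_of_real v) / s) \<circ> real_of_ereal) \<longlongrightarrow> - exp (- s * of_real a) / s) (at_right (ereal a))"
      by (simp add: ereal_tendsto_simps)
    have "((\<lambda>v. - exp (- s * complex_of_real v) / s) \<longlongrightarrow> 0) at_top"
    proof (rule tendsto_norm_zero_cancel)
      have "((\<lambda>v. exp (- Re s * v) / norm s) \<longlongrightarrow> 0) at_top"
        using s s0 by real_asymp
      then show "((\<lambda>v. norm (- exp (- s * complex_of_real v) / s)) \<longlongrightarrow> 0) at_top"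
        by (simp add: norm_divide)
    qed
    then show "(((\<lambda>v. - exp (- s * complex_of_real v) / s) \<circ> real_of_ereal) \<longlongrightarrow> 0) (at_left \<infinity>)"
      by (simp add: ereal_tendsto_simps)
  qed simp
  then have "(LBINT v:{a<..}. exp (- s * complex_of_real v)) = exp (- s * of_real a) / s"
    by (simp add: interval_integral_to_infinity_eq)
  then show ?thesis
    using i2 by (simp add: has_bochner_integral_iff set_integrable_def set_lebesgue_integral_def)
qed

lemma exp_ln_nat: "n > 0 \<Longrightarrow> exp (- s * complex_of_real (ln (real n))) = of_nat n powr (-s)"
  by (simp add: powr_def Ln_of_nat)

text \<open>For each \<open>v\<close> only finitely many \<open>n\<close> contribute, and the
  integrals of the norms form a convergent Dirichlet series at \<open>Re s\<close>. Hence the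
  integral may be taken term by term.\<close>

lemma laplace_Psi:
  assumes s: "Re s > 1"
  shows "has_bochner_integral lborel
     (\<lambda>v. indicator {0<..} v *\<^sub>R (of_real (Psi (exp v)) * exp (- s * of_real v))) (vm_series s / s)"
proof -
  define f where "f = (\<lambda>n v. of_real (mangoldt n) * (indicator {ln (real n)<..} v *\<^sub>R exp (- s * of_real v)))"
  have ln0: "ln (real n) \<ge> 0" for n by (cases "n = 0") auto
  have f: "has_bochner_integral lborel (f n) (of_real (mangoldt n) * (exp (- s * of_real (ln (real n))) / s))" for n
    unfolding f_def using s ln0 by (intro has_bochner_integral_mult_right laplace_exp) auto
  have fi: "integrable lborel (f n)" for n using f by (rule integrable.intros)
  have fn: "has_bochner_integral lborel (\<lambda>v. norm (f n v)) (mangoldt n * real n powr (- Re s) / Re s)" for n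
  proof (cases "n = 0")
    case False
    have "has_bochner_integral lborel (\<lambda>v. Re (indicator {ln (real n)<..} v *\<^sub>R exp (- of_real (Re s) * of_real v)))
        (Re (exp (- of_real (Re s) * of_real (ln (real n))) / of_real (Re s)))"
      using s ln0 by (intro has_bochner_integral_Re laplace_exp) auto
    then have "has_bochner_integral lborel (\<lambda>v. mangoldt n * Re (indicator {ln (real n)<..} v *\<^sub>R exp (- of_real (Re s) * of_real v)))
        (mangoldt n * (Re (exp (- of_real (Re s) * of_real (ln (real n))) / of_real (Re s))))"
      by (rule has_bochner_integral_mult_right)
    also have "(\<lambda>v. mangoldt n * Re (indicator {ln (real n)<..} v *\<^sub>R exp (- of_real (Re s) * of_real v))) = (\<lambda>v. norm (f n v))"
      by (auto simp: f_def norm_mult Re_exp indicator_def)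
    also have "Re (exp (- of_real (Re s) * of_real (ln (real n))) / of_real (Re s)) = real n powr (- Re s) / Re s"
      using False by (simp add: Re_exp powr_def)
    finally show ?thesis by simp
  qed (simp add: f_def has_bochner_integral_zero)
  have supp: "f n v = 0" if "n \<notin> {n. real n < exp v}" for n v
  proof (cases "n = 0")
    case False
    then have "\<not> ln (real n) < v" using that ln_less_cancel_iff[of "real n" "exp v"] by simp
    then show ?thesis by (simp add: f_def)
  qed (simp add: f_def)
  have ae: "summable (\<lambda>n. norm (f n v))" for v
    by (rule summable_finite[OF finite_nat_less_real[of "exp v"]]) (use supp in auto)
  have sm: "summable (\<lambda>n. LBINT v. norm (f n v))"
  proof -
    have "summable (\<lambda>n. norm (of_real (mangoldt n) * (of_nat n :: complex) powr (-s)) / Re s)"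
      by (intro summable_divide summable_norm_dirichlet mangoldt_growth s)
    then show ?thesis using fn[THEN has_bochner_integral_integral_eq]
      by (simp add: norm_mult norm_nat_powr)
  qed
  have "integrable lborel (\<lambda>v. \<Sum>n. f n v)"
    by (rule integrable_suminf[OF fi _ sm]) (use ae in auto)
  moreover have "(LBINT v. (\<Sum>n. f n v)) = (\<Sum>n. LBINT v. f n v)"
    by (rule integral_suminf[OF fi _ sm]) (use ae in auto)
  moreover have "(\<Sum>n. LBINT v. f n v) = vm_series s / s"
  proof -
    have "(LBINT v. f n v) = of_real (mangoldt n) * of_nat n powr (-s) / s" for n
      using f[of n, THEN has_bochner_integral_integral_eq] exp_ln_nat[of n s] by (cases "n = 0") auto
    moreover have "(\<lambda>n. of_real (mangoldt n) * (of_nat n :: complex) powr (-s) / s) sums (vm_series s / s)"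
      unfolding vm_series_def by (intro sums_divide dirichlet_sums mangoldt_growth s)
    ultimately show ?thesis by (simp add: sums_iff)
  qed
  moreover have "(\<Sum>n. f n v) = indicator {0<..} v *\<^sub>R (of_real (Psi (exp v)) * exp (- s * of_real v))" for v
  proof -
    have "(\<Sum>n. f n v) = (\<Sum>n | real n < exp v. f n v)"
      by (rule suminf_finite[OF finite_nat_less_real supp])
    also have "\<dots> = (\<Sum>n | real n < exp v. indicator {0<..} v *\<^sub>R (of_real (mangoldt n) * exp (- s * of_real v)))"
    proof (rule sum.cong)
      fix n assume "n \<in> {n. real n < exp v}"
      then have "n > 1 \<Longrightarrow> ln (real n) < v" using ln_less_cancel_iff[of "real n" "exp v"] by simp
      moreover have "n > 1 \<Longrightarrow> ln (real n) > 0" by simp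
      ultimately have 1: "n > 1 \<Longrightarrow> 0 < v \<and> ln (real n) < v" by linarith
      have 2: "n \<le> 1 \<Longrightarrow> mangoldt n = (0::real)" by (cases n) auto
      show "f n v = indicator {0<..} v *\<^sub>R (of_real (mangoldt n) * exp (- s * of_real v))"
        using 1 2 by (cases "n > 1") (simp_all add: f_def del: of_real_mangoldt)
    qed simp
    also have "\<dots> = indicator {0<..} v *\<^sub>R (of_real (Psi (exp v)) * exp (- s * of_real v))"
      by (simp add: Psi_def sum_distrib_right scaleR_sum_right)
    finally show ?thesis .
  qed
  ultimately show ?thesis by (simp add: has_bochner_integral_iff)
qed

text \<open>Damping by \<open>exp (- \<sigma> * v)\<close> makes the error
  \<open>Psi (exp v) - exp v\<close> integrable. Its Fourier transform is then
  \<open>laplace_error\<close> on the vertical line through \<sigma>.\<close>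

definition psi_error :: "real \<Rightarrow> real \<Rightarrow> real" where
  "psi_error \<sigma> v = indicator {0<..} v * (Psi (exp v) * exp (- \<sigma> * v) - exp (- (\<sigma> - 1) * v))"

lemma psi_error_fourier:
  assumes "\<sigma> > 1"
  shows "has_bochner_integral lborel (\<lambda>v. of_real (psi_error \<sigma> v) * iexp (- (t * v))) (laplace_error (Complex \<sigma> t))"
proof -
  let ?s = "Complex \<sigma> t"
  have "has_bochner_integral lborel
     (\<lambda>v. indicator {0<..} v *\<^sub>R (of_real (Psi (exp v)) * exp (- ?s * of_real v))
        - indicator {0<..} v *\<^sub>R exp (- (?s - 1) * of_real v))
     (vm_series ?s / ?s - exp (- (?s - 1) * of_real 0) / (?s - 1))"
    using assms by (intro has_bochner_integral_diff laplace_Psi laplace_exp) auto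
  also have "vm_series ?s / ?s - exp (- (?s - 1) * of_real 0) / (?s - 1) = laplace_error ?s"
    by (simp add: laplace_error_def)
  also have "(\<lambda>v. indicator {0<..} v *\<^sub>R (of_real (Psi (exp v)) * exp (- ?s * of_real v))
        - indicator {0<..} v *\<^sub>R exp (- (?s - 1) * of_real v)) = (\<lambda>v. of_real (psi_error \<sigma> v) * iexp (- (t * v)))"
  proof
    fix v
    have 1: "- ?s * of_real v = of_real (- \<sigma> * v) + \<i> * of_real (- (t * v))"
      and 2: "- (?s - 1) * of_real v = of_real (- (\<sigma> - 1) * v) + \<i> * of_real (- (t * v))"
      by (simp_all add: complex_eq_iff algebra_simps)
    show "indicator {0<..} v *\<^sub>R (of_real (Psi (exp v)) * exp (- ?s * of_real v))
        - indicator {0<..} v *\<^sub>R exp (- (?s - 1) * of_real v) = of_real (psi_error \<sigma> v) * iexp (- (t * v))"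
      unfolding 1 2 exp_add psi_error_def exp_of_real
      by (cases "v > 0") (auto simp: indicator_def algebra_simps)
  qed
  finally show ?thesis .
qed

lemma psi_error_integrable: "\<sigma> > 1 \<Longrightarrow> integrable lborel (psi_error \<sigma>)"
  using integrable_Re[OF integrable.intros[OF psi_error_fourier[of \<sigma> 0]]] by simp

section \<open>Gaussian smoothing\<close>

text \<open>The characteristic function of the standard normal distribution, rescaled by
  \<delta>.\<close>

lemma gauss_fourier:
  assumes d: "\<delta> > 0"
  shows "has_bochner_integral lborel (\<lambda>t. of_real (exp (- (\<delta> * t)\<^sup>2 / 2)) * iexp (t * w))
           (of_real (2 * pi * normal_density 0 \<delta> w))"
proof -
  define f where "f = (\<lambda>x. std_normal_density x *\<^sub>R iexp (w / \<delta> * x))"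
  have "integrable lborel (\<lambda>x. norm (f x))"
    unfolding f_def by (simp add: norm_mult)
  then have i: "integrable lborel f"
    by (subst (asm) integrable_norm_iff) (auto simp: f_def)
  have "(CLBINT x. f x) = char std_normal_distribution (w / \<delta>)"
    unfolding char_def f_def by (subst integral_density) (auto simp: borel_measurable_normal_density)
  then have "(CLBINT x. f x) = of_real (exp (- ((w / \<delta>)\<^sup>2) / 2))"
    by (simp only: char_std_normal_distribution)
  then have "has_bochner_integral lborel f (of_real (exp (- ((w / \<delta>)\<^sup>2) / 2)))"
    using i by (simp add: has_bochner_integral_iff)
  then have "has_bochner_integral lborel (\<lambda>t. f (0 + \<delta> * t)) (of_real (exp (- ((w / \<delta>)\<^sup>2) / 2)) /\<^sub>R \<bar>\<delta>\<bar>)"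
    using d by (subst (asm) lborel_has_bochner_integral_real_affine_iff[where c = \<delta> and t = 0]) auto
  then have "has_bochner_integral lborel (\<lambda>t. of_real (sqrt (2 * pi)) * f (0 + \<delta> * t))
     (of_real (sqrt (2 * pi)) * (of_real (exp (- ((w / \<delta>)\<^sup>2) / 2)) /\<^sub>R \<bar>\<delta>\<bar>))"
    by (rule has_bochner_integral_mult_right)
  also have "(\<lambda>t. of_real (sqrt (2 * pi)) * f (0 + \<delta> * t)) = (\<lambda>t. of_real (exp (- (\<delta> * t)\<^sup>2 / 2)) * iexp (t * w))"
    using d by (auto simp: f_def std_normal_density_def scaleR_conv_of_real fun_eq_iff mult_ac)
  also have "of_real (sqrt (2 * pi)) * (of_real (exp (- ((w / \<delta>)\<^sup>2) / 2)) /\<^sub>R \<bar>\<delta>\<bar>) = complex_of_real (2 * pi * normal_density 0 \<delta> w)"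
  proof -
    have 1: "sqrt (2 * pi * \<delta>\<^sup>2) = sqrt (2 * pi) * \<delta>"
      using d by (simp add: real_sqrt_mult)
    have 2: "- (w - 0)\<^sup>2 / (2 * \<delta>\<^sup>2) = - ((w / \<delta>)\<^sup>2) / 2"
      by (simp add: power_divide)
    have "2 * pi * normal_density 0 \<delta> w = (2 * pi) / sqrt (2 * pi) * (exp (- ((w / \<delta>)\<^sup>2) / 2) / \<delta>)"
      unfolding normal_density_def 1 2 by simp
    also have "(2 * pi) / sqrt (2 * pi) = sqrt (2 * pi)"
      by (rule real_div_sqrt) simp
    finally have nd: "2 * pi * normal_density 0 \<delta> w = sqrt (2 * pi) * (exp (- ((w / \<delta>)\<^sup>2) / 2) / \<delta>)" .
    show ?thesis unfolding nd using d by (simp add: scaleR_conv_of_real field_simps)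
  qed
  finally show ?thesis .
qed

text \<open>Multiplying a Fourier transform by a Gaussian convolves the original function with the
  dual Gaussian. The factor also provides the absolute convergence that Fubini needs.\<close>

lemma smoothing:
  assumes s: "\<sigma> > 1" and d: "\<delta> > 0"
  shows "(CLBINT t. laplace_error (Complex \<sigma> t) * of_real (exp (- (\<delta> * t)\<^sup>2 / 2)) * iexp (t * u))
     = of_real (2 * pi * (LBINT v. psi_error \<sigma> v * normal_density 0 \<delta> (u - v)))"
proof -
  define g where "g = (\<lambda>t. exp (- (\<delta> * t)\<^sup>2 / 2))"
  have gi: "integrable lborel g"
    using gauss_fourier[OF d, of 0, THEN has_bochner_integral_Re] unfolding g_def
    by (auto simp: has_bochner_integral_iff)
  have gm [measurable]: "g \<in> borel_measurable borel" using gi by (simp add: borel_measurable_integrable)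
  have Di: "integrable lborel (psi_error \<sigma>)" by (rule psi_error_integrable[OF s])
  have Dm [measurable]: "psi_error \<sigma> \<in> borel_measurable borel" using Di by (simp add: borel_measurable_integrable)
  define f where "f = (\<lambda>t v. of_real (psi_error \<sigma> v) * iexp (- (t * v)) * (of_real (g t) * iexp (t * u)))"
  have nf: "norm (f t v) = \<bar>psi_error \<sigma> v\<bar> * g t" for t v
    by (simp add: f_def norm_mult g_def)
  have fv: "(\<lambda>v. f t v) = (\<lambda>v. of_real (psi_error \<sigma> v) * iexp (- (t * v)) * (of_real (g t) * iexp (t * u)))" for t
    by (simp add: f_def)
  have inner: "has_bochner_integral lborel (f t) (laplace_error (Complex \<sigma> t) * (of_real (g t) * iexp (t * u)))" for t
    unfolding fv by (intro has_bochner_integral_mult_left psi_error_fourier s)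
  have "integrable (lborel \<Otimes>\<^sub>M lborel) (case_prod f)"
  proof (rule lborel_pair.Fubini_integrable)
    show "case_prod f \<in> borel_measurable (lborel \<Otimes>\<^sub>M lborel)"
    proof -
      have [measurable]: "(\<lambda>p. iexp (- (fst p * snd p)) * iexp (fst p * u)) \<in> borel_measurable (borel \<Otimes>\<^sub>M borel)"
        unfolding borel_prod by (intro borel_measurable_continuous_onI continuous_intros)
      have "(\<lambda>p. of_real (psi_error \<sigma> (snd p) * g (fst p)) * (iexp (- (fst p * snd p)) * iexp (fst p * u))) \<in> borel_measurable (borel \<Otimes>\<^sub>M borel)"
        by measurable
      also have "(\<lambda>p. of_real (psi_error \<sigma> (snd p) * g (fst p)) * (iexp (- (fst p * snd p)) * iexp (fst p * u))) = case_prod f"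
        by (simp add: fun_eq_iff f_def)
      also have "borel_measurable (borel \<Otimes>\<^sub>M borel) = borel_measurable (lborel \<Otimes>\<^sub>M lborel)"
        by (intro measurable_cong_sets sets_pair_measure_cong) auto
      finally show ?thesis .
    qed
    have "integrable lborel (\<lambda>t. (LBINT v. \<bar>psi_error \<sigma> v\<bar>) * g t)"
      using gi by simp
    then show "integrable lborel (\<lambda>t. LBINT v. norm (case_prod f (t, v)))"
      by (simp add: nf)
    show "AE t in lborel. integrable lborel (\<lambda>v. case_prod f (t, v))"
      using inner by (simp add: has_bochner_integral_iff)
  qed
  from lborel_pair.Fubini_integral[OF this]
  have "(CLBINT t. CLBINT v. f t v) = (CLBINT v. CLBINT t. f t v)" ..
  also have "(CLBINT t. CLBINT v. f t v) = (CLBINT t. laplace_error (Complex \<sigma> t) * of_real (g t) * iexp (t * u))"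
    using inner[THEN has_bochner_integral_integral_eq] by (simp add: mult.assoc)
  also have "(CLBINT v. CLBINT t. f t v) = (CLBINT v. of_real (2 * pi * (psi_error \<sigma> v * normal_density 0 \<delta> (u - v))))"
  proof (rule Bochner_Integration.integral_cong)
    fix v
    have "f t v = of_real (psi_error \<sigma> v) * (of_real (g t) * iexp (t * (u - v)))" for t
    proof -
      have "iexp (t * (u - v)) = iexp (- (t * v)) * iexp (t * u)"
        by (simp add: algebra_simps flip: exp_add)
      then show ?thesis by (simp add: f_def)
    qed
    then show "(CLBINT t. f t v) = of_real (2 * pi * (psi_error \<sigma> v * normal_density 0 \<delta> (u - v)))"
      using gauss_fourier[OF d, of "u - v", THEN has_bochner_integral_integral_eq]
      by (simp add: g_def mult_ac)
  qed simp
  also have "\<dots> = of_real (2 * pi * (LBINT v. psi_error \<sigma> v * normal_density 0 \<delta> (u - v)))"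
    by (simp only: integral_complex_of_real integral_mult_right_zero)
  finally show ?thesis unfolding g_def .
qed

text \<open>Integrating the derivative of \<open>f t * iexp (t * u)\<close> gives 0, as it vanishes
  at both ends; the product rule then trades one derivative of \<open>f\<close> for a factor
  \<open>1 / u\<close>.\<close>

lemma fourier_by_parts:
  fixes f f' :: "real \<Rightarrow> complex"
  assumes deriv: "\<And>t. (f has_vector_derivative f' t) (at t)"
    and cont: "\<And>t. isCont f' t"
    and int: "integrable lborel f" "integrable lborel f'"
    and lim: "(f \<longlongrightarrow> 0) at_top" "(f \<longlongrightarrow> 0) at_bot"
    and u: "u > 0"
  shows "norm (CLBINT t. f t * iexp (t * u)) \<le> (LBINT t. norm (f' t)) / u"
proof -
  have contf: "isCont f t" for t
    using has_vector_derivative_continuous[OF deriv[of t]] .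
  have fm [measurable]: "f \<in> borel_measurable borel" and f'm [measurable]: "f' \<in> borel_measurable borel"
    using int by (simp_all add: borel_measurable_integrable)
  have i1: "integrable lborel (\<lambda>t. f t * iexp (t * u))"
    by (rule Bochner_Integration.integrable_bound[OF int(1)]) (auto simp: norm_mult)
  have i2: "integrable lborel (\<lambda>t. f' t * iexp (t * u))"
    by (rule Bochner_Integration.integrable_bound[OF int(2)]) (auto simp: norm_mult)
  have i3: "integrable lborel (\<lambda>t. f' t * iexp (t * u) + (\<i> * of_real u) * (f t * iexp (t * u)))"
    using i1 i2 by (intro Bochner_Integration.integrable_add integrable_mult_right) auto
  have "(LBINT t=-\<infinity>..\<infinity>. f' t * iexp (t * u) + (\<i> * of_real u) * (f t * iexp (t * u))) = 0 - 0"
  proof (rule interval_integral_FTC_integrable[where F = "\<lambda>t. f t * iexp (t * u)"])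
    fix t
    have "((\<lambda>t. iexp (t * u)) has_vector_derivative (\<i> * of_real u) * iexp (t * u)) (at t)"
    proof -
      have "((\<lambda>z. exp (\<i> * (z * of_real u))) has_field_derivative (\<i> * of_real u) * exp (\<i> * (of_real t * of_real u))) (at (of_real t))"
        by (auto intro!: derivative_eq_intros)
      from has_vector_derivative_real_field[OF this] show ?thesis by simp
    qed
    from has_vector_derivative_mult[OF deriv[of t] this]
    show "((\<lambda>t. f t * iexp (t * u)) has_vector_derivative f' t * iexp (t * u) + (\<i> * of_real u) * (f t * iexp (t * u))) (at t)"
      by (simp add: algebra_simps)
    show "isCont (\<lambda>t. f' t * iexp (t * u) + (\<i> * of_real u) * (f t * iexp (t * u))) t"
      by (intro continuous_intros cont contf)
  next
    show "set_integrable lborel (einterval (- \<infinity>) \<infinity>) (\<lambda>t. f' t * iexp (t * u) + (\<i> * of_real u) * (f t * iexp (t * u)))"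
      using i3 by (simp add: set_integrable_def)
    have "((\<lambda>t. f t * iexp (t * u)) \<longlongrightarrow> 0) at_top"
      by (rule tendsto_norm_zero_cancel) (use tendsto_norm_zero[OF lim(1)] in \<open>simp add: norm_mult\<close>)
    then show "(((\<lambda>t. f t * iexp (t * u)) \<circ> real_of_ereal) \<longlongrightarrow> 0) (at_left \<infinity>)"
      by (simp add: ereal_tendsto_simps)
    have "((\<lambda>t. f t * iexp (t * u)) \<longlongrightarrow> 0) at_bot"
      by (rule tendsto_norm_zero_cancel) (use tendsto_norm_zero[OF lim(2)] in \<open>simp add: norm_mult\<close>)
    then show "(((\<lambda>t. f t * iexp (t * u)) \<circ> real_of_ereal) \<longlongrightarrow> 0) (at_right (- \<infinity>))"
      by (simp add: ereal_tendsto_simps)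
  qed simp
  then have "(CLBINT t. f' t * iexp (t * u) + (\<i> * of_real u) * (f t * iexp (t * u))) = 0"
    by (simp add: interval_lebesgue_integral_def set_lebesgue_integral_def)
  then have "(CLBINT t. f' t * iexp (t * u)) + (\<i> * of_real u) * (CLBINT t. f t * iexp (t * u)) = 0"
    using i1 i2 by simp
  then have "(\<i> * of_real u) * (CLBINT t. f t * iexp (t * u)) = - (CLBINT t. f' t * iexp (t * u))"
    by (simp add: eq_neg_iff_add_eq_0 add.commute)
  then have "norm ((\<i> * of_real u) * (CLBINT t. f t * iexp (t * u))) = norm (CLBINT t. f' t * iexp (t * u))"
    by (simp only: norm_minus_cancel)
  then have "u * norm (CLBINT t. f t * iexp (t * u)) = norm (CLBINT t. f' t * iexp (t * u))"
    using u by (simp add: norm_mult)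
  also have "\<dots> \<le> (LBINT t. norm (f' t * iexp (t * u)))"
    by (rule integral_norm_bound)
  also have "\<dots> = (LBINT t. norm (f' t))" by (simp add: norm_mult)
  finally show ?thesis using u by (simp add: field_simps)
qed

text \<open>Half of the Gaussian exponent is spent on the polynomial. The power 13 is the 12 of
  \<open>laplace_error_bounds\<close> plus 1 for the derivative of the Gaussian. The constant 52 is
  4 * 13, from \<open>(1 + z / 13) ^ 13 \<le> exp z\<close> at \<open>z = y / 4\<close>.\<close>

lemma gauss_poly_bound:
  fixes \<delta> t :: real
  assumes d: "0 < \<delta>" "\<delta> \<le> 1"
  shows "(1 + t\<^sup>2) ^ 13 * exp (- (\<delta> * t)\<^sup>2 / 2) \<le> 52 ^ 13 / \<delta> ^ 26 * exp (- (\<delta> * t)\<^sup>2 / 4)"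
proof -
  define y where "y = (\<delta> * t)\<^sup>2"
  have y: "y \<ge> 0" by (simp add: y_def)
  have "1 \<le> 1 / \<delta>\<^sup>2" using d by (simp add: field_simps power_le_one)
  then have "1 + t\<^sup>2 \<le> (1 + y) / \<delta>\<^sup>2"
    using d by (simp add: y_def power_mult_distrib add_divide_distrib)
  then have "(1 + t\<^sup>2) ^ 13 \<le> ((1 + y) / \<delta>\<^sup>2) ^ 13" by (intro power_mono) auto
  also have "\<dots> = (1 + y) ^ 13 / \<delta> ^ 26" by (simp add: power_divide flip: power_mult)
  also have "(1 + y) ^ 13 \<le> 52 ^ 13 * exp (y / 4)"
  proof -
    have "((1 + y) / 52) ^ 13 \<le> (1 + (y / 4) / real 13) ^ 13"
      using y by (intro power_mono) auto
    also have "\<dots> \<le> exp (y / 4)"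
      using y by (intro exp_ge_one_plus_x_over_n_power_n) auto
    finally show ?thesis by (simp add: power_divide field_simps)
  qed
  then have "(1 + y) ^ 13 / \<delta> ^ 26 \<le> 52 ^ 13 * exp (y / 4) / \<delta> ^ 26"
    using d by (intro divide_right_mono) auto
  finally have "(1 + t\<^sup>2) ^ 13 * exp (- y / 2) \<le> 52 ^ 13 * exp (y / 4) / \<delta> ^ 26 * exp (- y / 2)"
    by (intro mult_right_mono) auto
  also have "\<dots> = 52 ^ 13 / \<delta> ^ 26 * exp (- y / 4)"
    by (simp add: field_simps flip: exp_add)
  finally show ?thesis by (simp add: y_def)
qed

lemma gauss_integral:
  assumes d: "\<delta> > 0"
  shows "has_bochner_integral lborel (\<lambda>t. exp (- (\<delta> * t)\<^sup>2 / 4)) (sqrt (4 * pi) / \<delta>)"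
proof -
  have "has_bochner_integral lborel (\<lambda>t. sqrt (4 * pi) / \<delta> * normal_density 0 (sqrt 2 / \<delta>) t) (sqrt (4 * pi) / \<delta> * 1)"
    using d by (intro has_bochner_integral_mult_right) (simp add: has_bochner_integral_iff)
  also have "(\<lambda>t. sqrt (4 * pi) / \<delta> * normal_density 0 (sqrt 2 / \<delta>) t) = (\<lambda>t. exp (- (\<delta> * t)\<^sup>2 / 4))"
  proof
    fix t
    have 1: "sqrt (2 * pi * (sqrt 2 / \<delta>)\<^sup>2) = sqrt (4 * pi) / \<delta>"
      using d by (simp add: power_divide real_sqrt_divide)
    have 2: "- (t - 0)\<^sup>2 / (2 * (sqrt 2 / \<delta>)\<^sup>2) = - (\<delta> * t)\<^sup>2 / 4"
      using d by (simp add: power_divide power_mult_distrib)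
    have nz: "sqrt (4 * pi) / \<delta> \<noteq> 0" using d by simp
    show "sqrt (4 * pi) / \<delta> * normal_density 0 (sqrt 2 / \<delta>) t = exp (- (\<delta> * t)\<^sup>2 / 4)"
      unfolding normal_density_def 1 2 using nz by simp
  qed
  finally show ?thesis by simp
qed

text \<open>The polynomial contributes 26 powers of 1/\<delta>, the integral of the remaining
  Gaussian one more. The constant is uniform in \<sigma>, so that \<sigma> can tend to 1
  afterwards.\<close>

lemma smoothed_bound:
  "\<exists>C>0. \<forall>\<sigma> \<delta> u. 1 < \<sigma> \<and> \<sigma> \<le> 2 \<and> 0 < \<delta> \<and> \<delta> \<le> 1 \<and> 0 < u \<longrightarrow>
     \<bar>LBINT v. psi_error \<sigma> v * normal_density u \<delta> v\<bar> \<le> C / (\<delta> ^ 27 * u)"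
proof -
  obtain C where C: "C > 0" "\<And>s. 1 < Re s \<Longrightarrow> Re s \<le> 2 \<Longrightarrow> norm (laplace_error s) \<le> C * (1 + (Im s)\<^sup>2) ^ 12"
     "\<And>s. 1 < Re s \<Longrightarrow> Re s \<le> 2 \<Longrightarrow> norm (deriv laplace_error s) \<le> C * (1 + (Im s)\<^sup>2) ^ 12"
    using laplace_error_bounds by blast
  define K where "K = 2 * C * 52 ^ 13"
  have K: "K > 0" using C by (simp add: K_def)
  have "\<bar>LBINT v. psi_error \<sigma> v * normal_density u \<delta> v\<bar> \<le> (K * sqrt (4 * pi)) / (\<delta> ^ 27 * u)"
    if A: "1 < \<sigma>" "\<sigma> \<le> 2" "0 < \<delta>" "\<delta> \<le> 1" "0 < u" for \<sigma> \<delta> u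
  proof -
    define e where "e = (\<lambda>t. exp (- (\<delta> * t)\<^sup>2 / 2))"
    define M where "M = (\<lambda>t. K / \<delta> ^ 26 * exp (- (\<delta> * t)\<^sup>2 / 4))"
    define f where "f = (\<lambda>t. laplace_error (Complex \<sigma> t) * of_real (e t))"
    define f' where "f' = (\<lambda>t. \<i> * deriv laplace_error (Complex \<sigma> t) * of_real (e t) + laplace_error (Complex \<sigma> t) * of_real (- \<delta>\<^sup>2 * t * e t))"
    have opn: "open {s::complex. 1 < Re s}" by (rule open_halfspace_Re_gt)
    have Cx: "Complex \<sigma> t = of_real \<sigma> + \<i> * of_real t" for t by (simp add: complex_eq_iff)
    have e0: "e t > 0" for t by (simp add: e_def)
    have M: "has_bochner_integral lborel M (K / \<delta> ^ 26 * (sqrt (4 * pi) / \<delta>))"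
      unfolding M_def using A by (intro has_bochner_integral_mult_right gauss_integral) auto
    have bound: "2 * C * (1 + t\<^sup>2) ^ 13 * e t \<le> M t" for t
      using mult_left_mono[OF gauss_poly_bound[OF A(3,4), of t], of "2 * C"] C(1)
      by (simp add: e_def M_def K_def mult_ac)
    have p1: "(1 + t\<^sup>2) ^ 12 \<le> (1 + t\<^sup>2) ^ 13" for t :: real by (intro power_increasing) auto
    have bf: "norm (f t) \<le> M t" for t
    proof -
      have "norm (f t) \<le> C * (1 + t\<^sup>2) ^ 12 * e t"
        using C(2)[of "Complex \<sigma> t"] A e0[of t] by (simp add: f_def norm_mult mult_right_mono)
      also have "\<dots> \<le> (2 * C) * (1 + t\<^sup>2) ^ 13 * e t"
        using C(1) e0[of t] p1[of t] by (intro mult_right_mono mult_mono) auto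
      finally show ?thesis using bound[of t] by linarith
    qed
    have bf': "norm (f' t) \<le> M t" for t
    proof -
      have t1: "1 + \<delta>\<^sup>2 * \<bar>t\<bar> \<le> 2 * (1 + t\<^sup>2)"
      proof -
        have "\<delta>\<^sup>2 * \<bar>t\<bar> \<le> \<bar>t\<bar>"
          using A mult_right_mono[of "\<delta>\<^sup>2" 1 "\<bar>t\<bar>"] by (simp add: power_le_one)
        moreover have "2 * \<bar>t\<bar> \<le> 1 + t\<^sup>2" using sum_squares_bound[of 1 "\<bar>t\<bar>"] by simp
        moreover have "x \<le> a \<Longrightarrow> 2 * a \<le> 1 + b \<Longrightarrow> 0 \<le> b \<Longrightarrow> 1 + x \<le> 2 * (1 + b)" for x a b :: real
          by simp
        ultimately show ?thesis using zero_le_power2 by blast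
      qed
      have "norm (f' t) \<le> norm (\<i> * deriv laplace_error (Complex \<sigma> t) * of_real (e t)) + norm (laplace_error (Complex \<sigma> t) * of_real (- \<delta>\<^sup>2 * t * e t))"
        unfolding f'_def by (rule norm_triangle_ineq)
      also have "\<dots> = norm (deriv laplace_error (Complex \<sigma> t)) * e t + norm (laplace_error (Complex \<sigma> t)) * (\<delta>\<^sup>2 * \<bar>t\<bar> * e t)"
        using e0[of t] unfolding norm_mult norm_of_real by (simp add: abs_mult)
      also have "\<dots> \<le> C * (1 + t\<^sup>2) ^ 12 * e t + C * (1 + t\<^sup>2) ^ 12 * (\<delta>\<^sup>2 * \<bar>t\<bar> * e t)"
        using C(2,3)[of "Complex \<sigma> t"] A e0[of t] by (intro add_mono mult_right_mono) auto
      also have "\<dots> = C * (1 + t\<^sup>2) ^ 12 * e t * (1 + \<delta>\<^sup>2 * \<bar>t\<bar>)" by (simp add: algebra_simps)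
      also have "\<dots> \<le> C * (1 + t\<^sup>2) ^ 12 * e t * (2 * (1 + t\<^sup>2))"
        using t1 C(1) e0[of t] by (intro mult_left_mono) auto
      also have "\<dots> = 2 * C * (1 + t\<^sup>2) ^ 13 * e t" using power_add[of "1 + t\<^sup>2" 12 1] by simp
      finally show ?thesis using bound[of t] by linarith
    qed
    have der: "(f has_vector_derivative f' t) (at t)" for t
    proof -
      have "(laplace_error has_field_derivative deriv laplace_error (of_real \<sigma> + \<i> * of_real t)) (at (of_real \<sigma> + \<i> * of_real t))"
        using A by (intro holomorphic_derivI[OF laplace_error_holomorphic opn]) auto
      then have "((\<lambda>w. laplace_error (of_real \<sigma> + \<i> * w)) has_field_derivative deriv laplace_error (of_real \<sigma> + \<i> * of_real t) * \<i>) (at (of_real t))"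
        by (intro DERIV_chain2[where f = laplace_error]) (auto intro!: derivative_eq_intros)
      from has_vector_derivative_real_field[OF this]
      have 1: "((\<lambda>t. laplace_error (Complex \<sigma> t)) has_vector_derivative deriv laplace_error (Complex \<sigma> t) * \<i>) (at t)"
        by (simp add: Cx)
      have "(e has_real_derivative (- \<delta>\<^sup>2 * t * e t)) (at t)"
        unfolding e_def by (auto intro!: derivative_eq_intros simp: power2_eq_square)
      then have 2: "((\<lambda>t. complex_of_real (e t)) has_vector_derivative of_real (- \<delta>\<^sup>2 * t * e t)) (at t)"
        by (intro has_vector_derivative_of_real) (simp add: has_real_derivative_iff_has_vector_derivative)
      show ?thesis
        using has_vector_derivative_mult[OF 1 2] unfolding f_def f'_def by (simp add: mult_ac add_ac)
    qed
    have contG: "isCont (\<lambda>t. laplace_error (Complex \<sigma> t)) t" for t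
    proof -
      have "isCont laplace_error (Complex \<sigma> t)"
        using holomorphic_on_imp_continuous_on[OF laplace_error_holomorphic] opn A by (simp add: continuous_on_eq_continuous_at)
      then show ?thesis unfolding Cx by (rule isCont_o2[rotated]) (intro continuous_intros)
    qed
    have contG': "isCont (\<lambda>t. deriv laplace_error (Complex \<sigma> t)) t" for t
    proof -
      have "isCont (deriv laplace_error) (Complex \<sigma> t)"
        using holomorphic_on_imp_continuous_on[OF holomorphic_deriv[OF laplace_error_holomorphic opn]] opn A
        by (simp add: continuous_on_eq_continuous_at)
      then show ?thesis unfolding Cx by (rule isCont_o2[rotated]) (intro continuous_intros)
    qed
    have contf: "isCont f t" for t
      unfolding f_def e_def by (intro continuous_intros contG) auto
    have contf': "isCont f' t" for t
      unfolding f'_def e_def by (intro continuous_intros contG contG') auto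
    have meas: "f \<in> borel_measurable lborel" "f' \<in> borel_measurable lborel"
      using contf contf' by (auto intro!: borel_measurable_continuous_onI continuous_at_imp_continuous_on)
    have Mi: "integrable lborel M" using M by (rule integrable.intros)
    have M0: "0 \<le> M t" for t using norm_ge_zero order.trans bf by blast
    have int: "integrable lborel f" "integrable lborel f'"
      using meas bf bf' M0 by (auto intro!: Bochner_Integration.integrable_bound[OF Mi])
    have Mlim: "(M \<longlongrightarrow> 0) at_top" "(M \<longlongrightarrow> 0) at_bot"
    proof -
      have "((\<lambda>t. exp (- (\<delta> * t)\<^sup>2 / 4)) \<longlongrightarrow> 0) at_top" "((\<lambda>t. exp (- (\<delta> * t)\<^sup>2 / 4)) \<longlongrightarrow> 0) at_bot"
        using A by real_asymp+
      from tendsto_mult_right_zero[OF this(1), of "K / \<delta> ^ 26"] tendsto_mult_right_zero[OF this(2), of "K / \<delta> ^ 26"]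
      show "(M \<longlongrightarrow> 0) at_top" "(M \<longlongrightarrow> 0) at_bot"
        unfolding M_def .
    qed
    have lim: "(f \<longlongrightarrow> 0) at_top" "(f \<longlongrightarrow> 0) at_bot"
      by (rule Lim_null_comparison[OF _ Mlim(1)], use bf in auto)
         (rule Lim_null_comparison[OF _ Mlim(2)], use bf in auto)
    have "norm (CLBINT t. f t * iexp (t * u)) \<le> (LBINT t. norm (f' t)) / u"
      by (rule fourier_by_parts[OF der contf' int lim A(5)])
    also have "\<dots> \<le> (LBINT t. M t) / u"
      using A Mi int bf' by (intro divide_right_mono integral_mono) auto
    also have "(LBINT t. M t) = K * sqrt (4 * pi) / \<delta> ^ 27"
      using M[THEN has_bochner_integral_integral_eq] power_add[of \<delta> 26 1] by simp
    also have "(CLBINT t. f t * iexp (t * u)) = of_real (2 * pi * (LBINT v. psi_error \<sigma> v * normal_density 0 \<delta> (u - v)))"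
      unfolding f_def e_def by (rule smoothing[OF A(1,3)])
    also have "(\<lambda>v. normal_density 0 \<delta> (u - v)) = normal_density u \<delta>"
      by (simp add: normal_density_def fun_eq_iff power2_commute)
    finally have "norm (complex_of_real (2 * pi * (LBINT v. psi_error \<sigma> v * normal_density u \<delta> v))) \<le> K * sqrt (4 * pi) / \<delta> ^ 27 / u"
      by (simp add: fun_eq_iff)
    then have "2 * pi * \<bar>LBINT v. psi_error \<sigma> v * normal_density u \<delta> v\<bar> \<le> K * sqrt (4 * pi) / \<delta> ^ 27 / u"
      unfolding norm_of_real abs_mult by simp
    moreover have "1 * \<bar>LBINT v. psi_error \<sigma> v * normal_density u \<delta> v\<bar> \<le> 2 * pi * \<bar>LBINT v. psi_error \<sigma> v * normal_density u \<delta> v\<bar>"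
      using pi_gt3 by (intro mult_right_mono) auto
    ultimately show ?thesis by (simp add: field_simps)
  qed
  then show ?thesis using K by (intro exI[of _ "K * sqrt (4 * pi)"]) auto
qed

section \<open>Tauberian argument and the prime number theorem\<close>

definition psi_ratio :: "real \<Rightarrow> real" where "psi_ratio v = Psi (exp v) * exp (- v)"

lemma psi_ratio_nonneg: "0 \<le> psi_ratio v" by (simp add: psi_ratio_def Psi_nonneg)

text \<open>The Tauberian condition: since \<open>Psi\<close> is monotone, the ratio cannot fall
  faster than \<open>exp (- v)\<close>.\<close>

lemma psi_ratio_shift: "u \<le> v \<Longrightarrow> psi_ratio u * exp (- (v - u)) \<le> psi_ratio v"
  using Psi_mono[of "exp u" "exp v"] by (simp add: psi_ratio_def mult.assoc flip: exp_add)

lemma Psi_exp_measurable [measurable]: "(\<lambda>v. Psi (exp v)) \<in> borel_measurable borel"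
  by (rule borel_measurable_mono) (auto intro!: monoI Psi_mono)

lemma psi_ratio_measurable [measurable]: "psi_ratio \<in> borel_measurable borel"
  unfolding psi_ratio_def[abs_def] by measurable

lemma normal_second_moment:
  assumes "\<delta> > 0"
  shows "has_bochner_integral lborel (\<lambda>v. normal_density u \<delta> v * (v - u)\<^sup>2) (\<delta>\<^sup>2)"
  using normal_moment_even[OF assms, of u 1] assms by simp

text \<open>Chebyshev's inequality. Outside the window, \<open>1 - (v - u)^2 / \<eta>^2\<close> is
  at most 0, so weighting the density by it gives a lower bound for the mass inside.\<close>

lemma normal_concentration:
  assumes d: "\<delta> > 0" and e: "\<eta> > 0"
  shows "1 - \<delta>\<^sup>2 / \<eta>\<^sup>2 \<le> (LBINT v. indicator {u - \<eta>..u + \<eta>} v * normal_density u \<delta> v)"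
proof -
  have i1: "has_bochner_integral lborel (\<lambda>v. normal_density u \<delta> v - normal_density u \<delta> v * (v - u)\<^sup>2 / \<eta>\<^sup>2) (1 - \<delta>\<^sup>2 / \<eta>\<^sup>2)"
    using d by (intro has_bochner_integral_diff has_bochner_integral_divide_zero normal_second_moment)
               (auto simp: has_bochner_integral_iff)
  have i2: "integrable lborel (\<lambda>v. indicator {u - \<eta>..u + \<eta>} v * normal_density u \<delta> v)"
    using integrable_real_mult_indicator[of "{u - \<eta>..u + \<eta>}" lborel "normal_density u \<delta>"] d
    by (simp add: mult.commute)
  have "(LBINT v. normal_density u \<delta> v - normal_density u \<delta> v * (v - u)\<^sup>2 / \<eta>\<^sup>2)
     \<le> (LBINT v. indicator {u - \<eta>..u + \<eta>} v * normal_density u \<delta> v)"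
  proof (rule integral_mono[OF _ i2])
    show "integrable lborel (\<lambda>v. normal_density u \<delta> v - normal_density u \<delta> v * (v - u)\<^sup>2 / \<eta>\<^sup>2)"
      using i1 by (rule integrable.intros)
    fix v
    show "normal_density u \<delta> v - normal_density u \<delta> v * (v - u)\<^sup>2 / \<eta>\<^sup>2
      \<le> indicator {u - \<eta>..u + \<eta>} v * normal_density u \<delta> v"
    proof (cases "v \<in> {u - \<eta>..u + \<eta>}")
      case True
      have "0 \<le> normal_density u \<delta> v * (v - u)\<^sup>2 / \<eta>\<^sup>2" by simp
      then show ?thesis using True by simp
    next
      case False
      then have "\<eta>\<^sup>2 \<le> \<bar>v - u\<bar>\<^sup>2" using e by (intro power_mono) auto
      then have "1 \<le> (v - u)\<^sup>2 / \<eta>\<^sup>2" using e by simp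
      from mult_left_mono[OF this, of "normal_density u \<delta> v"] show ?thesis
        using False by simp
    qed
  qed
  then show ?thesis using i1 by (simp add: has_bochner_integral_iff)
qed

text \<open>The two one-sided Tauberian estimates compare the monotone function \<open>Psi\<close> with its Gaussian average
  centred \<open>\<eta>\<close> to the right, respectively to the left, of the point in question.\<close>

lemma psi_ratio_upper:
  "\<exists>C>0. \<forall>u>0. \<forall>\<delta>>0. \<forall>\<eta>>0. \<delta> \<le> 1 \<longrightarrow> psi_ratio u * exp (- 2 * \<eta>) * (1 - \<delta>\<^sup>2 / \<eta>\<^sup>2) \<le> 1 + C / (\<delta> ^ 27 * u)"
proof -
  obtain C where C: "C > 0" "\<And>\<sigma> \<delta> u. 1 < \<sigma> \<Longrightarrow> \<sigma> \<le> 2 \<Longrightarrow> 0 < \<delta> \<Longrightarrow> \<delta> \<le> 1 \<Longrightarrow> 0 < u \<Longrightarrow>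
     \<bar>LBINT v. psi_error \<sigma> v * normal_density u \<delta> v\<bar> \<le> C / (\<delta> ^ 27 * u)"
    using smoothed_bound by blast
  have "psi_ratio u * exp (- 2 * \<eta>) * (1 - \<delta>\<^sup>2 / \<eta>\<^sup>2) \<le> 1 + C / (\<delta> ^ 27 * u)"
    if A: "u > 0" "\<delta> > 0" "\<eta> > 0" "\<delta> \<le> 1" for u \<delta> \<eta>
  proof -
    define w where "w = u + \<eta>"
    define N where "N = normal_density w \<delta>"
    have Ni: "integrable lborel N" using A by (simp add: N_def)
    have N0: "0 \<le> N v" for v by (simp add: N_def)
    have Nm [measurable]: "N \<in> borel_measurable borel" using Ni by simp
    have N1: "(LBINT v. N v) = 1" using A by (simp add: N_def)
    have ineq: "psi_ratio u * exp (- 2 * \<eta>) * exp (- (\<sigma> - 1) * (u + 2 * \<eta>)) * (1 - \<delta>\<^sup>2 / \<eta>\<^sup>2) \<le> 1 + C / (\<delta> ^ 27 * u)"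
      if s: "1 < \<sigma>" "\<sigma> \<le> 2" for \<sigma>
    proof -
      define E where "E = (\<lambda>v. indicator {0<..} v * exp (- (\<sigma> - 1) * v))"
      have Em [measurable]: "E \<in> borel_measurable borel" unfolding E_def by measurable
      have E01: "0 \<le> E v" "E v \<le> 1" for v using s by (auto simp: E_def indicator_def intro!: mult_nonpos_nonneg)
      have psi_error: "psi_error \<sigma> v = E v * psi_ratio v - E v" for v
      proof -
        have "exp (- \<sigma> * v) = exp (- (\<sigma> - 1) * v) * exp (- v)" by (simp add: algebra_simps flip: exp_add)
        then show ?thesis by (simp add: psi_error_def E_def psi_ratio_def algebra_simps)
      qed
      have iE: "integrable lborel (\<lambda>v. E v * N v)"
        by (rule Bochner_Integration.integrable_bound[OF Ni]) (use E01 N0 in \<open>auto simp: abs_mult intro!: mult_left_le_one_le\<close>)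
      have iD: "integrable lborel (\<lambda>v. psi_error \<sigma> v * N v)"
      proof (rule Bochner_Integration.integrable_bound)
        show "integrable lborel (\<lambda>v. psi_error \<sigma> v * (1 / (sqrt (2 * pi * \<delta>\<^sup>2))))"
          using psi_error_integrable[OF s(1)] by simp
        have "N v \<le> 1 / (sqrt (2 * pi * \<delta>\<^sup>2))" for v
          unfolding N_def normal_density_def by (intro mult_left_le) (auto simp: divide_nonpos_nonneg)
        then have "\<bar>psi_error \<sigma> v\<bar> * \<bar>N v\<bar> \<le> \<bar>psi_error \<sigma> v\<bar> * \<bar>1 / (sqrt (2 * pi * \<delta>\<^sup>2))\<bar>" for v
          using N0[of v] by (intro mult_left_mono) (auto intro: order.trans[OF _ abs_ge_self])
        then show "AE v in lborel. norm (psi_error \<sigma> v * N v) \<le> norm (psi_error \<sigma> v * (1 / (sqrt (2 * pi * \<delta>\<^sup>2))))"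
          unfolding real_norm_def abs_mult by (intro AE_I2)
        show "(\<lambda>v. psi_error \<sigma> v * N v) \<in> borel_measurable lborel"
          using psi_error_integrable[OF s(1)] by measurable
      qed
      have iH: "integrable lborel (\<lambda>v. E v * psi_ratio v * N v)"
        using Bochner_Integration.integrable_add[OF iD iE] by (simp add: psi_error algebra_simps)
      have "(LBINT v. E v * psi_ratio v * N v) = (LBINT v. psi_error \<sigma> v * N v) + (LBINT v. E v * N v)"
        using Bochner_Integration.integral_add[OF iD iE] by (simp add: psi_error algebra_simps)
      also have "(LBINT v. psi_error \<sigma> v * N v) \<le> C / (\<delta> ^ 27 * w)"
        using C(2)[of \<sigma> \<delta> w] s A by (simp add: N_def w_def)
      also have "C / (\<delta> ^ 27 * w) \<le> C / (\<delta> ^ 27 * u)"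
        using A C(1) by (intro divide_left_mono mult_left_mono) (auto simp: w_def)
      also have "(LBINT v. E v * N v) \<le> (LBINT v. N v)"
        using E01 N0 by (intro integral_mono iE Ni) (auto intro!: mult_left_le_one_le)
      finally have up: "(LBINT v. E v * psi_ratio v * N v) \<le> 1 + C / (\<delta> ^ 27 * u)" using N1 by simp
      \<comment> \<open>A lower bound for the damped ratio on the whole window [u, u + 2 \<eta>]:
        \<open>psi_ratio_shift\<close> costs at most \<open>exp (- 2 * \<eta>)\<close>, and the
        damping is smallest at the right end.\<close>
      define c where "c = psi_ratio u * exp (- 2 * \<eta>) * exp (- (\<sigma> - 1) * (u + 2 * \<eta>))"
      have c0: "c \<ge> 0" by (simp add: c_def psi_ratio_nonneg)
      have "c * (1 - \<delta>\<^sup>2 / \<eta>\<^sup>2) \<le> c * (LBINT v. indicator {w - \<eta>..w + \<eta>} v * N v)"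
        unfolding N_def using A c0 by (intro mult_left_mono normal_concentration)
      also have "\<dots> = (LBINT v. c * (indicator {w - \<eta>..w + \<eta>} v * N v))" by simp
      also have "\<dots> \<le> (LBINT v. E v * psi_ratio v * N v)"
      proof (rule integral_mono[OF _ iH])
        show "integrable lborel (\<lambda>v. c * (indicator {w - \<eta>..w + \<eta>} v * N v))"
          using integrable_real_mult_indicator[OF _ Ni, of "{w - \<eta>..w + \<eta>}"] by (simp add: mult.commute)
        fix v
        show "c * (indicator {w - \<eta>..w + \<eta>} v * N v) \<le> E v * psi_ratio v * N v"
        proof (cases "v \<in> {w - \<eta>..w + \<eta>}")
          case True
          then have v: "u \<le> v" "v \<le> u + 2 * \<eta>" by (auto simp: w_def)
          have "psi_ratio u * exp (- 2 * \<eta>) \<le> psi_ratio u * exp (- (v - u))"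
            using v by (intro mult_left_mono psi_ratio_nonneg) auto
          also have "\<dots> \<le> psi_ratio v" by (rule psi_ratio_shift[OF v(1)])
          finally have "c \<le> psi_ratio v * exp (- (\<sigma> - 1) * v)"
            unfolding c_def using v s by (intro mult_mono) (auto simp: psi_ratio_nonneg)
          then have "c \<le> E v * psi_ratio v" using v A by (simp add: E_def mult.commute)
          then show ?thesis using True N0 by (simp add: mult_right_mono)
        next
          case False
          then show ?thesis using E01 psi_ratio_nonneg N0 by simp
        qed
      qed
      finally show ?thesis using up unfolding c_def by linarith
    qed
    \<comment> \<open>The right-hand side is independent of \<sigma>, so the limit \<sigma> to 1
      removes the damping.\<close>
    have "((\<lambda>\<sigma>. psi_ratio u * exp (- 2 * \<eta>) * exp (- (\<sigma> - 1) * (u + 2 * \<eta>)) * (1 - \<delta>\<^sup>2 / \<eta>\<^sup>2)) \<longlongrightarrow>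
        psi_ratio u * exp (- 2 * \<eta>) * exp (- (1 - 1) * (u + 2 * \<eta>)) * (1 - \<delta>\<^sup>2 / \<eta>\<^sup>2)) (at_right 1)"
      by (intro tendsto_intros)
    moreover have "\<forall>\<^sub>F \<sigma> in at_right 1. psi_ratio u * exp (- 2 * \<eta>) * exp (- (\<sigma> - 1) * (u + 2 * \<eta>)) * (1 - \<delta>\<^sup>2 / \<eta>\<^sup>2) \<le> 1 + C / (\<delta> ^ 27 * u)"
      unfolding eventually_at_right_field using ineq by (intro exI[of _ 2]) auto
    ultimately show ?thesis
      using tendsto_upperbound[of _ _ "at_right (1::real)"] by fastforce
  qed
  then show ?thesis using C(1) by blast
qed

text \<open>A Chebyshev bound, from the upper estimate at \<delta> = 1 and \<eta> = 2, where the
  mass in the window is at least 3/4. The lower estimate needs it to control what lies outside its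
  window.\<close>

lemma psi_ratio_bounded: "\<exists>B\<ge>1. \<forall>v>0. psi_ratio v \<le> B"
proof -
  obtain C where C: "C > 0" "\<And>u \<delta> \<eta>. u > 0 \<Longrightarrow> \<delta> > 0 \<Longrightarrow> \<eta> > 0 \<Longrightarrow> \<delta> \<le> 1 \<Longrightarrow>
     psi_ratio u * exp (- 2 * \<eta>) * (1 - \<delta>\<^sup>2 / \<eta>\<^sup>2) \<le> 1 + C / (\<delta> ^ 27 * u)"
    using psi_ratio_upper by blast
  define B where "B = (1 + C) * exp 4 * 2"
  have "psi_ratio v \<le> max B (Psi (exp 1))" if "v > 0" for v
  proof (cases "v \<ge> 1")
    case True
    have "psi_ratio v * exp (- 4) * (3/4) \<le> 1 + C / v"
      using C(2)[of v 1 2] that by simp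
    also have "C / v \<le> C / 1" using True C(1) by (intro divide_left_mono) auto
    finally have "psi_ratio v * exp (- 4) * (3/4) \<le> 1 + C" by simp
    then have "psi_ratio v * (3/4) \<le> (1 + C) * exp 4"
      by (simp add: exp_minus field_simps)
    then show ?thesis using psi_ratio_nonneg[of v] C(1) by (simp add: B_def)
  next
    case False
    have "psi_ratio v \<le> Psi (exp 1) * 1"
      unfolding psi_ratio_def using False that by (intro mult_mono Psi_mono Psi_nonneg) auto
    then show ?thesis by simp
  qed
  moreover have "B \<ge> 1"
  proof -
    have "1 * 1 \<le> (1 + C) * exp 4" using C(1) by (intro mult_mono) auto
    then show ?thesis by (simp add: B_def)
  qed
  ultimately show ?thesis by (intro exI[of _ "max B (Psi (exp 1))"]) auto
qed

lemma psi_ratio_lower: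
  "\<exists>B C. B \<ge> 1 \<and> C > 0 \<and> (\<forall>v>0. psi_ratio v \<le> B) \<and> (\<forall>u>0. \<forall>\<delta>>0. \<forall>\<eta>>0. \<delta> \<le> 1 \<and> 2 * \<eta> < u \<longrightarrow>
     1 - \<delta>\<^sup>2 / \<eta>\<^sup>2 \<le> psi_ratio u * exp (2 * \<eta>) + B * (\<delta>\<^sup>2 / \<eta>\<^sup>2) + C / (\<delta> ^ 27 * u))"
proof -
  obtain C where C: "C > 0" "\<And>\<sigma> \<delta> u. 1 < \<sigma> \<Longrightarrow> \<sigma> \<le> 2 \<Longrightarrow> 0 < \<delta> \<Longrightarrow> \<delta> \<le> 1 \<Longrightarrow> 0 < u \<Longrightarrow>
     \<bar>LBINT v. psi_error \<sigma> v * normal_density u \<delta> v\<bar> \<le> C / (\<delta> ^ 27 * u)"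
    using smoothed_bound by blast
  obtain B where B: "B \<ge> 1" "\<And>v. v > 0 \<Longrightarrow> psi_ratio v \<le> B" using psi_ratio_bounded by blast
  have "1 - \<delta>\<^sup>2 / \<eta>\<^sup>2 \<le> psi_ratio u * exp (2 * \<eta>) + B * (\<delta>\<^sup>2 / \<eta>\<^sup>2) + 2 * C / (\<delta> ^ 27 * u)"
    if A: "u > 0" "\<delta> > 0" "\<eta> > 0" "\<delta> \<le> 1" "2 * \<eta> < u" for u \<delta> \<eta>
  proof -
    define w where "w = u - \<eta>"
    define N where "N = normal_density w \<delta>"
    have Ni: "integrable lborel N" using A by (simp add: N_def)
    have N0: "0 \<le> N v" for v by (simp add: N_def)
    have Nm [measurable]: "N \<in> borel_measurable borel" using Ni by simp
    have N1: "(LBINT v. N v) = 1" using A by (simp add: N_def)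
    define X where "X = psi_ratio u * exp (2 * \<eta>) + B * (\<delta>\<^sup>2 / \<eta>\<^sup>2) + 2 * C / (\<delta> ^ 27 * u)"
    have ineq: "exp (- (\<sigma> - 1) * u) * (1 - \<delta>\<^sup>2 / \<eta>\<^sup>2) \<le> X"
      if s: "1 < \<sigma>" "\<sigma> \<le> 2" for \<sigma>
    proof -
      define E where "E = (\<lambda>v. indicator {0<..} v * exp (- (\<sigma> - 1) * v))"
      have Em [measurable]: "E \<in> borel_measurable borel" unfolding E_def by measurable
      have E01: "0 \<le> E v" "E v \<le> 1" for v using s by (auto simp: E_def indicator_def intro!: mult_nonpos_nonneg)
      have psi_error: "psi_error \<sigma> v = E v * psi_ratio v - E v" for v
      proof -
        have "exp (- \<sigma> * v) = exp (- (\<sigma> - 1) * v) * exp (- v)" by (simp add: algebra_simps flip: exp_add)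
        then show ?thesis by (simp add: psi_error_def E_def psi_ratio_def algebra_simps)
      qed
      have iE: "integrable lborel (\<lambda>v. E v * N v)"
        by (rule Bochner_Integration.integrable_bound[OF Ni]) (use E01 N0 in \<open>auto simp: abs_mult intro!: mult_left_le_one_le\<close>)
      have EhB: "0 \<le> E v * psi_ratio v" "E v * psi_ratio v \<le> B" for v
      proof -
        show "0 \<le> E v * psi_ratio v" using E01 psi_ratio_nonneg by simp
        show "E v * psi_ratio v \<le> B"
        proof (cases "v > 0")
          case True
          have "E v * psi_ratio v \<le> 1 * B" using E01[of v] B True psi_ratio_nonneg by (intro mult_mono) auto
          then show ?thesis by simp
        qed (use B in \<open>simp add: E_def\<close>)
      qed
      have iH: "integrable lborel (\<lambda>v. E v * psi_ratio v * N v)"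
      proof (rule Bochner_Integration.integrable_bound)
        show "integrable lborel (\<lambda>v. B * N v)" using Ni by simp
        show "AE v in lborel. norm (E v * psi_ratio v * N v) \<le> norm (B * N v)"
        proof (rule AE_I2)
          fix v
          have "E v * psi_ratio v * N v \<le> B * N v" "0 \<le> E v * psi_ratio v * N v"
            using EhB[of v] N0[of v] by (auto intro: mult_right_mono)
          then show "norm (E v * psi_ratio v * N v) \<le> norm (B * N v)"
            unfolding real_norm_def by linarith
        qed
      qed measurable
      have sec: "has_bochner_integral lborel (\<lambda>v. N v * (v - w)\<^sup>2) (\<delta>\<^sup>2)"
        unfolding N_def by (rule normal_second_moment[OF A(2)])
      \<comment> \<open>Inside the window the ratio is at most
        \<open>psi_ratio u * exp (2 * \<eta>)\<close>. Outside, only the bound \<open>B\<close> is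
        known, and there \<open>(v - w)^2 / \<eta>^2\<close> is at least 1, so the second moment
        pays for it.\<close>
      have maj: "has_bochner_integral lborel (\<lambda>v. psi_ratio u * exp (2 * \<eta>) * N v + B / \<eta>\<^sup>2 * (N v * (v - w)\<^sup>2))
         (psi_ratio u * exp (2 * \<eta>) * 1 + B / \<eta>\<^sup>2 * \<delta>\<^sup>2)"
        using Ni N1 by (intro has_bochner_integral_add has_bochner_integral_mult_right sec) (simp add: has_bochner_integral_iff)
      have up: "(LBINT v. E v * psi_ratio v * N v) \<le> psi_ratio u * exp (2 * \<eta>) * 1 + B / \<eta>\<^sup>2 * \<delta>\<^sup>2"
        unfolding has_bochner_integral_integral_eq[OF maj, symmetric]
      proof (rule integral_mono[OF iH integrable.intros[OF maj]])
        fix v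
        have p1: "0 \<le> psi_ratio u * exp (2 * \<eta>) * N v" using psi_ratio_nonneg N0 by simp
        have p2: "0 \<le> B / \<eta>\<^sup>2 * (N v * (v - w)\<^sup>2)" using B N0 by simp
        show "E v * psi_ratio v * N v \<le> psi_ratio u * exp (2 * \<eta>) * N v + B / \<eta>\<^sup>2 * (N v * (v - w)\<^sup>2)"
        proof (cases "v \<in> {w - \<eta>..w + \<eta>}")
          case True
          then have v: "u - 2 * \<eta> \<le> v" "v \<le> u" by (auto simp: w_def)
          have "psi_ratio v * exp (- (u - v)) * exp (u - v) \<le> psi_ratio u * exp (2 * \<eta>)"
            using v psi_ratio_shift[OF v(2)] psi_ratio_nonneg by (intro mult_mono) auto
          then have "psi_ratio v \<le> psi_ratio u * exp (2 * \<eta>)" by (simp add: mult.assoc flip: exp_add)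
          then have "E v * psi_ratio v \<le> psi_ratio u * exp (2 * \<eta>)"
            using E01[of v] psi_ratio_nonneg[of v] mult_left_le_one_le[of "psi_ratio v" "E v"] by linarith
          then have "E v * psi_ratio v * N v \<le> psi_ratio u * exp (2 * \<eta>) * N v" using N0 by (intro mult_right_mono)
          then show ?thesis using p2 by linarith
        next
          case False
          then have "\<eta>\<^sup>2 \<le> \<bar>v - w\<bar>\<^sup>2" using A by (intro power_mono) auto
          then have "1 \<le> (v - w)\<^sup>2 / \<eta>\<^sup>2" using A by simp
          then have "B * N v * 1 \<le> B * N v * ((v - w)\<^sup>2 / \<eta>\<^sup>2)" using B N0 by (intro mult_left_mono) auto
          moreover have "E v * psi_ratio v * N v \<le> B * N v" using EhB N0 by (intro mult_right_mono)
          ultimately show ?thesis using p1 by (simp add: mult_ac)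
        qed
      qed
      have "(LBINT v. psi_error \<sigma> v * N v) = (LBINT v. E v * psi_ratio v * N v) - (LBINT v. E v * N v)"
        using Bochner_Integration.integral_diff[OF iH iE] by (simp add: psi_error algebra_simps)
      then have "(LBINT v. E v * N v) = (LBINT v. E v * psi_ratio v * N v) - (LBINT v. psi_error \<sigma> v * N v)" by simp
      also have "\<dots> \<le> (LBINT v. E v * psi_ratio v * N v) + C / (\<delta> ^ 27 * w)"
        using C(2)[of \<sigma> \<delta> w] s A by (simp add: N_def w_def)
      \<comment> \<open>The hypothesis \<open>2 * \<eta> < u\<close> keeps the centre
        \<open>w\<close> above \<open>u / 2\<close>; hence the constant
        \<open>2 * C\<close>.\<close>
      also have "C / (\<delta> ^ 27 * w) \<le> C / (\<delta> ^ 27 * (u / 2))"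
        using A C(1) by (intro divide_left_mono mult_left_mono) (auto simp: w_def)
      finally have low: "(LBINT v. E v * N v) \<le> X"
        using up by (simp add: X_def field_simps)
      define c where "c = exp (- (\<sigma> - 1) * u)"
      have c0: "c \<ge> 0" by (simp add: c_def)
      have "c * (1 - \<delta>\<^sup>2 / \<eta>\<^sup>2) \<le> c * (LBINT v. indicator {w - \<eta>..w + \<eta>} v * N v)"
        unfolding N_def using A c0 by (intro mult_left_mono normal_concentration)
      also have "\<dots> = (LBINT v. c * (indicator {w - \<eta>..w + \<eta>} v * N v))" by simp
      also have "\<dots> \<le> (LBINT v. E v * N v)"
      proof (rule integral_mono[OF _ iE])
        show "integrable lborel (\<lambda>v. c * (indicator {w - \<eta>..w + \<eta>} v * N v))"
          using integrable_real_mult_indicator[OF _ Ni, of "{w - \<eta>..w + \<eta>}"] by (simp add: mult.commute)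
        fix v
        show "c * (indicator {w - \<eta>..w + \<eta>} v * N v) \<le> E v * N v"
        proof (cases "v \<in> {w - \<eta>..w + \<eta>}")
          case True
          then have v: "0 < v" "v \<le> u" using A by (auto simp: w_def)
          then have "c \<le> E v" using s by (simp add: c_def E_def mult_left_mono)
          then show ?thesis using True N0 by (simp add: mult_right_mono)
        next
          case False
          then show ?thesis using E01 N0 by simp
        qed
      qed
      finally show ?thesis using low unfolding c_def by linarith
    qed
    have "((\<lambda>\<sigma>. exp (- (\<sigma> - 1) * u) * (1 - \<delta>\<^sup>2 / \<eta>\<^sup>2)) \<longlongrightarrow> exp (- (1 - 1) * u) * (1 - \<delta>\<^sup>2 / \<eta>\<^sup>2)) (at_right 1)"
      by (intro tendsto_intros)
    moreover have "\<forall>\<^sub>F \<sigma> in at_right 1. exp (- (\<sigma> - 1) * u) * (1 - \<delta>\<^sup>2 / \<eta>\<^sup>2) \<le> X"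
      unfolding eventually_at_right_field using ineq by (intro exI[of _ 2]) auto
    ultimately show ?thesis
      unfolding X_def[symmetric] using tendsto_upperbound[of _ _ "at_right (1::real)"] by fastforce
  qed
  then show ?thesis using B C(1) by (intro exI[of _ B] exI[of _ "2 * C"]) auto
qed


text \<open>With \<eta> = \<open>u powr (-1/60)\<close> and \<delta> = \<eta>^2 all losses are
  O(\<eta>): the window width costs a multiple of \<eta>, the mass outside is at most \<delta>^2 /
  \<eta>^2 = \<eta>^2, and \<delta>^27 = \<open>u powr (-9/10)\<close> leaves
  \<open>u powr (-1/10)\<close> for the smoothing error.\<close>

theorem PNT_Psi: "\<exists>C>0. \<forall>x\<ge>3. \<bar>Psi x - x\<bar> \<le> C * x * ln x powr (-1/60)"
proof -
  obtain C1 where C1: "C1 > 0" "\<And>u \<delta> \<eta>. u > 0 \<Longrightarrow> \<delta> > 0 \<Longrightarrow> \<eta> > 0 \<Longrightarrow> \<delta> \<le> 1 \<Longrightarrow>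
     psi_ratio u * exp (- 2 * \<eta>) * (1 - \<delta>\<^sup>2 / \<eta>\<^sup>2) \<le> 1 + C1 / (\<delta> ^ 27 * u)"
    using psi_ratio_upper by blast
  obtain B C2 where C2: "B \<ge> 1" "C2 > 0" "\<And>v. v > 0 \<Longrightarrow> psi_ratio v \<le> B"
    "\<And>u \<delta> \<eta>. u > 0 \<Longrightarrow> \<delta> > 0 \<Longrightarrow> \<eta> > 0 \<Longrightarrow> \<delta> \<le> 1 \<Longrightarrow> 2 * \<eta> < u \<Longrightarrow>
     1 - \<delta>\<^sup>2 / \<eta>\<^sup>2 \<le> psi_ratio u * exp (2 * \<eta>) + B * (\<delta>\<^sup>2 / \<eta>\<^sup>2) + C2 / (\<delta> ^ 27 * u)"
    using psi_ratio_lower by blast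
  define C where "C = 9 * B + C1 + C2 + 5"
  have main: "\<bar>psi_ratio u - 1\<bar> \<le> C * u powr (-1/60)" if u: "u \<ge> 1" for u
  proof -
    define \<eta> where "\<eta> = u powr (-1/60)"
    have e0: "0 < \<eta>" using u by (simp add: \<eta>_def)
    have e1: "\<eta> \<le> 1" using u powr_mono[of "-1/60" 0 u] by (simp add: \<eta>_def)
    have hB: "psi_ratio u \<le> B" and h0: "0 \<le> psi_ratio u" using C2(3)[of u] u psi_ratio_nonneg by auto
    show ?thesis
    proof (cases "\<eta> \<le> 1/4")
      \<comment> \<open>Here \<eta> exceeds 1/4 and the Chebyshev bound \<open>B\<close> is enough.
        In the other case, \<eta> is small enough for \<open>2 * \<eta> < u\<close> and for the
        quadratic bound on \<open>exp (2 * \<eta>)\<close>.\<close>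
      case False
      have "4 * (B + 1) * (1/4) \<le> 4 * (B + 1) * \<eta>" using False C2(1) by (intro mult_left_mono) auto
      also have "\<dots> \<le> C * \<eta>" using C1(1) C2(1,2) e0 by (intro mult_right_mono) (auto simp: C_def)
      finally show ?thesis using hB h0 C2(1) unfolding \<eta>_def[symmetric] by (simp add: abs_le_iff)
    next
      case True
      define \<delta> where "\<delta> = \<eta>\<^sup>2"
      have d: "0 < \<delta>" "\<delta> \<le> 1" using e0 e1 by (auto simp: \<delta>_def power_le_one)
      have q: "\<delta>\<^sup>2 / \<eta>\<^sup>2 \<le> \<eta>"
        using e0 e1 by (simp add: \<delta>_def power2_eq_square mult_left_le)
      have du: "\<delta> ^ 27 * u = u powr (1/10)"
      proof -
        have "\<delta> ^ 27 = \<eta> ^ 54" by (simp add: \<delta>_def flip: power_mult)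
        also have "\<dots> = u powr (-1/60 * 54)" using u by (simp add: \<eta>_def powr_powr flip: powr_realpow)
        finally show ?thesis using u powr_add[of u "-9/10" 1] by simp
      qed
      have e: "1 / (\<delta> ^ 27 * u) \<le> \<eta>"
      proof -
        have "1 / (\<delta> ^ 27 * u) = u powr (- (1/10))"
          unfolding du by (rule powr_minus_divide [symmetric])
        also have "\<dots> \<le> u powr (-1/60)" using u by (intro powr_mono) auto
        finally show ?thesis by (simp only: \<eta>_def)
      qed
      have ea: "C1 / (\<delta> ^ 27 * u) \<le> C1 * \<eta>" "C2 / (\<delta> ^ 27 * u) \<le> C2 * \<eta>"
        using mult_left_mono[OF e, of C1] mult_left_mono[OF e, of C2] C1(1) C2(2) by auto
      have up: "psi_ratio u \<le> 1 + (C1 + 3 * B) * \<eta>"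
      proof -
        have "(1 - 2 * \<eta>) * (1 - \<eta>) = 1 - 3 * \<eta> + 2 * (\<eta> * \<eta>)" by (simp add: algebra_simps)
        moreover have "0 \<le> \<eta> * \<eta>" by simp
        ultimately have "1 - 3 * \<eta> \<le> (1 - 2 * \<eta>) * (1 - \<eta>)" by linarith
        also have "\<dots> \<le> exp (- 2 * \<eta>) * (1 - \<delta>\<^sup>2 / \<eta>\<^sup>2)"
        proof (rule mult_mono)
          show "1 - 2 * \<eta> \<le> exp (- 2 * \<eta>)" using exp_ge_add_one_self[of "- 2 * \<eta>"] by simp
          show "1 - \<eta> \<le> 1 - \<delta>\<^sup>2 / \<eta>\<^sup>2" using q by linarith
          show "0 \<le> 1 - \<eta>" using e1 by linarith
        qed simp
        finally have "psi_ratio u * (1 - 3 * \<eta>) \<le> psi_ratio u * (exp (- 2 * \<eta>) * (1 - \<delta>\<^sup>2 / \<eta>\<^sup>2))"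
          using h0 by (rule mult_left_mono)
        also have "\<dots> \<le> 1 + C1 * \<eta>"
          using C1(2)[of u \<delta> \<eta>] ea d e0 u by simp
        finally have "psi_ratio u \<le> 1 + C1 * \<eta> + 3 * (psi_ratio u * \<eta>)" by (simp add: algebra_simps)
        moreover have "psi_ratio u * \<eta> \<le> B * \<eta>" using hB e0 by simp
        ultimately show ?thesis by (simp add: algebra_simps)
      qed
      have low: "1 - (1 + 5 * B + C2) * \<eta> \<le> psi_ratio u"
      proof -
        have "exp (2 * \<eta>) \<le> 1 + 2 * \<eta> + (2 * \<eta>)\<^sup>2"
          using e0 True by (intro exp_bound) auto
        also have "(2 * \<eta>)\<^sup>2 \<le> 2 * \<eta>" using e0 True by (simp add: power2_eq_square)
        finally have "psi_ratio u * exp (2 * \<eta>) \<le> psi_ratio u * (1 + 4 * \<eta>)" using h0 by (intro mult_left_mono) auto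
        also have "\<dots> = psi_ratio u + 4 * (psi_ratio u * \<eta>)" by (simp add: algebra_simps)
        also have "psi_ratio u * \<eta> \<le> B * \<eta>" using hB e0 by simp
        finally have 1: "psi_ratio u * exp (2 * \<eta>) \<le> psi_ratio u + 4 * (B * \<eta>)" by simp
        have 2: "B * (\<delta>\<^sup>2 / \<eta>\<^sup>2) \<le> B * \<eta>" using q C2(1) by (intro mult_left_mono) auto
        have "1 - \<delta>\<^sup>2 / \<eta>\<^sup>2 \<le> psi_ratio u * exp (2 * \<eta>) + B * (\<delta>\<^sup>2 / \<eta>\<^sup>2) + C2 / (\<delta> ^ 27 * u)"
          using C2(4)[of u \<delta> \<eta>] d e0 u True by simp
        then show ?thesis using 1 2 q ea by (simp add: algebra_simps)
      qed
      have "(C1 + 3 * B) * \<eta> \<le> C * \<eta>" "(1 + 5 * B + C2) * \<eta> \<le> C * \<eta>"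
        using C1(1) C2(1,2) e0 by (auto simp: C_def)
      then show ?thesis using up low unfolding \<eta>_def[symmetric] by (simp add: abs_le_iff)
    qed
  qed
  have "\<bar>Psi x - x\<bar> \<le> C * x * ln x powr (-1/60)" if x: "x \<ge> 3" for x
  proof -
    have "1 \<le> ln (3::real)" using exp_le by (subst ln_ge_iff) auto
    then have "1 \<le> ln x" using x by (meson ln_le_cancel_iff order.trans less_le_trans zero_less_numeral)
    from main[OF this] have "x * \<bar>psi_ratio (ln x) - 1\<bar> \<le> x * (C * ln x powr (-1/60))"
      using x by (intro mult_left_mono) auto
    also have "x * \<bar>psi_ratio (ln x) - 1\<bar> = \<bar>x * (psi_ratio (ln x) - 1)\<bar>" using x by (simp add: abs_mult)
    also have "x * (psi_ratio (ln x) - 1) = Psi x - x"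
      using x by (simp add: psi_ratio_def exp_minus algebra_simps)
    finally show ?thesis by (simp add: mult_ac)
  qed
  moreover have "C > 0" using C1(1) C2(1,2) by (simp add: C_def)
  ultimately show ?thesis by blast
qed

section \<open>Odd primes: Chebyshev function and Mertens sum\<close>

definition oprimes :: "real \<Rightarrow> nat set" where
  "oprimes x = {p. prime p \<and> odd p \<and> real p \<le> x}"

definition theta :: "real \<Rightarrow> real" where "theta x = (\<Sum>p\<in>oprimes x. ln (real p))"

lemma finite_nat_le_real [simp]: "finite {n::nat. real n \<le> x}"
  by (rule finite_subset[of _ "{..nat \<lfloor>x\<rfloor>}"]) (auto simp: le_nat_floor)

lemma finite_oprimes [simp]: "finite (oprimes x)"
  by (rule finite_subset[OF _ finite_nat_le_real[of x]]) (auto simp: oprimes_def)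

lemma oprimes_ge_3: "p \<in> oprimes x \<Longrightarrow> p \<ge> 3"
  using prime_ge_2_nat[of p] by (auto simp: oprimes_def) presburger

text \<open>A prime power that is not an odd prime is a power of 2 or has an exponent of at least 2,
  and then its base is at most \<open>sqrt x\<close>. Exponents never exceed \<open>log 2 x\<close>.
  The base 2 is inserted separately because it may exceed \<open>sqrt x\<close>.\<close>

lemma card_bad_primepows:
  assumes x: "x \<ge> 1"
  shows "real (card {n. real n < x \<and> mangoldt n \<noteq> (0::real) \<and> \<not> (prime n \<and> odd n)}) \<le> (sqrt x + 2) * (log 2 x + 1)"
proof -
  define A where "A = insert 2 {m::nat. real m \<le> sqrt x}"
  define B where "B = {k::nat. real k \<le> log 2 x}"
  have fin: "finite A" "finite B" by (auto simp: A_def B_def)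
  have card_le: "real (card {m::nat. real m \<le> y}) \<le> y + 1" if "y \<ge> 0" for y
  proof -
    have "card {m::nat. real m \<le> y} \<le> card {..nat \<lfloor>y\<rfloor>}"
      by (rule card_mono) (auto simp: le_nat_floor)
    also have "\<dots> = nat \<lfloor>y\<rfloor> + 1" by simp
    finally have "real (card {m::nat. real m \<le> y}) \<le> real (nat \<lfloor>y\<rfloor>) + 1" by linarith
    also have "\<dots> \<le> y + 1" using that by simp
    finally show ?thesis .
  qed
  have "{n. real n < x \<and> mangoldt n \<noteq> (0::real) \<and> \<not> (prime n \<and> odd n)} \<subseteq> (\<lambda>(p,k). p ^ k) ` (A \<times> B)"
  proof
    fix n assume "n \<in> {n. real n < x \<and> mangoldt n \<noteq> (0::real) \<and> \<not> (prime n \<and> odd n)}"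
    then have n: "real n < x" "primepow n" "\<not> (prime n \<and> odd n)"
      unfolding mangoldt_def by (simp_all split: if_splits)
    then obtain p k where pk: "prime p" "k > 0" "n = p ^ k"
      unfolding primepow_def by blast
    have p2: "p \<ge> 2" using pk prime_ge_2_nat by blast
    have "2 ^ k \<le> real p ^ k" using p2 by (intro power_mono) auto
    moreover have "real p ^ k = real n" by (simp add: pk(3))
    moreover have "2 powr real k = 2 ^ k" by (rule powr_realpow) simp
    ultimately have "2 powr real k \<le> x" using n(1) by linarith
    then have "k \<in> B" using x by (simp add: B_def le_log_iff)
    moreover have "p \<in> A"
    proof (cases "k \<ge> 2")
      case True
      then have "real p ^ 2 \<le> real p ^ k" using p2 by (intro power_increasing) auto
      moreover have "real p ^ k = real n" by (simp add: pk(3))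
      ultimately have "(real p)\<^sup>2 \<le> x" using n(1) by linarith
      then have "real p \<le> sqrt x" by (rule real_le_rsqrt)
      then show ?thesis by (simp add: A_def)
    next
      case False
      then have "n = p" using pk by (cases k) auto
      then have "even p" using n(3) pk(1) by simp
      then have "p = 2" using primes_dvd_imp_eq[OF two_is_prime_nat pk(1)] by simp
      then show ?thesis by (simp add: A_def)
    qed
    ultimately show "n \<in> (\<lambda>(p,k). p ^ k) ` (A \<times> B)" using pk by auto
  qed
  then have "card {n. real n < x \<and> mangoldt n \<noteq> (0::real) \<and> \<not> (prime n \<and> odd n)} \<le> card ((\<lambda>(p,k). p ^ k) ` (A \<times> B))"
    using fin by (intro card_mono) auto
  also have "\<dots> \<le> card (A \<times> B)" using fin by (intro card_image_le) auto
  also have "\<dots> = card A * card B" by (rule card_cartesian_product)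
  finally have "real (card {n. real n < x \<and> mangoldt n \<noteq> (0::real) \<and> \<not> (prime n \<and> odd n)}) \<le> real (card A * card B)"
    unfolding of_nat_le_iff .
  also have "real (card A * card B) = real (card A) * real (card B)" by (rule of_nat_mult)
  also have "\<dots> \<le> (sqrt x + 2) * (log 2 x + 1)"
  proof (rule mult_mono)
    have "card A \<le> card {m::nat. real m \<le> sqrt x} + 1" by (simp add: A_def card_insert_if)
    then have "real (card A) \<le> real (card {m::nat. real m \<le> sqrt x}) + 1" by linarith
    then show "real (card A) \<le> sqrt x + 2" using card_le[of "sqrt x"] x by simp
    show "real (card B) \<le> log 2 x + 1" unfolding B_def using x by (intro card_le) simp
  qed (use x in auto)
  finally show ?thesis .
qed

lemma theta_Psi:
  assumes x: "x \<ge> 1"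
  shows "\<bar>theta x - Psi x\<bar> \<le> ln x * ((sqrt x + 2) * (log 2 x + 1) + 1)"
proof -
  define G where "G = {p. prime p \<and> odd p \<and> real p < x}"
  define Bd where "Bd = {n. real n < x \<and> mangoldt n \<noteq> (0::real) \<and> \<not> (prime n \<and> odd n)}"
  have fin: "finite G" "finite Bd"
    by (auto intro!: finite_subset[OF _ finite_nat_le_real[of x]] simp: G_def Bd_def)
  have "Psi x = (\<Sum>n\<in>G \<union> Bd. mangoldt n)"
    unfolding Psi_def by (rule sum.mono_neutral_right) (auto simp: finite_nat_less_real G_def Bd_def)
  also have "\<dots> = (\<Sum>n\<in>G. mangoldt n) + (\<Sum>n\<in>Bd. mangoldt n)"
    using fin by (intro sum.union_disjoint) (auto simp: G_def Bd_def)
  also have "(\<Sum>n\<in>G. mangoldt n) = (\<Sum>p\<in>G. ln (real p))"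
    by (rule sum.cong) (auto simp: G_def)
  finally have 1: "Psi x = (\<Sum>p\<in>G. ln (real p)) + (\<Sum>n\<in>Bd. mangoldt n)" .
  \<comment> \<open>\<open>Psi\<close> stops strictly below \<open>x\<close> and
    \<open>theta\<close> includes \<open>x\<close>, so the endpoint adds at most one prime.\<close>
  have 2: "theta x = (\<Sum>p\<in>G. ln (real p)) + (\<Sum>p\<in>{p. prime p \<and> odd p \<and> real p = x}. ln (real p))"
    unfolding theta_def
    by (subst sum.union_disjoint [symmetric])
       (auto simp: G_def oprimes_def intro!: sum.cong finite_subset[OF _ finite_nat_le_real[of x]])
  have "{p. prime p \<and> odd p \<and> real p = x} \<subseteq> {nat \<lfloor>x\<rfloor>}" by auto
  then have "card {p. prime p \<and> odd p \<and> real p = x} \<le> 1"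
    using card_mono[of "{nat \<lfloor>x\<rfloor>}" "{p. prime p \<and> odd p \<and> real p = x}"] by simp
  then have c1: "(\<Sum>p\<in>{p. prime p \<and> odd p \<and> real p = x}. ln (real p)) \<le> ln x * 1"
  proof -
    have "(\<Sum>p\<in>{p. prime p \<and> odd p \<and> real p = x}. ln (real p)) \<le> real (card {p. prime p \<and> odd p \<and> real p = x}) * ln x"
      by (rule sum_bounded_above) auto
    also have "\<dots> \<le> 1 * ln x" using \<open>card _ \<le> 1\<close> x by (intro mult_right_mono) auto
    finally show ?thesis by simp
  qed
  have c0: "0 \<le> (\<Sum>p\<in>{p. prime p \<and> odd p \<and> real p = x}. ln (real p))" using x by (intro sum_nonneg) auto
  have "(\<Sum>n\<in>Bd. mangoldt n) \<le> real (card Bd) * ln x"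
  proof (rule sum_bounded_above)
    fix n assume n: "n \<in> Bd"
    then have "n > 0" by (cases "n = 0") (simp_all add: Bd_def)
    then have "mangoldt n \<le> ln (real n)" by (rule mangoldt_le)
    also have "\<dots> \<le> ln x" using n \<open>n > 0\<close> by (simp add: Bd_def)
    finally show "mangoldt n \<le> ln x" .
  qed
  also have "\<dots> \<le> (sqrt x + 2) * (log 2 x + 1) * ln x"
    using card_bad_primepows[OF x] x unfolding Bd_def by (intro mult_right_mono) auto
  finally have c2: "(\<Sum>n\<in>Bd. mangoldt n) \<le> ln x * ((sqrt x + 2) * (log 2 x + 1))" by (simp add: mult_ac)
  have c3: "0 \<le> (\<Sum>n\<in>Bd. mangoldt n :: real)" by (intro sum_nonneg mangoldt_nonneg)
  have c4: "0 \<le> ln x" "0 \<le> ln x * ((sqrt x + 2) * (log 2 x + 1))" using x by auto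
  have "theta x - Psi x = (\<Sum>p\<in>{p. prime p \<and> odd p \<and> real p = x}. ln (real p)) - (\<Sum>n\<in>Bd. mangoldt n)"
    unfolding 1 2 by simp
  moreover have "ln x * ((sqrt x + 2) * (log 2 x + 1) + 1) = ln x * ((sqrt x + 2) * (log 2 x + 1)) + ln x"
    by (simp only: distrib_left mult_1_right)
  ultimately show ?thesis using c0 c1 c2 c3 c4 unfolding abs_le_iff by linarith
qed

text \<open>The shifts by 1 make both logarithms at least 1 from \<open>x = 1\<close> on. Estimates
  will be applied at \<open>x / m\<close> for all \<open>m\<close> up to \<open>x\<close>, so they
  must hold there without a threshold.\<close>

definition lnp :: "real \<Rightarrow> real" where "lnp x = 1 + ln x"
definition lnlnp :: "real \<Rightarrow> real" where "lnlnp x = 1 + ln (lnp x)"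

lemma lnp_ge_1: "x \<ge> 1 \<Longrightarrow> lnp x \<ge> 1" by (simp add: lnp_def)
lemma lnlnp_ge_1: "x \<ge> 1 \<Longrightarrow> lnlnp x \<ge> 1" using lnp_ge_1[of x] by (simp add: lnlnp_def)
lemma lnp_mono: "1 \<le> x \<Longrightarrow> x \<le> y \<Longrightarrow> lnp x \<le> lnp y" by (simp add: lnp_def)
lemma lnlnp_mono: "1 \<le> x \<Longrightarrow> x \<le> y \<Longrightarrow> lnlnp x \<le> lnlnp y"
  using lnp_mono[of x y] lnp_ge_1[of x] by (simp add: lnlnp_def)

lemma ln_oprimes_nonneg: "p \<in> oprimes x \<Longrightarrow> 0 \<le> ln (real p)"
  using oprimes_ge_3[of p x] by simp

lemma theta_nonneg: "0 \<le> theta x"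
  unfolding theta_def by (intro sum_nonneg ln_oprimes_nonneg)

lemma theta_mono: "x \<le> y \<Longrightarrow> theta x \<le> theta y"
  unfolding theta_def by (intro sum_mono2) (auto simp: oprimes_def intro: ln_oprimes_nonneg[of _ y, unfolded oprimes_def])

lemma PNT_theta: "\<exists>C>0. \<forall>x\<ge>1. \<bar>theta x - x\<bar> \<le> C * x * lnp x powr (-1/60)"
proof -
  obtain C where C: "C > 0" "\<And>x. x \<ge> 3 \<Longrightarrow> \<bar>Psi x - x\<bar> \<le> C * x * ln x powr (-1/60)"
    using PNT_Psi by blast
  have "\<forall>\<^sub>F x::real in at_top. ln x * ((sqrt x + 2) * (log 2 x + 1) + 1) \<le> x * (1 + ln x) powr (-1/60)"
    by real_asymp
  moreover have "\<forall>\<^sub>F x::real in at_top. ln x powr (-1/60) \<le> 2 * (1 + ln x) powr (-1/60)"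
    by real_asymp
  ultimately have "\<forall>\<^sub>F x::real in at_top. x \<ge> 3 \<and> ln x * ((sqrt x + 2) * (log 2 x + 1) + 1) \<le> x * (1 + ln x) powr (-1/60) \<and> ln x powr (-1/60) \<le> 2 * (1 + ln x) powr (-1/60)"
    using eventually_ge_at_top[of 3] by eventually_elim auto
  then obtain X where X: "\<And>x. x \<ge> X \<Longrightarrow> x \<ge> 3 \<and> ln x * ((sqrt x + 2) * (log 2 x + 1) + 1) \<le> x * (1 + ln x) powr (-1/60) \<and> ln x powr (-1/60) \<le> 2 * (1 + ln x) powr (-1/60)"
    unfolding eventually_at_top_linorder by blast
  have X3: "X \<ge> 3" using X[of X] by simp
  \<comment> \<open>Covers the range from 1 to \<open>X\<close>, where \<open>theta X + X\<close> is
    a trivial bound and the power of \<open>lnp\<close> is smallest at \<open>X\<close>.\<close>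
  define D where "D = (theta X + X) / lnp X powr (-1/60)"
  have D0: "D \<ge> 0" using theta_nonneg[of X] X3 by (simp add: D_def)
  have "\<bar>theta x - x\<bar> \<le> (2 * C + 1 + D) * x * lnp x powr (-1/60)" if x: "x \<ge> 1" for x
  proof (cases "x \<ge> X")
    case True
    note X' = X[OF True]
    have "\<bar>theta x - x\<bar> \<le> \<bar>theta x - Psi x\<bar> + \<bar>Psi x - x\<bar>" by linarith
    also have "\<dots> \<le> x * lnp x powr (-1/60) + C * x * (2 * lnp x powr (-1/60))"
    proof (rule add_mono)
      show "\<bar>theta x - Psi x\<bar> \<le> x * lnp x powr (-1/60)"
        using theta_Psi[OF x] X' unfolding lnp_def by linarith
      have "C * x * ln x powr (-1/60) \<le> C * x * (2 * lnp x powr (-1/60))"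
        using X' C(1) x unfolding lnp_def by (intro mult_left_mono) auto
      then show "\<bar>Psi x - x\<bar> \<le> C * x * (2 * lnp x powr (-1/60))" using C(2)[of x] X' by linarith
    qed
    also have "\<dots> = (2 * C + 1) * x * lnp x powr (-1/60)" by (simp add: algebra_simps)
    also have "\<dots> \<le> (2 * C + 1 + D) * x * lnp x powr (-1/60)"
      using D0 x by (intro mult_right_mono) auto
    finally show ?thesis .
  next
    case False
    have "\<bar>theta x - x\<bar> \<le> theta X + X"
      using theta_mono[of x X] theta_nonneg[of x] False x by linarith
    also have "\<dots> = D * lnp X powr (-1/60)" using X3 lnp_ge_1[of X] by (simp add: D_def)
    also have "\<dots> \<le> D * lnp x powr (-1/60)"
      using False x lnp_mono[of x X] lnp_ge_1[of x] D0 by (intro mult_left_mono powr_mono2') auto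
    also have "\<dots> = D * 1 * lnp x powr (-1/60)" by simp
    also have "\<dots> \<le> (2 * C + 1 + D) * x * lnp x powr (-1/60)"
      using D0 x C(1) by (intro mult_right_mono mult_mono) auto
    finally show ?thesis .
  qed
  then show ?thesis using C(1) D0 by (intro exI[of _ "2 * C + 1 + D"]) auto
qed

section \<open>Mertens' theorem for odd primes\<close>

definition prime_recips :: "real \<Rightarrow> real" where "prime_recips x = (\<Sum>p\<in>oprimes x. 1 / real p)"

lemma oprimes_empty:
  assumes "x < 3"
  shows "oprimes x = {}"
proof (rule equals0I)
  fix p assume "p \<in> oprimes x"
  then have "p \<ge> 3" "real p \<le> x" using oprimes_ge_3 by (auto simp: oprimes_def)
  then show False using assms by linarith
qed

lemma oprimes_of_nat_Suc:
  "oprimes (real (Suc n)) = (if prime (Suc n) \<and> odd (Suc n) then insert (Suc n) (oprimes (real n)) else oprimes (real n))"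
  by (auto simp: oprimes_def le_Suc_eq simp del: of_nat_Suc)

lemma theta_Suc: "theta (real (Suc n)) = theta (real n) + (if prime (Suc n) \<and> odd (Suc n) then ln (real (Suc n)) else 0)"
proof -
  have "Suc n \<notin> oprimes (real n)" by (simp add: oprimes_def)
  then show ?thesis unfolding theta_def oprimes_of_nat_Suc by (simp del: of_nat_Suc)
qed

lemma prime_recips_Suc: "prime_recips (real (Suc n)) = prime_recips (real n) + (if prime (Suc n) \<and> odd (Suc n) then 1 / real (Suc n) else 0)"
proof -
  have "Suc n \<notin> oprimes (real n)" by (simp add: oprimes_def)
  then show ?thesis unfolding prime_recips_def oprimes_of_nat_Suc by (simp del: of_nat_Suc)
qed

definition inv_n_ln :: "nat \<Rightarrow> real" where "inv_n_ln n = 1 / (real n * ln (real n))"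

text \<open>Abel summation: the weight \<open>inv_n_ln\<close> turns the jump \<open>ln p\<close> of
  \<open>theta\<close> into \<open>1 / p\<close>. The smooth part \<open>n\<close> of
  \<open>theta n\<close> has jumps 1 and yields the first sum. The sums start at 3, the least odd
  prime.\<close>

lemma prime_recips_by_parts:
  fixes N :: nat
  assumes "N \<ge> 2"
  defines "R \<equiv> \<lambda>n::nat. theta (real n) - real n"
  shows "prime_recips (real N) = (\<Sum>n=3..N. inv_n_ln n) + R N * inv_n_ln (Suc N) - R 2 * inv_n_ln 3 + (\<Sum>n=3..N. R n * (inv_n_ln n - inv_n_ln (Suc n)))"
  using assms(1)
proof (induction N rule: dec_induct)
  case base
  have "oprimes 2 = {}" by (rule oprimes_empty) simp
  then show ?case by (simp add: prime_recips_def numeral_eq_Suc)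
next
  case (step N)
  have "ln (real (Suc N)) * inv_n_ln (Suc N) = 1 / real (Suc N)"
    using step.hyps by (simp add: inv_n_ln_def)
  then have 1: "prime_recips (real (Suc N)) = prime_recips (real N) + (theta (real (Suc N)) - theta (real N)) * inv_n_ln (Suc N)"
    unfolding prime_recips_Suc theta_Suc by (simp del: of_nat_Suc)
  have 2: "(\<Sum>n=3..Suc N. inv_n_ln n) = (\<Sum>n=3..N. inv_n_ln n) + inv_n_ln (Suc N)"
    "(\<Sum>n=3..Suc N. R n * (inv_n_ln n - inv_n_ln (Suc n))) = (\<Sum>n=3..N. R n * (inv_n_ln n - inv_n_ln (Suc n))) + R (Suc N) * (inv_n_ln (Suc N) - inv_n_ln (Suc (Suc N)))"
    using step.hyps by simp_all
  show ?case unfolding 1 2 step.IH unfolding R_def by (simp add: algebra_simps)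
qed

lemma ln_nat_ge_1: "n \<ge> 3 \<Longrightarrow> ln (real n) \<ge> 1"
proof -
  assume "n \<ge> 3"
  then have "exp 1 \<le> real n" using exp_le by linarith
  then show ?thesis using \<open>n \<ge> 3\<close> by (subst ln_ge_iff) auto
qed

lemma ln_Suc_diff: "n > 0 \<Longrightarrow> ln (real (Suc n)) - ln (real n) \<le> 1 / real n"
proof -
  assume n: "n > 0"
  have "ln (real (Suc n)) - ln (real n) = ln (1 + 1 / real n)"
  proof -
    have "1 + 1 / real n = real (Suc n) / real n" using n by (simp add: field_simps)
    then have "ln (1 + 1 / real n) = ln (real (Suc n) / real n)" by simp
    then show ?thesis using n by (simp add: ln_div del: of_nat_Suc)
  qed
  then show ?thesis using ln_add_one_self_le_self[of "1 / real n"] by simp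
qed

lemma ln_Suc_diff_ge: "n > 0 \<Longrightarrow> ln (real (Suc n)) - ln (real n) \<ge> 1 / real (Suc n)"
proof -
  assume n: "n > 0"
  have "ln (real n / real (Suc n)) \<le> real n / real (Suc n) - 1"
    using n by (intro ln_le_minus_one) auto
  also have "real n / real (Suc n) - 1 = - (1 / real (Suc n))" by (simp add: field_simps)
  finally show ?thesis using n by (simp add: ln_div)
qed

text \<open>Telescoping of \<open>ln (ln n)\<close>. Both comparisons of its increments with
  \<open>inv_n_ln\<close> come from \<open>ln y \<le> y - 1\<close>, applied to a quotient of
  consecutive logarithms and to its inverse.\<close>

lemma sum_inv_n_ln_bounds:
  assumes "N \<ge> 3"
  shows "ln (ln (real (Suc N))) - ln (ln 3) \<le> (\<Sum>n=3..N. inv_n_ln n)" "(\<Sum>n=3..N. inv_n_ln n) \<le> ln (ln (real N)) - ln (ln 2)"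
proof -
  have lo: "ln (ln (real (Suc n))) - ln (ln (real n)) \<le> inv_n_ln n" if n: "n \<ge> 3" for n
  proof -
    define a b where "a = ln (real n)" and "b = ln (real (Suc n))"
    have a: "a \<ge> 1" "b \<ge> 1" using ln_nat_ge_1[of n] ln_nat_ge_1[of "Suc n"] n by (auto simp: a_def b_def simp del: of_nat_Suc)
    have "ln b - ln a = ln (b / a)" using a by (simp add: ln_div)
    also have "\<dots> \<le> b / a - 1" using a by (intro ln_le_minus_one) auto
    also have "\<dots> = (b - a) / a" using a by (simp add: field_simps)
    also have "\<dots> \<le> (1 / real n) / a"
      using ln_Suc_diff[of n] n a unfolding a_def[symmetric] b_def[symmetric] by (intro divide_right_mono) auto
    finally show ?thesis by (simp add: inv_n_ln_def a_def b_def)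
  qed
  have up: "inv_n_ln (Suc n) \<le> ln (ln (real (Suc n))) - ln (ln (real n))" if n: "n \<ge> 2" for n
  proof -
    define a b where "a = ln (real n)" and "b = ln (real (Suc n))"
    have a: "a > 0" "b > 0" using n by (auto simp: a_def b_def)
    have "ln (a / b) \<le> a / b - 1" using a by (intro ln_le_minus_one) auto
    then have "1 - a / b \<le> ln b - ln a" using a by (simp add: ln_div)
    moreover have "(1 / real (Suc n)) / b \<le> (b - a) / b"
      using ln_Suc_diff_ge[of n] n a unfolding a_def[symmetric] b_def[symmetric] by (intro divide_right_mono) auto
    moreover have "(b - a) / b = 1 - a / b" using a by (simp add: diff_divide_distrib)
    moreover have "inv_n_ln (Suc n) = (1 / real (Suc n)) / b" by (simp add: inv_n_ln_def b_def)
    ultimately show ?thesis unfolding a_def b_def by linarith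
  qed
  show "ln (ln (real (Suc N))) - ln (ln 3) \<le> (\<Sum>n=3..N. inv_n_ln n)"
    using assms
  proof (induction N rule: dec_induct)
    case base
    then show ?case using lo[of 3] by simp
  next
    case (step n)
    have "(\<Sum>n=3..Suc n. inv_n_ln n) = (\<Sum>n=3..n. inv_n_ln n) + inv_n_ln (Suc n)" using step.hyps by simp
    then show ?case using step.IH lo[of "Suc n"] step.hyps by linarith
  qed
  show "(\<Sum>n=3..N. inv_n_ln n) \<le> ln (ln (real N)) - ln (ln 2)"
    using assms
  proof (induction N rule: dec_induct)
    case base
    then show ?case using up[of 2] by (simp add: numeral_eq_Suc)
  next
    case (step n)
    have "(\<Sum>n=3..Suc n. inv_n_ln n) = (\<Sum>n=3..n. inv_n_ln n) + inv_n_ln (Suc n)" using step.hyps by simp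
    then show ?case using step.IH up[of n] step.hyps by linarith
  qed
qed

lemma inv_n_ln_diff_bound:
  assumes n: "n \<ge> 3"
  shows "0 \<le> inv_n_ln n - inv_n_ln (Suc n)" "inv_n_ln n - inv_n_ln (Suc n) \<le> 2 / ((real n)\<^sup>2 * ln (real n))"
proof -
  define a b where "a = ln (real n)" and "b = ln (real (Suc n))"
  have a: "a \<ge> 1" "b \<ge> 1" "a \<le> b" using ln_nat_ge_1[of n] ln_nat_ge_1[of "Suc n"] n by (auto simp: a_def b_def simp del: of_nat_Suc)
  define m where "m = real n"
  have m: "m \<ge> 3" using n by (simp add: m_def)
  have g: "inv_n_ln n = 1 / (m * a)" "inv_n_ln (Suc n) = 1 / ((m + 1) * b)"
    by (simp_all add: inv_n_ln_def m_def a_def b_def add.commute)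
  have "m * a \<le> (m + 1) * b" using m a by (intro mult_mono) auto
  then show "0 \<le> inv_n_ln n - inv_n_ln (Suc n)" unfolding g using m a by (simp add: frac_le)
  have "b - a \<le> 1 / m" using ln_Suc_diff[of n] n by (simp add: a_def b_def m_def)
  then have "m * (b - a) \<le> 1" using m by (simp add: field_simps)
  then have num: "(m + 1) * b - m * a \<le> 2 * b" using a by (simp add: algebra_simps)
  have "inv_n_ln n - inv_n_ln (Suc n) = ((m + 1) * b - m * a) / (m * a * ((m + 1) * b))"
    unfolding g using m a by (subst diff_frac_eq) auto
  also have "\<dots> \<le> 2 * b / (m * a * ((m + 1) * b))"
    using num m a by (intro divide_right_mono) auto
  also have "\<dots> = 2 / (m * a * (m + 1))" using a by simp
  also have "\<dots> \<le> 2 / (m * a * m)" using m a by (intro divide_left_mono mult_left_mono) auto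
  finally show "inv_n_ln n - inv_n_ln (Suc n) \<le> 2 / ((real n)\<^sup>2 * ln (real n))"
    by (simp add: m_def a_def power2_eq_square mult_ac)
qed

text \<open>The summand is at most the decrement of \<open>ln n powr (-c) / c\<close>, so the sum
  telescopes and stays bounded. This is where Mertens' theorem consumes the power of the logarithm
  saved in \<open>PNT_theta\<close>.\<close>

lemma sum_inverse_ln_powr:
  fixes c :: real
  assumes c: "c > 0" and N: "N \<ge> 2"
  shows "(\<Sum>n=3..N. 1 / (real n * ln (real n) powr (1 + c))) \<le> (ln 2 powr (-c) - ln (real N) powr (-c)) / c"
  using N
proof (induction N rule: dec_induct)
  case base
  then show ?case by simp
next
  case (step n)
  define a b where "a = ln (real n)" and "b = ln (real (Suc n))"
  have a: "a > 0" "b > 0" "a \<le> b" using step.hyps by (auto simp: a_def b_def)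
  have "1 + c * (1 - a / b) \<le> 1 + (- c * ln (a / b))"
    using mult_left_mono[OF ln_le_minus_one[of "a / b"], of c] a c by (simp add: algebra_simps)
  also have "\<dots> \<le> exp (- c * ln (a / b))" by (rule exp_ge_add_one_self)
  also have "\<dots> = (a / b) powr (-c)" using a by (simp add: powr_def)
  finally have "b powr (-c) * (1 + c * (1 - a / b)) \<le> b powr (-c) * (a / b) powr (-c)"
    by (intro mult_left_mono) auto
  also have "b powr (-c) * (a / b) powr (-c) = a powr (-c)"
    using a by (simp add: powr_divide)
  finally have 1: "b powr (-c) * (1 - a / b) \<le> (a powr (-c) - b powr (-c)) / c"
    using c by (simp add: field_simps)
  have "1 / real (Suc n) \<le> b - a"
    using ln_Suc_diff_ge[of n] step.hyps by (simp add: a_def b_def)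
  then have "(1 / real (Suc n)) / b \<le> (b - a) / b" using a by (intro divide_right_mono) auto
  also have "(b - a) / b = 1 - a / b" using a by (simp add: diff_divide_distrib)
  finally have "b powr (-c) * ((1 / real (Suc n)) / b) \<le> b powr (-c) * (1 - a / b)"
    by (intro mult_left_mono) auto
  moreover have "b powr (-c) * ((1 / real (Suc n)) / b) = 1 / (real (Suc n) * b powr (1 + c))"
    using a by (simp add: powr_add powr_minus divide_inverse mult_ac)
  ultimately have 2: "1 / (real (Suc n) * b powr (1 + c)) \<le> (a powr (-c) - b powr (-c)) / c"
    using 1 by linarith
  have "(\<Sum>n=3..Suc n. 1 / (real n * ln (real n) powr (1 + c))) = (\<Sum>n=3..n. 1 / (real n * ln (real n) powr (1 + c))) + 1 / (real (Suc n) * b powr (1 + c))"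
    using step.hyps unfolding b_def by simp
  also have "\<dots> \<le> (ln 2 powr (-c) - a powr (-c)) / c + (a powr (-c) - b powr (-c)) / c"
    using step.IH 2 unfolding a_def by (intro add_mono)
  also have "\<dots> = (ln 2 powr (-c) - b powr (-c)) / c" by (simp add: diff_divide_distrib)
  finally show ?case unfolding b_def .
qed

lemma mertens: "\<exists>C>0. \<forall>x\<ge>1. \<bar>prime_recips x - lnlnp x\<bar> \<le> C"
proof -
  obtain C where C: "C > 0" "\<And>x. x \<ge> 1 \<Longrightarrow> \<bar>theta x - x\<bar> \<le> C * x * lnp x powr (-1/60)"
    using PNT_theta by blast
  define c :: real where "c = 1/60"
  define K where "K = 2 * C * (ln 2 powr (-c) / c)"
  have K0: "K \<ge> 0" using C(1) by (simp add: K_def c_def)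
  define R where "R = (\<lambda>n::nat. theta (real n) - real n)"
  define B where "B = \<bar>ln (ln 2)\<bar> + \<bar>ln (ln 3)\<bar> + C + \<bar>R 2 * inv_n_ln 3\<bar> + K"
  have nat: "\<bar>prime_recips (real N) - ln (ln (real N))\<bar> \<le> B" if N: "N \<ge> 3" for N
  proof -
    have Rb: "\<bar>R n\<bar> \<le> C * real n * ln (real n) powr (-c)" if n: "n \<ge> 3" for n
    proof -
      have "\<bar>R n\<bar> \<le> C * real n * lnp (real n) powr (-c)" using C(2)[of "real n"] n by (simp add: R_def c_def)
      also have "lnp (real n) powr (-c) \<le> ln (real n) powr (-c)"
        using ln_nat_ge_1[OF n] by (intro powr_mono2') (auto simp: c_def lnp_def)
      then have "C * real n * lnp (real n) powr (-c) \<le> C * real n * ln (real n) powr (-c)"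
        using C(1) by (intro mult_left_mono) auto
      finally show ?thesis .
    qed
    have t1: "\<bar>R N * inv_n_ln (Suc N)\<bar> \<le> C"
    proof -
      have "ln (real N) powr (-c) \<le> 1" using ln_nat_ge_1[OF N] powr_mono[of "-c" 0 "ln (real N)"] by (simp add: c_def)
      then have "C * real N * ln (real N) powr (-c) \<le> C * real N * 1" using C(1) by (intro mult_left_mono) auto
      then have r: "\<bar>R N\<bar> \<le> C * real N" using Rb[OF N] by linarith
      have l: "ln (real (Suc N)) \<ge> 1" using ln_nat_ge_1[of "Suc N"] N by simp
      have "inv_n_ln (Suc N) \<le> 1 / (real N * 1)"
        unfolding inv_n_ln_def using l N by (intro frac_le mult_mono; simp)
      moreover have "0 \<le> inv_n_ln (Suc N)"
        unfolding inv_n_ln_def using l by (intro divide_nonneg_nonneg mult_nonneg_nonneg) linarith+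
      ultimately have "\<bar>R N * inv_n_ln (Suc N)\<bar> \<le> C * real N * (1 / real N)"
        unfolding abs_mult using r C(1) by (intro mult_mono) auto
      then show ?thesis using N by simp
    qed
    have t2: "\<bar>\<Sum>n=3..N. R n * (inv_n_ln n - inv_n_ln (Suc n))\<bar> \<le> K"
    proof -
      have "\<bar>\<Sum>n=3..N. R n * (inv_n_ln n - inv_n_ln (Suc n))\<bar> \<le> (\<Sum>n=3..N. \<bar>R n * (inv_n_ln n - inv_n_ln (Suc n))\<bar>)" by (rule sum_abs)
      also have "\<dots> \<le> (\<Sum>n=3..N. 2 * C * (1 / (real n * ln (real n) powr (1 + c))))"
      proof (rule sum_mono)
        fix n assume "n \<in> {3..N}"
        then have n: "n \<ge> 3" by simp
        have "\<bar>R n * (inv_n_ln n - inv_n_ln (Suc n))\<bar> \<le> (C * real n * ln (real n) powr (-c)) * (2 / ((real n)\<^sup>2 * ln (real n)))"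
          unfolding abs_mult using Rb[OF n] inv_n_ln_diff_bound[OF n] by (intro mult_mono) auto
        also have "\<dots> = 2 * C * (1 / (real n * ln (real n) powr (1 + c)))"
          using ln_nat_ge_1[OF n] n by (simp add: powr_add powr_minus power2_eq_square field_simps)
        finally show "\<bar>R n * (inv_n_ln n - inv_n_ln (Suc n))\<bar> \<le> 2 * C * (1 / (real n * ln (real n) powr (1 + c)))" .
      qed
      also have "\<dots> = 2 * C * (\<Sum>n=3..N. 1 / (real n * ln (real n) powr (1 + c)))" by (rule sum_distrib_left [symmetric])
      also have "\<dots> \<le> 2 * C * ((ln 2 powr (-c) - ln (real N) powr (-c)) / c)"
        using C(1) N by (intro mult_left_mono sum_inverse_ln_powr) (auto simp: c_def)
      also have "\<dots> \<le> K" unfolding K_def using C(1) by (intro mult_left_mono divide_right_mono) (auto simp: c_def)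
      finally show ?thesis .
    qed
    have g1: "ln (ln (real N)) - ln (ln 3) \<le> (\<Sum>n=3..N. inv_n_ln n)"
    proof -
      have "ln (ln (real N)) \<le> ln (ln (real (Suc N)))" using ln_nat_ge_1[OF N] N by simp
      then show ?thesis using sum_inv_n_ln_bounds(1)[OF N] by linarith
    qed
    have "prime_recips (real N) = (\<Sum>n=3..N. inv_n_ln n) + R N * inv_n_ln (Suc N) - R 2 * inv_n_ln 3 + (\<Sum>n=3..N. R n * (inv_n_ln n - inv_n_ln (Suc n)))"
      using prime_recips_by_parts[of N] N unfolding R_def by simp
    then show ?thesis unfolding B_def using t1 t2 g1 sum_inv_n_ln_bounds(2)[OF N] by linarith
  qed
  have B0: "B \<ge> 0" using K0 C(1) by (simp add: B_def)
  have "\<bar>prime_recips x - lnlnp x\<bar> \<le> B + 3" if x: "x \<ge> 1" for x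
  proof (cases "x \<ge> 3")
    case False
    have "oprimes x = {}" using False by (intro oprimes_empty) simp
    then have "prime_recips x = 0" by (simp add: prime_recips_def)
    moreover have "lnlnp x \<le> lnp x" using lnp_ge_1[OF x] ln_le_minus_one[of "lnp x"] by (simp add: lnlnp_def)
    moreover have "lnp x \<le> x" using ln_le_minus_one[of x] x by (simp add: lnp_def)
    ultimately show ?thesis using False lnlnp_ge_1[OF x] B0 by simp
  next
    case True
    define N where "N = nat \<lfloor>x\<rfloor>"
    have N: "N \<ge> 3" "real N \<le> x" "x \<le> real N + 1" using True by (auto simp: N_def le_nat_iff le_floor_iff)
    have "real p \<le> x \<longleftrightarrow> real p \<le> real N" for p :: nat
    proof
      assume "real p \<le> x"
      then have "p \<le> N" unfolding N_def by (rule le_nat_floor)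
      then show "real p \<le> real N" by simp
    qed (use N(2) in linarith)
    then have e: "prime_recips x = prime_recips (real N)" by (simp add: prime_recips_def oprimes_def)
    have l1: "ln (real N) \<ge> 1" by (rule ln_nat_ge_1[OF N(1)])
    have a: "ln (ln (real N)) \<le> lnlnp x"
    proof -
      have "ln (real N) \<le> ln x" using N by simp
      then have "ln (ln (real N)) \<le> ln (1 + ln x)" using l1 by simp
      then show ?thesis by (simp add: lnlnp_def lnp_def)
    qed
    have b: "lnlnp x \<le> ln (ln (real N)) + 3"
    proof -
      have "ln x \<le> ln (real (Suc N))" using N by simp
      also have "\<dots> \<le> ln (real N) + 1 / real N" using ln_Suc_diff[of N] N by simp
      also have "\<dots> \<le> ln (real N) + 1" using N by simp
      finally have "lnp x \<le> 3 * ln (real N)" using l1 by (simp add: lnp_def)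
      then have "ln (lnp x) \<le> ln (3 * ln (real N))" using lnp_ge_1[of x] True by simp
      also have "\<dots> = ln 3 + ln (ln (real N))" using l1 by (simp add: ln_mult)
      also have "ln 3 \<le> (2::real)" using ln_le_minus_one[of 3] by simp
      finally show ?thesis by (simp add: lnlnp_def)
    qed
    show ?thesis using nat[OF N(1)] a b unfolding e by linarith
  qed
  then show ?thesis using B0 by (intro exI[of _ "B + 3"]) auto
qed

section \<open>Ordered factorisations into odd primes\<close>

definition odd_prime_divs :: "nat \<Rightarrow> nat set" where
  "odd_prime_divs n = {p. prime p \<and> odd p \<and> p dvd n}"

text \<open>The number of \<open>k\<close>-tuples of odd primes with product \<open>n\<close>.
  Keeping the order lets the recursion peel off one prime at a time and makes sums over
  \<open>n\<close> into iterated sums over primes; a squarefree odd \<open>n\<close> with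
  \<open>k\<close> prime factors has \<open>fact k\<close> such tuples.\<close>

fun ordered_facs :: "nat \<Rightarrow> nat \<Rightarrow> nat" where
  "ordered_facs 0 n = (if n = 1 then 1 else 0)"
| "ordered_facs (Suc k) n = (\<Sum>p\<in>odd_prime_divs n. ordered_facs k (n div p))"

lemma finite_odd_prime_divs: "n > 0 \<Longrightarrow> finite (odd_prime_divs n)"
  by (rule finite_subset[of _ "{..n}"]) (auto simp: odd_prime_divs_def dest: dvd_imp_le)

lemma odd_prime_divs_subset: "n > 0 \<Longrightarrow> odd_prime_divs n \<subseteq> prime_factors n"
  by (auto simp: odd_prime_divs_def prime_factors_dvd)

lemma odd_prime_divsE:
  assumes "p \<in> odd_prime_divs n" "n > 0"
  obtains m where "n = p * m" "m > 0" "n div p = m" "prime p" "odd p" "p > 0"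
    "prime_factorization n = add_mset p (prime_factorization m)"
proof -
  have p: "prime p" "odd p" "p dvd n" using assms by (auto simp: odd_prime_divs_def)
  then obtain m where m: "n = p * m" by auto
  with assms have "m > 0" "p > 0" by auto
  moreover have "prime_factorization n = add_mset p (prime_factorization m)"
    using p m \<open>m > 0\<close> by (simp add: prime_factorization_mult prime_factorization_prime)
  ultimately show thesis using that m p by simp
qed

lemma ordered_facs_nonzero: "ordered_facs k n \<noteq> 0 \<Longrightarrow> n > 0 \<and> odd n \<and> size (prime_factorization n) = k"
proof (induction k arbitrary: n)
  case 0
  then show ?case by (auto split: if_splits)
next
  case (Suc k)
  then obtain p where p: "p \<in> odd_prime_divs n" "ordered_facs k (n div p) \<noteq> 0"
    by (metis ordered_facs.simps(2) sum.neutral)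
  from Suc.IH[OF p(2)] have h: "n div p > 0" "odd (n div p)" "size (prime_factorization (n div p)) = k" by auto
  then have "n > 0" by (cases "n = 0") auto
  from odd_prime_divsE[OF p(1) this] show ?case using h \<open>n > 0\<close> by (metis even_mult_iff size_add_mset)
qed

lemma card_set_mset_le: "card (set_mset A) \<le> size A"
proof (induction A)
  case (add x A)
  have "card (insert x (set_mset A)) \<le> Suc (card (set_mset A))" by (rule card_insert_le_m1) auto
  then show ?case using add by simp
qed simp

lemma ordered_facs_le_fact: "ordered_facs k n \<le> fact k"
proof (induction k arbitrary: n)
  case (Suc k)
  show ?case
  proof (cases "ordered_facs (Suc k) n = 0")
    case False
    then have n: "n > 0" "size (prime_factorization n) = Suc k" using ordered_facs_nonzero by blast+
    have "card (odd_prime_divs n) \<le> card (prime_factors n)"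
      using odd_prime_divs_subset[OF n(1)] by (intro card_mono) auto
    also have "\<dots> \<le> Suc k" using card_set_mset_le[of "prime_factorization n"] n(2) by simp
    finally have c: "card (odd_prime_divs n) \<le> Suc k" .
    have "ordered_facs (Suc k) n \<le> card (odd_prime_divs n) * fact k"
      unfolding ordered_facs.simps using sum_bounded_above[of "odd_prime_divs n" "\<lambda>p. ordered_facs k (n div p)" "fact k"] Suc.IH by simp
    also have "\<dots> \<le> Suc k * fact k" using c by (rule mult_right_mono) simp
    finally show ?thesis by simp
  qed simp
qed simp

lemma ordered_facs_eq_fact:
  assumes "n > 0" "odd n" "card (prime_factors n) = k" "size (prime_factorization n) = k"
  shows "ordered_facs k n = fact k"
  using assms
proof (induction k arbitrary: n)
  case 0
  then have "prime_factorization n = {#}" by simp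
  then have "n = 1" using 0 by (simp add: prime_factorization_empty_iff)
  then show ?case by simp
next
  case (Suc k)
  have e: "odd_prime_divs n = prime_factors n"
    using Suc.prems by (auto simp: odd_prime_divs_def prime_factors_dvd)
  have "ordered_facs k (n div p) = fact k" if p: "p \<in> odd_prime_divs n" for p
    using p Suc.prems(1)
  proof (rule odd_prime_divsE)
    fix m assume m: "n = p * m" "m > 0" "n div p = m" "prime_factorization n = add_mset p (prime_factorization m)"
    have s: "size (prime_factorization m) = k" using Suc.prems(4) m(4) by simp
    have "Suc k = card (insert p (prime_factors m))" using Suc.prems(3) m(4) by simp
    also have "\<dots> \<le> Suc (card (prime_factors m))" by (simp add: card_insert_if)
    finally have "k \<le> card (prime_factors m)" by simp
    moreover have "card (prime_factors m) \<le> k" using card_set_mset_le[of "prime_factorization m"] s by simp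
    ultimately have "card (prime_factors m) = k" by simp
    moreover have "odd m" using Suc.prems(2) m(1) by simp
    ultimately show "ordered_facs k (n div p) = fact k" using Suc.IH[of m] m s by simp
  qed
  then have "ordered_facs (Suc k) n = card (odd_prime_divs n) * fact k" by simp
  then show ?case using e Suc.prems(3) by simp
qed

lemma odd_prime_divs_swap:
  assumes "n > 0"
  shows "(p \<in> odd_prime_divs n \<and> q \<in> odd_prime_divs (n div p)) \<longleftrightarrow> (prime p \<and> odd p \<and> prime q \<and> odd q \<and> p * q dvd n)"
proof
  assume A: "p \<in> odd_prime_divs n \<and> q \<in> odd_prime_divs (n div p)"
  then have "p * q dvd p * (n div p)" by (intro mult_dvd_mono) (auto simp: odd_prime_divs_def)
  with A show "prime p \<and> odd p \<and> prime q \<and> odd q \<and> p * q dvd n" by (auto simp: odd_prime_divs_def)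
next
  assume A: "prime p \<and> odd p \<and> prime q \<and> odd q \<and> p * q dvd n"
  then obtain r where r: "n = p * q * r" by auto
  have "p > 0" using A prime_gt_0_nat by blast
  then have "n div p = q * r" using r by simp
  then show "p \<in> odd_prime_divs n \<and> q \<in> odd_prime_divs (n div p)" using A r by (auto simp: odd_prime_divs_def)
qed

text \<open>Both sides run over the pairs of odd primes with \<open>p * q\<close> dividing
  \<open>n\<close>, a symmetric condition.\<close>

lemma sum_odd_prime_divs_swap:
  assumes n: "n > 0"
  shows "(\<Sum>p\<in>odd_prime_divs n. \<Sum>q\<in>odd_prime_divs (n div p). f p q (n div p div q))
       = (\<Sum>q\<in>odd_prime_divs n. \<Sum>p\<in>odd_prime_divs (n div q). f p q (n div q div p))"
proof -
  have fin: "\<And>p. p \<in> odd_prime_divs n \<Longrightarrow> finite (odd_prime_divs (n div p))"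
    using odd_prime_divsE[OF _ n] finite_odd_prime_divs by metis
  have "(\<Sum>p\<in>odd_prime_divs n. \<Sum>q\<in>odd_prime_divs (n div p). f p q (n div p div q))
      = (\<Sum>(p,q)\<in>(SIGMA p:odd_prime_divs n. odd_prime_divs (n div p)). f p q (n div p div q))"
    using fin finite_odd_prime_divs[OF n] by (intro sum.Sigma) auto
  also have "\<dots> = (\<Sum>(q,p)\<in>(SIGMA q:odd_prime_divs n. odd_prime_divs (n div q)). f p q (n div q div p))"
  proof -
    have "q \<in> odd_prime_divs n \<and> p \<in> odd_prime_divs (n div q)"
      if "p \<in> odd_prime_divs n" "q \<in> odd_prime_divs (n div p)" for p q
    proof -
      have "prime p \<and> odd p \<and> prime q \<and> odd q \<and> p * q dvd n"
        using odd_prime_divs_swap[OF n, of p q] that by blast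
      then have "prime q \<and> odd q \<and> prime p \<and> odd p \<and> q * p dvd n" unfolding mult.commute[of q p] by blast
      then show ?thesis using odd_prime_divs_swap[OF n, of q p] by blast
    qed
    note sw = this
    have dd: "n div p div q = n div q div p" for p q
      unfolding div_mult2_eq [symmetric] mult.commute[of p q] ..
    show ?thesis
    proof (rule sum.reindex_bij_witness[of _ "\<lambda>(q,p). (p,q)" "\<lambda>(p,q). (q,p)"])
      fix a assume "a \<in> (SIGMA p:odd_prime_divs n. odd_prime_divs (n div p))"
      then obtain p q where a: "a = (p, q)" "p \<in> odd_prime_divs n" "q \<in> odd_prime_divs (n div p)" by blast
      then show "(case a of (p, q) \<Rightarrow> (q, p)) \<in> (SIGMA q:odd_prime_divs n. odd_prime_divs (n div q))"
        "(case case a of (p, q) \<Rightarrow> (q, p) of (q, p) \<Rightarrow> (p, q)) = a"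
        "(case case a of (p, q) \<Rightarrow> (q, p) of (q, p) \<Rightarrow> f p q (n div q div p)) = (case a of (p, q) \<Rightarrow> f p q (n div p div q))"
        using sw[OF a(2,3)] dd[of p q] by simp_all
    next
      fix b assume "b \<in> (SIGMA q:odd_prime_divs n. odd_prime_divs (n div q))"
      then obtain p q where b: "b = (q, p)" "q \<in> odd_prime_divs n" "p \<in> odd_prime_divs (n div q)" by blast
      then show "(case b of (q, p) \<Rightarrow> (p, q)) \<in> (SIGMA p:odd_prime_divs n. odd_prime_divs (n div p))"
        "(case case b of (q, p) \<Rightarrow> (p, q) of (p, q) \<Rightarrow> (q, p)) = b"
        using sw[OF b(2,3)] by simp_all
    qed
  qed
  also have "\<dots> = (\<Sum>q\<in>odd_prime_divs n. \<Sum>p\<in>odd_prime_divs (n div q). f p q (n div q div p))"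
    using fin finite_odd_prime_divs[OF n] by (intro sum.Sigma [symmetric]) auto
  finally show ?thesis .
qed

text \<open>By symmetry, each of the \<open>k + 1\<close> prime factors of an ordered factorisation contributes equally
  to \<open>ln n\<close>.\<close>

lemma ordered_facs_ln:
  assumes "n > 0"
  shows "real (ordered_facs (Suc k) n) * ln (real n) = real (Suc k) * (\<Sum>p\<in>odd_prime_divs n. ln (real p) * real (ordered_facs k (n div p)))"
  using assms
proof (induction k arbitrary: n)
  case 0
  have "real (ordered_facs 0 (n div p)) * ln (real n) = ln (real p) * real (ordered_facs 0 (n div p))" if "p \<in> odd_prime_divs n" for p
    by (rule odd_prime_divsE[OF that 0]) auto
  then have "(\<Sum>p\<in>odd_prime_divs n. real (ordered_facs 0 (n div p)) * ln (real n)) = (\<Sum>p\<in>odd_prime_divs n. ln (real p) * real (ordered_facs 0 (n div p)))"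
    by (rule sum.cong[OF refl])
  then show ?case unfolding ordered_facs.simps(2) of_nat_sum sum_distrib_right by simp
next
  case (Suc k)
  define D where "D = (\<Sum>p\<in>odd_prime_divs n. ln (real p) * real (ordered_facs (Suc k) (n div p)))"
  have "real (ordered_facs (Suc (Suc k)) n) * ln (real n) = (\<Sum>p\<in>odd_prime_divs n. real (ordered_facs (Suc k) (n div p)) * ln (real n))"
    unfolding ordered_facs.simps(2)[of "Suc k" n] of_nat_sum sum_distrib_right ..
  also have "\<dots> = (\<Sum>p\<in>odd_prime_divs n. ln (real p) * real (ordered_facs (Suc k) (n div p))
      + real (Suc k) * (\<Sum>q\<in>odd_prime_divs (n div p). ln (real q) * real (ordered_facs k (n div p div q))))"
  proof (rule sum.cong)
    fix p assume "p \<in> odd_prime_divs n"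
    then show "real (ordered_facs (Suc k) (n div p)) * ln (real n) = ln (real p) * real (ordered_facs (Suc k) (n div p))
      + real (Suc k) * (\<Sum>q\<in>odd_prime_divs (n div p). ln (real q) * real (ordered_facs k (n div p div q)))"
      using Suc.prems
    proof (rule odd_prime_divsE)
      fix m assume m: "n = p * m" "m > 0" "n div p = m" "p > 0"
      have "ln (real n) = ln (real p) + ln (real m)" using m by (simp add: ln_mult)
      then have "real (ordered_facs (Suc k) m) * ln (real n) = ln (real p) * real (ordered_facs (Suc k) m) + real (ordered_facs (Suc k) m) * ln (real m)"
        by (simp add: algebra_simps del: ordered_facs.simps)
      then show ?thesis unfolding m(3) Suc.IH[OF m(2)] .
    qed
  qed simp
  also have "\<dots> = D + real (Suc k) * (\<Sum>p\<in>odd_prime_divs n. \<Sum>q\<in>odd_prime_divs (n div p). ln (real q) * real (ordered_facs k (n div p div q)))"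
    unfolding D_def sum.distrib sum_distrib_left ..
  also have "(\<Sum>p\<in>odd_prime_divs n. \<Sum>q\<in>odd_prime_divs (n div p). ln (real q) * real (ordered_facs k (n div p div q)))
     = (\<Sum>q\<in>odd_prime_divs n. \<Sum>p\<in>odd_prime_divs (n div q). ln (real q) * real (ordered_facs k (n div q div p)))"
    by (rule sum_odd_prime_divs_swap[OF Suc.prems, of "\<lambda>p q r. ln (real q) * real (ordered_facs k r)"])
  also have "\<dots> = D"
    unfolding D_def ordered_facs.simps(2)[of k] of_nat_sum sum_distrib_left ..
  finally show ?case unfolding D_def [symmetric] by (simp add: algebra_simps)
qed

section \<open>Summatory functions of ordered factorisations\<close>

definition nats_upto :: "real \<Rightarrow> nat set" where "nats_upto x = {n. 0 < n \<and> real n \<le> x}"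

lemma finite_nats_upto [simp]: "finite (nats_upto x)"
  by (rule finite_subset[OF _ finite_nat_le_real[of x]]) (auto simp: nats_upto_def)

lemma nats_upto_mono: "x \<le> y \<Longrightarrow> nats_upto x \<subseteq> nats_upto y" by (auto simp: nats_upto_def)

lemma nats_upto_pos: "n \<in> nats_upto x \<Longrightarrow> n > 0" by (simp add: nats_upto_def)
lemma nats_upto_le: "n \<in> nats_upto x \<Longrightarrow> real n \<le> x" by (simp add: nats_upto_def)
lemma nats_upto_quot: "n \<in> nats_upto x \<Longrightarrow> 1 \<le> x / real n" by (simp add: nats_upto_def)

lemma nats_upto_conv_atLeastAtMost: "x \<ge> 0 \<Longrightarrow> nats_upto x = {1..nat \<lfloor>x\<rfloor>}"
  by (auto simp: nats_upto_def le_nat_floor) (meson of_nat_floor of_nat_le_iff order_trans)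

lemma card_nats_upto: "x \<ge> 0 \<Longrightarrow> real (card (nats_upto x)) \<le> x"
  by (simp add: nats_upto_conv_atLeastAtMost)

lemma oprimes_pos: "p \<in> oprimes x \<Longrightarrow> p > 0"
  using oprimes_ge_3[of p x] by simp

lemma oprimes_quot: "p \<in> oprimes x \<Longrightarrow> 1 \<le> x / real p"
  using oprimes_pos[of p x] by (simp add: oprimes_def)

lemma oprimes_mono: "x \<le> y \<Longrightarrow> oprimes x \<subseteq> oprimes y" by (auto simp: oprimes_def)

lemma sum_divs_primes_first:
  fixes F :: "nat \<Rightarrow> nat \<Rightarrow> real"
  shows "(\<Sum>n\<in>nats_upto x. \<Sum>p\<in>odd_prime_divs n. F p (n div p)) = (\<Sum>p\<in>oprimes x. \<Sum>m\<in>nats_upto (x / real p). F p m)"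
proof -
  have "(\<Sum>n\<in>nats_upto x. \<Sum>p\<in>odd_prime_divs n. F p (n div p)) = (\<Sum>(n,p)\<in>(SIGMA n:nats_upto x. odd_prime_divs n). F p (n div p))"
    using finite_odd_prime_divs nats_upto_pos by (intro sum.Sigma) auto
  also have "\<dots> = (\<Sum>(p,m)\<in>(SIGMA p:oprimes x. nats_upto (x / real p)). F p m)"
  proof (rule sum.reindex_bij_witness[of _ "\<lambda>(p,m). (p * m, p)" "\<lambda>(n,p). (p, n div p)"])
    fix a assume "a \<in> (SIGMA n:nats_upto x. odd_prime_divs n)"
    then obtain n p where a: "a = (n, p)" "n \<in> nats_upto x" "p \<in> odd_prime_divs n" by auto
    from odd_prime_divsE[OF a(3) nats_upto_pos[OF a(2)]] obtain m where
      m: "n = p * m" "m > 0" "n div p = m" "prime p" "odd p" "p > 0" by metis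
    have "real p * real m \<le> x" using nats_upto_le[OF a(2)] m by simp
    moreover have "real p * 1 \<le> real p * real m" using m by (intro mult_left_mono) auto
    ultimately have "real p \<le> x" by linarith
    then have "p \<in> oprimes x" "m \<in> nats_upto (x / real p)"
      using m \<open>real p * real m \<le> x\<close> by (auto simp: oprimes_def nats_upto_def field_simps)
    then show "(case a of (n, p) \<Rightarrow> (p, n div p)) \<in> (SIGMA p:oprimes x. nats_upto (x / real p))"
      "(case case a of (n, p) \<Rightarrow> (p, n div p) of (p, m) \<Rightarrow> (p * m, p)) = a"
      "(case case a of (n, p) \<Rightarrow> (p, n div p) of (p, m) \<Rightarrow> F p m) = (case a of (n, p) \<Rightarrow> F p (n div p))"
      using m a by auto
  next
    fix b assume "b \<in> (SIGMA p:oprimes x. nats_upto (x / real p))"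
    then obtain p m where b: "b = (p, m)" "p \<in> oprimes x" "m \<in> nats_upto (x / real p)" by auto
    have "p > 0" by (rule oprimes_pos[OF b(2)])
    then have "real p * real m \<le> x" using nats_upto_le[OF b(3)] by (simp add: field_simps)
    then show "(case b of (p, m) \<Rightarrow> (p * m, p)) \<in> (SIGMA n:nats_upto x. odd_prime_divs n)"
      "(case case b of (p, m) \<Rightarrow> (p * m, p) of (n, p) \<Rightarrow> (p, n div p)) = b"
      using b \<open>p > 0\<close> by (auto simp: nats_upto_def oprimes_def odd_prime_divs_def)
  qed
  also have "\<dots> = (\<Sum>p\<in>oprimes x. \<Sum>m\<in>nats_upto (x / real p). F p m)"
    by (rule sum.Sigma [symmetric]) auto
  finally show ?thesis .
qed

lemma sum_divs_primes_last:
  fixes F :: "nat \<Rightarrow> nat \<Rightarrow> real"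
  shows "(\<Sum>n\<in>nats_upto x. \<Sum>p\<in>odd_prime_divs n. F p (n div p)) = (\<Sum>m\<in>nats_upto x. \<Sum>p\<in>oprimes (x / real m). F p m)"
proof -
  have "(\<Sum>p\<in>oprimes x. \<Sum>m\<in>nats_upto (x / real p). F p m) = (\<Sum>(p,m)\<in>(SIGMA p:oprimes x. nats_upto (x / real p)). F p m)"
    by (rule sum.Sigma) auto
  also have "\<dots> = (\<Sum>(m,p)\<in>(SIGMA m:nats_upto x. oprimes (x / real m)). F p m)"
  proof -
    have "p \<in> oprimes x \<and> m \<in> nats_upto (x / real p) \<longleftrightarrow> m \<in> nats_upto x \<and> p \<in> oprimes (x / real m)" for p m
    proof
      assume A: "p \<in> oprimes x \<and> m \<in> nats_upto (x / real p)"
      then have "p > 0" "m > 0" using oprimes_pos nats_upto_pos by blast+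
      then have pm: "real p * real m \<le> x" using A nats_upto_le[of m "x / real p"] by (simp add: field_simps)
      moreover have "1 * real m \<le> real p * real m" using \<open>p > 0\<close> by (intro mult_right_mono) auto
      ultimately have "real m \<le> x" by linarith
      then show "m \<in> nats_upto x \<and> p \<in> oprimes (x / real m)"
        using pm A \<open>m > 0\<close> by (auto simp: nats_upto_def oprimes_def field_simps)
    next
      assume A: "m \<in> nats_upto x \<and> p \<in> oprimes (x / real m)"
      then have "p > 0" "m > 0" using oprimes_pos nats_upto_pos by blast+
      then have pm: "real p * real m \<le> x" using A by (auto simp: oprimes_def field_simps)
      moreover have "real p * 1 \<le> real p * real m" using \<open>m > 0\<close> by (intro mult_left_mono) auto
      ultimately have "real p \<le> x" by linarith
      then show "p \<in> oprimes x \<and> m \<in> nats_upto (x / real p)"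
        using pm A \<open>m > 0\<close> \<open>p > 0\<close> by (auto simp: nats_upto_def oprimes_def field_simps)
    qed
    then show ?thesis
      by (intro sum.reindex_bij_witness[of _ "\<lambda>(m,p). (p,m)" "\<lambda>(p,m). (m,p)"]) auto
  qed
  also have "\<dots> = (\<Sum>m\<in>nats_upto x. \<Sum>p\<in>oprimes (x / real m). F p m)"
    by (rule sum.Sigma [symmetric]) auto
  finally show ?thesis unfolding sum_divs_primes_first .
qed

section \<open>Reciprocal sums over ordered factorisations\<close>

definition recip_sum :: "nat \<Rightarrow> real \<Rightarrow> real" where "recip_sum k x = (\<Sum>n\<in>nats_upto x. real (ordered_facs k n) / real n)"

lemma recip_sum_0: "x \<ge> 1 \<Longrightarrow> recip_sum 0 x = 1"
proof -
  assume "x \<ge> 1"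
  then have "recip_sum 0 x = (\<Sum>n\<in>{1}. real (ordered_facs 0 n) / real n)"
    unfolding recip_sum_def by (intro sum.mono_neutral_right) (auto simp: nats_upto_def)
  then show ?thesis by simp
qed

lemma recip_sum_nonneg: "0 \<le> recip_sum k x" unfolding recip_sum_def by (intro sum_nonneg) auto

lemma recip_sum_mono: "x \<le> y \<Longrightarrow> recip_sum k x \<le> recip_sum k y"
  unfolding recip_sum_def using nats_upto_mono by (intro sum_mono2) auto

lemma recip_sum_Suc: "recip_sum (Suc k) x = (\<Sum>p\<in>oprimes x. 1 / real p * recip_sum k (x / real p))"
proof -
  have "recip_sum (Suc k) x = (\<Sum>n\<in>nats_upto x. \<Sum>p\<in>odd_prime_divs n. real (ordered_facs k (n div p)) / (real p * real (n div p)))"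
    unfolding recip_sum_def
  proof (rule sum.cong)
    fix n assume n: "n \<in> nats_upto x"
    have "real (ordered_facs k (n div p)) / real n = real (ordered_facs k (n div p)) / (real p * real (n div p))" if "p \<in> odd_prime_divs n" for p
      by (rule odd_prime_divsE[OF that nats_upto_pos[OF n]]) simp
    then show "real (ordered_facs (Suc k) n) / real n = (\<Sum>p\<in>odd_prime_divs n. real (ordered_facs k (n div p)) / (real p * real (n div p)))"
      unfolding ordered_facs.simps(2) of_nat_sum sum_divide_distrib by (intro sum.cong) auto
  qed simp
  also have "\<dots> = (\<Sum>p\<in>oprimes x. \<Sum>m\<in>nats_upto (x / real p). real (ordered_facs k m) / (real p * real m))"
    by (rule sum_divs_primes_first)
  also have "\<dots> = (\<Sum>p\<in>oprimes x. 1 / real p * recip_sum k (x / real p))"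
    by (simp add: recip_sum_def sum_distrib_left)
  finally show ?thesis .
qed

lemma prime_recips_nonneg: "0 \<le> prime_recips x" unfolding prime_recips_def by (intro sum_nonneg) auto

lemma prime_recips_mono: "x \<le> y \<Longrightarrow> prime_recips x \<le> prime_recips y"
  unfolding prime_recips_def using oprimes_mono by (intro sum_mono2) auto

text \<open>Every prime in a factorisation of some \<open>n \<le> x\<close> is itself at most
  \<open>x\<close>.\<close>

lemma recip_sum_upper: "x \<ge> 1 \<Longrightarrow> recip_sum k x \<le> prime_recips x ^ k"
proof (induction k)
  case 0
  then show ?case by (simp add: recip_sum_0)
next
  case (Suc k)
  have "recip_sum (Suc k) x \<le> (\<Sum>p\<in>oprimes x. 1 / real p * recip_sum k x)"
    unfolding recip_sum_Suc
  proof (intro sum_mono mult_left_mono recip_sum_mono)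
    fix p assume "p \<in> oprimes x"
    then have "p > 0" by (rule oprimes_pos)
    then show "x / real p \<le> x" using Suc.prems by (simp add: field_simps)
  qed simp
  also have "\<dots> = prime_recips x * recip_sum k x" by (simp add: prime_recips_def sum_distrib_right)
  also have "\<dots> \<le> prime_recips x * prime_recips x ^ k"
    using Suc by (intro mult_left_mono prime_recips_nonneg) auto
  finally show ?case by simp
qed

text \<open>Conversely, \<open>k\<close> primes up to \<open>y\<close> have a product of at most
  \<open>y ^ k\<close>.\<close>

lemma recip_sum_lower: "y \<ge> 1 \<Longrightarrow> prime_recips y ^ k \<le> recip_sum k (y ^ k)"
proof (induction k)
  case 0
  then show ?case by (simp add: recip_sum_0)
next
  case (Suc k)
  have "prime_recips y ^ Suc k \<le> prime_recips y * recip_sum k (y ^ k)"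
    using Suc by (simp add: mult_left_mono prime_recips_nonneg)
  also have "\<dots> = (\<Sum>p\<in>oprimes y. 1 / real p * recip_sum k (y ^ k))" by (simp add: prime_recips_def sum_distrib_right)
  also have "\<dots> \<le> (\<Sum>p\<in>oprimes y. 1 / real p * recip_sum k (y ^ Suc k / real p))"
  proof (intro sum_mono mult_left_mono recip_sum_mono)
    fix p assume p: "p \<in> oprimes y"
    have "y ^ k * 1 \<le> y ^ k * (y / real p)"
      using oprimes_quot[OF p] Suc.prems by (intro mult_left_mono) auto
    then show "y ^ k \<le> y ^ Suc k / real p" by (simp add: mult_ac)
  qed simp
  also have "\<dots> \<le> (\<Sum>p\<in>oprimes (y ^ Suc k). 1 / real p * recip_sum k (y ^ Suc k / real p))"
  proof (rule sum_mono2)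
    have "y * 1 \<le> y * y ^ k" using Suc.prems by (intro mult_left_mono) auto
    then show "oprimes y \<subseteq> oprimes (y ^ Suc k)" by (intro oprimes_mono) simp
  qed (auto simp: recip_sum_nonneg)
  finally show ?case unfolding recip_sum_Suc .
qed

lemma power_diff_bound:
  fixes a b C :: real
  assumes "a \<ge> 1" "\<bar>b - a\<bar> \<le> C"
  shows "\<bar>b ^ k - a ^ k\<bar> \<le> real k * C * (1 + C) ^ k * a ^ (k - 1)"
proof (induction k)
  case (Suc k)
  have C: "C \<ge> 0" using assms by linarith
  have b: "\<bar>b\<bar> \<le> (1 + C) * a"
  proof -
    have "C * 1 \<le> C * a" using assms C by (intro mult_left_mono) auto
    then show ?thesis using assms by (simp add: algebra_simps)
  qed
  have pw: "1 \<le> (1 + C) ^ Suc k" using C by (intro one_le_power) simp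
  have "b ^ Suc k - a ^ Suc k = b * (b ^ k - a ^ k) + (b - a) * a ^ k" by (simp add: algebra_simps)
  then have "\<bar>b ^ Suc k - a ^ Suc k\<bar> \<le> \<bar>b\<bar> * \<bar>b ^ k - a ^ k\<bar> + \<bar>b - a\<bar> * a ^ k"
    using assms(1) abs_triangle_ineq[of "b * (b ^ k - a ^ k)" "(b - a) * a ^ k"] by (simp add: abs_mult)
  also have "\<dots> \<le> (1 + C) * a * (real k * C * (1 + C) ^ k * a ^ (k - 1)) + C * a ^ k"
    using b Suc.IH assms C by (intro add_mono mult_mono) auto
  also have "(1 + C) * a * (real k * C * (1 + C) ^ k * a ^ (k - 1)) = real k * C * (1 + C) ^ Suc k * a ^ k"
    by (cases k) (auto simp: mult_ac)
  also have "C * a ^ k \<le> C * (1 + C) ^ Suc k * a ^ k"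
    using C pw assms mult_left_mono[OF pw, of C] by (intro mult_right_mono) auto
  finally have "\<bar>b ^ Suc k - a ^ Suc k\<bar> \<le> real k * C * (1 + C) ^ Suc k * a ^ k + C * (1 + C) ^ Suc k * a ^ k" by simp
  also have "\<dots> = real (Suc k) * C * (1 + C) ^ Suc k * a ^ (Suc k - 1)" by (simp add: algebra_simps)
  finally show ?case .
qed simp

lemma lnlnp_root:
  assumes x: "x \<ge> 1" and y: "y \<ge> 1" and k: "k \<ge> 1" and yk: "y ^ k = x"
  shows "lnlnp x - ln (real k) \<le> lnlnp y" "y \<le> x" "lnp x \<le> real k * lnp y"
proof -
  have "ln x = real k * ln y" using yk y by (simp add: ln_realpow flip: yk)
  then have "lnp x \<le> real k * lnp y" using k by (simp add: lnp_def algebra_simps)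
  then show "lnp x \<le> real k * lnp y" .
  then have "ln (lnp x) \<le> ln (real k * lnp y)" using lnp_ge_1[OF x] by simp
  also have "\<dots> = ln (real k) + ln (lnp y)" using lnp_ge_1[OF y] k by (simp add: ln_mult)
  finally show "lnlnp x - ln (real k) \<le> lnlnp y" by (simp add: lnlnp_def)
  have "y ^ 1 \<le> y ^ k" using y k by (intro power_increasing) auto
  then show "y \<le> x" using yk by simp
qed

text \<open>Sandwiched between \<open>k\<close>-th powers of \<open>prime_recips\<close> at
  \<open>x\<close> and at the \<open>k\<close>-th root of \<open>x\<close>. Taking the root shifts
  the iterated logarithm by at most \<open>ln k\<close>, which affects its \<open>k\<close>-th power
  only one order below.\<close>

lemma recip_sum_asymp: "\<exists>C>0. \<forall>x\<ge>1. \<bar>recip_sum k x - lnlnp x ^ k\<bar> \<le> C * lnlnp x ^ (k - 1)"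
proof (cases "k = 0")
  case True
  then show ?thesis by (intro exI[of _ 1]) (simp add: recip_sum_0)
next
  case False
  then have k: "k \<ge> 1" by simp
  obtain M where M: "M > 0" "\<And>x. x \<ge> 1 \<Longrightarrow> \<bar>prime_recips x - lnlnp x\<bar> \<le> M" using mertens by blast
  define C where "C = M + ln (real k)"
  have C: "C > 0" "M \<le> C" using M k by (auto simp: C_def add_pos_nonneg)
  have "\<bar>recip_sum k x - lnlnp x ^ k\<bar> \<le> (real k * C * (1 + C) ^ k) * lnlnp x ^ (k - 1)" if x: "x \<ge> 1" for x
  proof -
    define y where "y = x powr (1 / real k)"
    have y1: "y \<ge> 1" unfolding y_def using x by (intro ge_one_powr_ge_zero) auto
    have yk: "y ^ k = x" using x k by (simp add: y_def powr_powr flip: powr_realpow)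
    note r = lnlnp_root[OF x y1 k yk]
    have "\<bar>prime_recips x - lnlnp x\<bar> \<le> C" using M(2)[OF x] C(2) by linarith
    from power_diff_bound[OF lnlnp_ge_1[OF x] this, of k]
    have 1: "\<bar>prime_recips x ^ k - lnlnp x ^ k\<bar> \<le> real k * C * (1 + C) ^ k * lnlnp x ^ (k - 1)" .
    have "prime_recips y \<le> prime_recips x" by (rule prime_recips_mono[OF r(2)])
    then have "\<bar>prime_recips y - lnlnp x\<bar> \<le> C"
      using M(2)[OF x] M(2)[OF y1] r(1) C unfolding C_def by linarith
    from power_diff_bound[OF lnlnp_ge_1[OF x] this, of k]
    have 2: "\<bar>prime_recips y ^ k - lnlnp x ^ k\<bar> \<le> real k * C * (1 + C) ^ k * lnlnp x ^ (k - 1)" .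
    have "prime_recips y ^ k \<le> recip_sum k x" using recip_sum_lower[OF y1, of k] yk by simp
    then show ?thesis using 1 2 recip_sum_upper[OF x, of k] by linarith
  qed
  moreover have "real k * C * (1 + C) ^ k > 0" using C k by simp
  ultimately show ?thesis by blast
qed

lemma lnlnp_le_powr:
  assumes c: "c > 0" and x: "x \<ge> 1"
  shows "lnlnp x \<le> (1 + 1 / c) * lnp x powr c"
proof -
  have L: "lnp x \<ge> 1" by (rule lnp_ge_1[OF x])
  have p: "lnp x powr c \<ge> 1" using L c by (intro ge_one_powr_ge_zero) auto
  have "c * ln (lnp x) = ln (lnp x powr c)" using L by (simp add: ln_powr)
  also have "\<dots> \<le> lnp x powr c - 1" using p by (intro ln_le_minus_one) auto
  finally have "ln (lnp x) \<le> lnp x powr c / c" using c by (simp add: field_simps)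
  then show ?thesis using p by (simp add: lnlnp_def distrib_right)
qed

lemma lnlnp_power_le_lnp: "\<exists>K>0. \<forall>x\<ge>1. lnlnp x ^ k \<le> K * lnp x"
proof -
  define c where "c = 1 / real (Suc k)"
  have c: "c > 0" by (simp add: c_def)
  have "lnlnp x ^ k \<le> (1 + 1 / c) ^ Suc k * lnp x" if x: "x \<ge> 1" for x
  proof -
    have L: "lnp x \<ge> 1" by (rule lnp_ge_1[OF x])
    have "lnlnp x ^ k \<le> lnlnp x ^ Suc k" using lnlnp_ge_1[OF x] by (intro power_increasing) auto
    also have "\<dots> \<le> ((1 + 1 / c) * lnp x powr c) ^ Suc k"
      using lnlnp_le_powr[OF c x] lnlnp_ge_1[OF x] by (intro power_mono) auto
    also have "\<dots> = (1 + 1 / c) ^ Suc k * (lnp x powr c) ^ Suc k" by (rule power_mult_distrib)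
    also have "(lnp x powr c) ^ Suc k = lnp x powr (c * real (Suc k))"
      using L by (simp add: powr_powr del: power_Suc of_nat_Suc flip: powr_realpow)
    also have "c * real (Suc k) = 1" by (simp add: c_def)
    finally show ?thesis using L by simp
  qed
  moreover have "(1 + 1 / c) ^ Suc k > 0" using c by (intro zero_less_power) (simp add: add_pos_pos)
  ultimately show ?thesis by blast
qed

text \<open>The sum is split at \<open>sqrt x\<close>. Up to there, \<open>lnp (x / m)\<close> is at
  least half of \<open>lnp x\<close>, and the factor \<open>lnp x powr (-c)\<close> swallows the
  surplus \<open>lnlnp x\<close>. Beyond, the weight is at most 1, and the reciprocal sum between
  \<open>sqrt x\<close> and \<open>x\<close> is one order smaller because \<open>lnlnp\<close> moves
  by at most \<open>ln 2\<close>.\<close>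

lemma weighted_error:
  assumes k: "k \<ge> 1" and c: "c > 0"
  shows "\<exists>K>0. \<forall>x\<ge>1. (\<Sum>m\<in>nats_upto x. real (ordered_facs k m) / real m * lnp (x / real m) powr (-c)) \<le> K * lnlnp x ^ (k - 1)"
proof -
  obtain C where C: "C > 0" "\<And>x. x \<ge> 1 \<Longrightarrow> \<bar>recip_sum k x - lnlnp x ^ k\<bar> \<le> C * lnlnp x ^ (k - 1)"
    using recip_sum_asymp by blast
  define D where "D = real k * ln 2 * (1 + ln 2) ^ k"
  have D0: "D \<ge> 0" by (simp add: D_def)
  define K where "K = 2 powr c * (1 + C) * (1 + 1 / c) + (2 * C + D)"
  have K: "K > 0" using C(1) D0 c by (simp add: K_def add_pos_pos add_pos_nonneg)
  have "(\<Sum>m\<in>nats_upto x. real (ordered_facs k m) / real m * lnp (x / real m) powr (-c)) \<le> K * lnlnp x ^ (k - 1)"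
    if x: "x \<ge> 1" for x
  proof -
    define y where "y = sqrt x"
    have y: "y \<ge> 1" "y \<^sup>2 = x" using x by (auto simp: y_def)
    note r = lnlnp_root[OF x y(1) _ y(2)]
    have yx: "y \<le> x" using r(2) by simp
    have L2x: "lnlnp x \<ge> 1" by (rule lnlnp_ge_1[OF x])
    define P where "P = lnlnp x ^ (k - 1)"
    have P: "P \<ge> 1" "lnlnp x ^ k = P * lnlnp x"
      using L2x k power_Suc2[of "lnlnp x" "k - 1"] unfolding P_def by (auto intro: one_le_power)
    have Lx: "recip_sum k x \<le> P * lnlnp x + C * P" using C(2)[OF x] P(2) unfolding P_def by linarith
    have Ly: "recip_sum k y \<ge> P * lnlnp x - D * P - C * P"
    proof -
      have "\<bar>lnlnp y - lnlnp x\<bar> \<le> ln 2" using r(1) lnlnp_mono[OF y(1) yx] by simp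
      from power_diff_bound[OF L2x this, of k] have "lnlnp y ^ k \<ge> lnlnp x ^ k - D * P"
        unfolding D_def P_def by linarith
      moreover have "C * lnlnp y ^ (k - 1) \<le> C * P"
        unfolding P_def using lnlnp_mono[OF y(1) yx] lnlnp_ge_1[OF y(1)] C(1) by (intro mult_left_mono power_mono) auto
      ultimately show ?thesis using C(2)[OF y(1)] P(2) by linarith
    qed
    have sub: "nats_upto y \<subseteq> nats_upto x" by (rule nats_upto_mono[OF yx])
    define f where "f = (\<lambda>m. real (ordered_facs k m) / real m)"
    have f0: "f m \<ge> 0" for m by (simp add: f_def)
    have "(\<Sum>m\<in>nats_upto x. f m * lnp (x / real m) powr (-c))
       = (\<Sum>m\<in>nats_upto x - nats_upto y. f m * lnp (x / real m) powr (-c)) + (\<Sum>m\<in>nats_upto y. f m * lnp (x / real m) powr (-c))"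
      by (rule sum.subset_diff[OF sub]) simp
    also have "(\<Sum>m\<in>nats_upto x - nats_upto y. f m * lnp (x / real m) powr (-c)) \<le> (\<Sum>m\<in>nats_upto x - nats_upto y. f m * 1)"
    proof (intro sum_mono mult_left_mono f0)
      fix m assume "m \<in> nats_upto x - nats_upto y"
      then have "lnp (x / real m) \<ge> 1" using nats_upto_quot[of m x] lnp_ge_1 by blast
      then show "lnp (x / real m) powr (-c) \<le> 1" using c powr_mono[of "-c" 0 "lnp (x / real m)"] by simp
    qed
    also have "(\<Sum>m\<in>nats_upto x - nats_upto y. f m * 1) = recip_sum k x - recip_sum k y"
      using sub by (simp add: sum_diff recip_sum_def f_def)
    also have "\<dots> \<le> (2 * C + D) * P" using Lx Ly by (simp add: algebra_simps)
    also have "(\<Sum>m\<in>nats_upto y. f m * lnp (x / real m) powr (-c)) \<le> (\<Sum>m\<in>nats_upto y. f m * (2 powr c * lnp x powr (-c)))"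
    proof (intro sum_mono mult_left_mono f0)
      fix m assume m: "m \<in> nats_upto y"
      have "y * real m \<le> y * y" using nats_upto_le[OF m] y by (intro mult_left_mono) auto
      then have "y * real m \<le> x" using y(2) by (simp only: power2_eq_square)
      then have "y \<le> x / real m" using nats_upto_pos[OF m] by (simp add: pos_le_divide_eq)
      then have "lnp y \<le> lnp (x / real m)" using y by (intro lnp_mono)
      then have "lnp x / 2 \<le> lnp (x / real m)" using r(3) by simp
      then have "lnp (x / real m) powr (-c) \<le> (lnp x / 2) powr (-c)"
        using lnp_ge_1[OF x] c by (intro powr_mono2') auto
      also have "\<dots> = 2 powr c * lnp x powr (-c)"
        using lnp_ge_1[OF x] by (simp add: powr_divide powr_minus_divide)
      finally show "lnp (x / real m) powr (-c) \<le> 2 powr c * lnp x powr (-c)" .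
    qed
    also have "\<dots> = recip_sum k y * (2 powr c * lnp x powr (-c))" by (simp add: recip_sum_def f_def sum_distrib_right)
    also have "\<dots> \<le> ((1 + C) * (P * lnlnp x)) * (2 powr c * lnp x powr (-c))"
    proof (rule mult_right_mono)
      have "C * P * 1 \<le> C * P * lnlnp x" using C(1) P L2x by (intro mult_left_mono) auto
      then have "P * lnlnp x + C * P \<le> (1 + C) * (P * lnlnp x)" by (simp add: algebra_simps)
      then show "recip_sum k y \<le> (1 + C) * (P * lnlnp x)" using Lx recip_sum_mono[OF yx, of k] by linarith
    qed simp
    also have "\<dots> \<le> ((1 + C) * (P * ((1 + 1 / c) * lnp x powr c))) * (2 powr c * lnp x powr (-c))"
      using lnlnp_le_powr[OF c x] C(1) P by (intro mult_right_mono mult_left_mono) auto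
    also have "\<dots> = 2 powr c * (1 + C) * (1 + 1 / c) * P * (lnp x powr c * lnp x powr (-c))"
      by (simp add: mult_ac)
    also have "lnp x powr c * lnp x powr (-c) = 1" using lnp_ge_1[OF x] by (simp flip: powr_add)
    finally show ?thesis unfolding K_def P_def[symmetric] f_def by (simp add: algebra_simps)
  qed
  then show ?thesis using K by blast
qed

section \<open>Sums weighted by the logarithm\<close>

definition log_sum :: "nat \<Rightarrow> real \<Rightarrow> real" where "log_sum k x = (\<Sum>n\<in>nats_upto x. real (ordered_facs k n) * ln (real n))"

text \<open>By \<open>ordered_facs_ln\<close> a single prime carries the logarithm. Summing over
  that prime with the cofactor \<open>m\<close> fixed produces \<open>theta (x / m)\<close>.\<close>

lemma log_sum_Suc: "log_sum (Suc k) x = real (Suc k) * (\<Sum>m\<in>nats_upto x. real (ordered_facs k m) * theta (x / real m))"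
proof -
  have "log_sum (Suc k) x = (\<Sum>n\<in>nats_upto x. real (Suc k) * (\<Sum>p\<in>odd_prime_divs n. ln (real p) * real (ordered_facs k (n div p))))"
    unfolding log_sum_def using nats_upto_pos by (intro sum.cong refl ordered_facs_ln) auto
  also have "\<dots> = real (Suc k) * (\<Sum>n\<in>nats_upto x. \<Sum>p\<in>odd_prime_divs n. ln (real p) * real (ordered_facs k (n div p)))"
    by (rule sum_distrib_left [symmetric])
  also have "(\<Sum>n\<in>nats_upto x. \<Sum>p\<in>odd_prime_divs n. ln (real p) * real (ordered_facs k (n div p)))
     = (\<Sum>m\<in>nats_upto x. \<Sum>p\<in>oprimes (x / real m). ln (real p) * real (ordered_facs k m))"
    by (rule sum_divs_primes_last)
  also have "\<dots> = (\<Sum>m\<in>nats_upto x. real (ordered_facs k m) * theta (x / real m))"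
    by (simp add: theta_def sum_distrib_left mult.commute)
  finally show ?thesis .
qed

text \<open>The error has the form \<open>lnlnp x ^ k / lnlnp x\<close> because the truncated
  exponent \<open>k - 1\<close> would lose the saving at \<open>k = 0\<close>. In that case
  \<open>recip_sum\<close> is exactly 1, only \<open>m = 1\<close> occurs, and the saving comes from
  \<open>theta\<close> alone.\<close>

lemma log_sum_asymp: "\<exists>K>0. \<forall>x\<ge>1. \<bar>log_sum (Suc k) x - real (Suc k) * x * lnlnp x ^ k\<bar> \<le> K * x * lnlnp x ^ k / lnlnp x"
proof -
  define c :: real where "c = 1/60"
  have c: "c > 0" by (simp add: c_def)
  have c': "-1/60 = -c" by (simp add: c_def)
  obtain C where C: "C > 0" "\<And>x. x \<ge> 1 \<Longrightarrow> \<bar>theta x - x\<bar> \<le> C * x * lnp x powr (-c)"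
    using PNT_theta unfolding c' by blast
  have W: "\<exists>W>0. \<forall>x\<ge>1. (\<Sum>m\<in>nats_upto x. real (ordered_facs k m) / real m * lnp (x / real m) powr (-c)) \<le> W * (lnlnp x ^ k / lnlnp x)"
  proof (cases "k = 0")
    case True
    have "(\<Sum>m\<in>nats_upto x. real (ordered_facs k m) / real m * lnp (x / real m) powr (-c)) \<le> (1 + 1 / c) * (lnlnp x ^ k / lnlnp x)" if x: "x \<ge> 1" for x
    proof -
      have "(\<Sum>m\<in>nats_upto x. real (ordered_facs k m) / real m * lnp (x / real m) powr (-c)) = (\<Sum>m\<in>{1}. real (ordered_facs k m) / real m * lnp (x / real m) powr (-c))"
        using x True by (intro sum.mono_neutral_right) (auto simp: nats_upto_def)
      also have "\<dots> = lnp x powr (-c)" using True by simp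
      also have "\<dots> = 1 / lnp x powr c" by (rule powr_minus_divide)
      also have "\<dots> \<le> (1 + 1 / c) * (1 / lnlnp x)"
      proof -
        define R where "R = lnp x powr c"
        have R: "R > 0" "lnlnp x > 0" using lnp_ge_1[OF x] lnlnp_ge_1[OF x] by (auto simp: R_def)
        have "lnlnp x / (R * lnlnp x) \<le> ((1 + 1 / c) * R) / (R * lnlnp x)"
          using lnlnp_le_powr[OF c x] R unfolding R_def[symmetric] by (intro divide_right_mono) auto
        then show ?thesis using R unfolding R_def[symmetric] by simp
      qed
      finally show ?thesis using True by simp
    qed
    moreover have "1 + 1 / c > 0" using c by (simp add: add_pos_pos)
    ultimately show ?thesis by blast
  next
    case False
    then obtain W where W: "W > 0" "\<And>x. x \<ge> 1 \<Longrightarrow> (\<Sum>m\<in>nats_upto x. real (ordered_facs k m) / real m * lnp (x / real m) powr (-c)) \<le> W * lnlnp x ^ (k - 1)"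
      using weighted_error[OF _ c, of k] by auto
    have "lnlnp x ^ (k - 1) = lnlnp x ^ k / lnlnp x" if "x \<ge> 1" for x
      using lnlnp_ge_1[OF that] False by (cases k) auto
    then show ?thesis using W by (intro exI[of _ W]) auto
  qed
  then obtain W where W: "W > 0" "\<And>x. x \<ge> 1 \<Longrightarrow> (\<Sum>m\<in>nats_upto x. real (ordered_facs k m) / real m * lnp (x / real m) powr (-c)) \<le> W * (lnlnp x ^ k / lnlnp x)"
    by blast
  obtain B where B: "B > 0" "\<And>x. x \<ge> 1 \<Longrightarrow> \<bar>recip_sum k x - lnlnp x ^ k\<bar> \<le> B * (lnlnp x ^ k / lnlnp x)"
  proof (cases "k = 0")
    case True
    have "\<bar>recip_sum k x - lnlnp x ^ k\<bar> \<le> 1 * (lnlnp x ^ k / lnlnp x)" if "x \<ge> 1" for x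
      using lnlnp_ge_1[OF that] that True by (simp add: recip_sum_0)
    then show thesis using that[of 1] by simp
  next
    case False
    obtain B where B: "B > 0" "\<And>x. x \<ge> 1 \<Longrightarrow> \<bar>recip_sum k x - lnlnp x ^ k\<bar> \<le> B * lnlnp x ^ (k - 1)"
      using recip_sum_asymp by blast
    have "lnlnp x ^ (k - 1) = lnlnp x ^ k / lnlnp x" if "x \<ge> 1" for x
      using lnlnp_ge_1[OF that] False by (cases k) auto
    then show thesis using B that[of B] by auto
  qed
  have "\<bar>log_sum (Suc k) x - real (Suc k) * x * lnlnp x ^ k\<bar> \<le> (real (Suc k) * (C * W + B)) * x * lnlnp x ^ k / lnlnp x"
    if x: "x \<ge> 1" for x
  proof -
    define Q where "Q = lnlnp x ^ k / lnlnp x"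
    have e1: "\<bar>(\<Sum>m\<in>nats_upto x. real (ordered_facs k m) * theta (x / real m)) - x * recip_sum k x\<bar> \<le> C * x * (W * Q)"
    proof -
      have "x * recip_sum k x = (\<Sum>m\<in>nats_upto x. real (ordered_facs k m) * (x / real m))" by (simp add: recip_sum_def sum_distrib_left mult_ac)
      then have "\<bar>(\<Sum>m\<in>nats_upto x. real (ordered_facs k m) * theta (x / real m)) - x * recip_sum k x\<bar>
          = \<bar>\<Sum>m\<in>nats_upto x. real (ordered_facs k m) * (theta (x / real m) - x / real m)\<bar>"
        by (simp only: right_diff_distrib sum_subtractf)
      also have "\<dots> \<le> (\<Sum>m\<in>nats_upto x. \<bar>real (ordered_facs k m) * (theta (x / real m) - x / real m)\<bar>)" by (rule sum_abs)
      also have "\<dots> \<le> (\<Sum>m\<in>nats_upto x. C * x * (real (ordered_facs k m) / real m * lnp (x / real m) powr (-c)))"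
      proof (rule sum_mono)
        fix m assume m: "m \<in> nats_upto x"
        have "\<bar>real (ordered_facs k m) * (theta (x / real m) - x / real m)\<bar> = real (ordered_facs k m) * \<bar>theta (x / real m) - x / real m\<bar>"
          by (simp add: abs_mult)
        also have "\<dots> \<le> real (ordered_facs k m) * (C * (x / real m) * lnp (x / real m) powr (-c))"
          using C(2)[OF nats_upto_quot[OF m]] by (intro mult_left_mono) auto
        finally show "\<bar>real (ordered_facs k m) * (theta (x / real m) - x / real m)\<bar> \<le> C * x * (real (ordered_facs k m) / real m * lnp (x / real m) powr (-c))"
          by (simp add: mult_ac)
      qed
      also have "\<dots> = C * x * (\<Sum>m\<in>nats_upto x. real (ordered_facs k m) / real m * lnp (x / real m) powr (-c))"
        by (rule sum_distrib_left [symmetric])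
      also have "\<dots> \<le> C * x * (W * Q)"
        unfolding Q_def using W(2)[OF x] C(1) x by (intro mult_left_mono) auto
      finally show ?thesis .
    qed
    have "x * \<bar>recip_sum k x - lnlnp x ^ k\<bar> \<le> x * (B * Q)"
      unfolding Q_def using B(2)[OF x] x by (intro mult_left_mono) auto
    then have e2: "\<bar>x * recip_sum k x - x * lnlnp x ^ k\<bar> \<le> x * (B * Q)"
      using x by (simp add: abs_mult flip: right_diff_distrib)
    have "\<bar>(\<Sum>m\<in>nats_upto x. real (ordered_facs k m) * theta (x / real m)) - x * lnlnp x ^ k\<bar> \<le> C * x * (W * Q) + x * (B * Q)"
      using e1 e2 by linarith
    then have "real (Suc k) * \<bar>(\<Sum>m\<in>nats_upto x. real (ordered_facs k m) * theta (x / real m)) - x * lnlnp x ^ k\<bar> \<le> real (Suc k) * (C * x * (W * Q) + x * (B * Q))"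
      by (intro mult_left_mono) auto
    moreover have "\<bar>log_sum (Suc k) x - real (Suc k) * x * lnlnp x ^ k\<bar> = real (Suc k) * \<bar>(\<Sum>m\<in>nats_upto x. real (ordered_facs k m) * theta (x / real m)) - x * lnlnp x ^ k\<bar>"
    proof -
      have "log_sum (Suc k) x - real (Suc k) * x * lnlnp x ^ k = real (Suc k) * ((\<Sum>m\<in>nats_upto x. real (ordered_facs k m) * theta (x / real m)) - x * lnlnp x ^ k)"
        unfolding log_sum_Suc by (simp only: right_diff_distrib mult.assoc)
      then show ?thesis by (simp only: abs_mult abs_of_nat)
    qed
    moreover have "real (Suc k) * (C * x * (W * Q) + x * (B * Q)) = (real (Suc k) * (C * W + B)) * x * lnlnp x ^ k / lnlnp x"
      unfolding Q_def by (simp add: algebra_simps add_divide_distrib)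
    ultimately show ?thesis by linarith
  qed
  moreover have "real (Suc k) * (C * W + B) > 0" using C(1) W(1) B(1) by (simp add: add_pos_pos)
  ultimately show ?thesis by blast
qed

declare ordered_facs.simps [simp del]

section \<open>Removal of the logarithmic weight\<close>

definition sum_ordered_facs :: "nat \<Rightarrow> real \<Rightarrow> real" where "sum_ordered_facs k x = (\<Sum>n\<in>nats_upto x. real (ordered_facs k n))"

lemma power_div_fact_le_exp:
  fixes x :: real
  assumes "x \<ge> 0"
  shows "x ^ n / fact n \<le> exp x"
proof -
  have "(\<Sum>i\<in>{n}. x ^ i /\<^sub>R fact i) \<le> (\<Sum>i. x ^ i /\<^sub>R fact i)"
    using assms by (intro sum_le_suminf summable_exp_generic) auto
  then show ?thesis by (simp add: exp_def divide_inverse mult.commute)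
qed

text \<open>With \<open>N\<close> the integer part of \<open>x\<close>, the sum is the logarithm of
  \<open>x ^ N / fact N\<close>, a single term of the series for \<open>exp x\<close>.\<close>

lemma sum_ln_quot:
  assumes x: "x \<ge> 1"
  shows "(\<Sum>n\<in>nats_upto x. ln (x / real n)) \<le> x"
proof -
  define N where "N = nat \<lfloor>x\<rfloor>"
  have e: "nats_upto x = {1..N}" using x by (simp add: nats_upto_conv_atLeastAtMost N_def)
  have "(\<Sum>n\<in>nats_upto x. ln (x / real n)) = ln (\<Prod>n\<in>nats_upto x. x / real n)"
    using x nats_upto_pos by (intro ln_prod [symmetric]) auto
  also have "(\<Prod>n\<in>nats_upto x. x / real n) = x ^ N / fact N"
    unfolding e by (simp add: prod_dividef fact_prod)
  also have "ln (x ^ N / fact N) \<le> ln (exp x)"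
    using x power_div_fact_le_exp[of x N] by (subst ln_le_cancel_iff) auto
  finally show ?thesis by simp
qed

text \<open>The exact splitting \<open>lnp x = ln n + (1 + ln (x / n))\<close> takes the place of
  partial summation.\<close>

lemma sum_ordered_facs_lnp:
  assumes x: "x \<ge> 1"
  shows "sum_ordered_facs k x * lnp x = log_sum k x + (\<Sum>n\<in>nats_upto x. real (ordered_facs k n) * (1 + ln (x / real n)))"
proof -
  have "sum_ordered_facs k x * lnp x = (\<Sum>n\<in>nats_upto x. real (ordered_facs k n) * ln (real n) + real (ordered_facs k n) * (1 + ln (x / real n)))"
    unfolding sum_ordered_facs_def sum_distrib_right
  proof (rule sum.cong)
    fix n assume "n \<in> nats_upto x"
    then have "ln (x / real n) = ln x - ln (real n)" using x nats_upto_pos[of n x] by (simp add: ln_div)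
    then have "lnp x = ln (real n) + (1 + ln (x / real n))" by (simp add: lnp_def)
    then show "real (ordered_facs k n) * lnp x = real (ordered_facs k n) * ln (real n) + real (ordered_facs k n) * (1 + ln (x / real n))"
      by (simp only: distrib_left)
  qed simp
  then show ?thesis by (simp add: log_sum_def sum.distrib)
qed

lemma ordered_facs_le_fact_real: "real (ordered_facs k n) \<le> fact k"
  using ordered_facs_le_fact[of k n] by (metis of_nat_fact of_nat_le_iff)

lemma sum_ordered_facs_lnp_error:
  assumes x: "x \<ge> 1"
  shows "0 \<le> (\<Sum>n\<in>nats_upto x. real (ordered_facs k n) * (1 + ln (x / real n)))"
    "(\<Sum>n\<in>nats_upto x. real (ordered_facs k n) * (1 + ln (x / real n))) \<le> 2 * fact k * x"
proof -
  have l: "0 \<le> 1 + ln (x / real n)" if "n \<in> nats_upto x" for n using nats_upto_quot[OF that] by simp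
  then show "0 \<le> (\<Sum>n\<in>nats_upto x. real (ordered_facs k n) * (1 + ln (x / real n)))" by (intro sum_nonneg) auto
  have "(\<Sum>n\<in>nats_upto x. real (ordered_facs k n) * (1 + ln (x / real n))) \<le> (\<Sum>n\<in>nats_upto x. fact k * (1 + ln (x / real n)))"
    using l by (intro sum_mono mult_right_mono ordered_facs_le_fact_real) auto
  also have "\<dots> = fact k * (real (card (nats_upto x)) + (\<Sum>n\<in>nats_upto x. ln (x / real n)))"
    by (simp add: sum.distrib flip: sum_distrib_left)
  also have "\<dots> \<le> fact k * (x + x)"
    using card_nats_upto[of x] sum_ln_quot[OF x] x by (intro mult_left_mono add_mono) auto
  finally show "(\<Sum>n\<in>nats_upto x. real (ordered_facs k n) * (1 + ln (x / real n))) \<le> 2 * fact k * x" by simp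
qed

text \<open>For almost primes of order one the trivial bound \<open>O(x)\<close> on the partial summation error is too weak;
  numbers above \<open>x / (lnp x)\<^sup>2\<close> carry a logarithm of size \<open>O(lnlnp x)\<close> only.\<close>

lemma sum_ordered_facs_1_error:
  "\<exists>K>0. \<forall>x\<ge>1. (\<Sum>n\<in>nats_upto x. real (ordered_facs 1 n) * (1 + ln (x / real n))) \<le> K * x / lnlnp x"
proof -
  obtain T where T: "T > 0" "\<And>x. x \<ge> 1 \<Longrightarrow> \<bar>log_sum (Suc 0) x - real (Suc 0) * x * lnlnp x ^ 0\<bar> \<le> T * x * lnlnp x ^ 0 / lnlnp x"
    using log_sum_asymp[of 0] by blast
  obtain M where M: "M > 0" "\<And>x. x \<ge> 1 \<Longrightarrow> lnlnp x ^ 2 \<le> M * lnp x" using lnlnp_power_le_lnp[of 2] by blast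
  have "(\<Sum>n\<in>nats_upto x. real (ordered_facs 1 n) * (1 + ln (x / real n))) \<le> (M * (1 + 2 * (T + 3))) * x / lnlnp x" if x: "x \<ge> 1" for x
  proof -
    have L: "lnp x \<ge> 1" "lnlnp x \<ge> 1" using lnp_ge_1[OF x] lnlnp_ge_1[OF x] .
    \<comment> \<open>First a Chebyshev-type bound O(x / lnp x) for the count, with the crude error
      O(x). It is then fed into the range above \<open>y\<close>.\<close>
    have "T * x / lnlnp x \<le> T * x / 1" using T x L by (intro divide_left_mono) auto
    then have "log_sum 1 x \<le> (T + 1) * x" using T(2)[OF x] by (simp add: algebra_simps)
    then have "sum_ordered_facs 1 x * lnp x \<le> (T + 3) * x"
      using sum_ordered_facs_lnp[OF x, of 1] sum_ordered_facs_lnp_error(2)[OF x, of 1] by (simp add: algebra_simps)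
    then have C1: "sum_ordered_facs 1 x \<le> (T + 3) * x / lnp x" using L by (simp add: field_simps)
    define y where "y = x / (lnp x)\<^sup>2"
    have "x / (lnp x)\<^sup>2 \<le> x / 1" using x L by (intro divide_left_mono) auto
    then have yx: "y \<le> x" by (simp add: y_def)
    have sub: "nats_upto y \<subseteq> nats_upto x" by (rule nats_upto_mono[OF yx])
    define f where "f = (\<lambda>n. real (ordered_facs 1 n) * (1 + ln (x / real n)))"
    have "(\<Sum>n\<in>nats_upto x. f n) = (\<Sum>n\<in>nats_upto x - nats_upto y. f n) + (\<Sum>n\<in>nats_upto y. f n)"
      by (rule sum.subset_diff[OF sub]) simp
    also have "(\<Sum>n\<in>nats_upto y. f n) \<le> (\<Sum>n\<in>nats_upto y. 1 * lnp x)"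
    proof (rule sum_mono)
      fix n assume "n \<in> nats_upto y"
      then have n: "n \<in> nats_upto x" "n > 0" using sub nats_upto_pos by blast+
      have "x / real n \<le> x" using x n by (simp add: divide_le_eq)
      then have "ln (x / real n) \<le> ln x" using x n by simp
      then show "f n \<le> 1 * lnp x"
        unfolding f_def lnp_def using ordered_facs_le_fact_real[of 1 n] nats_upto_quot[OF n(1)] by (intro mult_mono) auto
    qed
    also have "\<dots> = real (card (nats_upto y)) * lnp x" by simp
    also have "\<dots> \<le> y * lnp x" using card_nats_upto[of y] x L by (intro mult_right_mono) (auto simp: y_def)
    also have "\<dots> = x / lnp x" using L by (simp add: y_def power2_eq_square)
    also have "(\<Sum>n\<in>nats_upto x - nats_upto y. f n) \<le> (\<Sum>n\<in>nats_upto x - nats_upto y. real (ordered_facs 1 n) * (2 * lnlnp x))"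
    proof (rule sum_mono)
      fix n assume n: "n \<in> nats_upto x - nats_upto y"
      then have n0: "n > 0" and "y < real n" by (auto simp: nats_upto_def)
      then have "x / real n \<le> (lnp x)\<^sup>2" using L x unfolding y_def by (simp add: field_simps)
      then have "ln (x / real n) \<le> ln ((lnp x)\<^sup>2)" using x n0 L by simp
      also have "\<dots> = 2 * ln (lnp x)" using L by (simp add: ln_realpow)
      finally have "1 + ln (x / real n) \<le> 2 * lnlnp x" by (simp add: lnlnp_def)
      then show "f n \<le> real (ordered_facs 1 n) * (2 * lnlnp x)" unfolding f_def by (intro mult_left_mono) auto
    qed
    also have "\<dots> \<le> (\<Sum>n\<in>nats_upto x. real (ordered_facs 1 n) * (2 * lnlnp x))"
      using L by (intro sum_mono2) auto
    also have "\<dots> = sum_ordered_facs 1 x * (2 * lnlnp x)" by (simp add: sum_ordered_facs_def sum_distrib_right)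
    also have "\<dots> \<le> ((T + 3) * x / lnp x) * (2 * lnlnp x)" using C1 L by (intro mult_right_mono) auto
    finally have "(\<Sum>n\<in>nats_upto x. f n) \<le> x / lnp x * (1 + 2 * (T + 3) * lnlnp x)" by (simp add: algebra_simps add_divide_distrib)
    also have "\<dots> \<le> x / lnp x * ((1 + 2 * (T + 3)) * lnlnp x)"
      using L x by (intro mult_left_mono) (auto simp: algebra_simps)
    also have "\<dots> = (1 + 2 * (T + 3)) * x * (lnlnp x ^ 2 / lnp x) / lnlnp x"
      using L by (simp add: power2_eq_square)
    also have "\<dots> \<le> (1 + 2 * (T + 3)) * x * M / lnlnp x"
      using M(2)[OF x] L x T(1) by (intro divide_right_mono mult_left_mono) (auto simp: divide_le_eq)
    finally show ?thesis by (simp add: f_def mult_ac)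
  qed
  moreover have "M * (1 + 2 * (T + 3)) > 0" using M(1) T(1) by simp
  ultimately show ?thesis by blast
qed

text \<open>In effect the exponent of \<open>lnlnp\<close> is \<open>j - 1\<close>, but the quotient
  also makes sense at \<open>j = 0\<close>. Up to a constant, \<open>error_scale (Suc j)\<close> is
  the order of the count with \<open>Suc j\<close> primes, and \<open>error_scale j\<close> the
  order of its error.\<close>

definition error_scale :: "nat \<Rightarrow> real \<Rightarrow> real" where "error_scale j x = x * lnlnp x ^ j / (lnp x * lnlnp x)"

lemma error_scale_pos: "x \<ge> 1 \<Longrightarrow> error_scale j x > 0"
  using lnp_ge_1[of x] lnlnp_ge_1[of x] by (simp add: error_scale_def)

lemma error_scale_Suc: "x \<ge> 1 \<Longrightarrow> error_scale (Suc j) x = x * lnlnp x ^ j / lnp x"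
  using lnp_ge_1[of x] lnlnp_ge_1[of x] by (simp add: error_scale_def)

lemma error_scale_le_Suc:
  assumes x: "x \<ge> 1"
  shows "error_scale j x \<le> error_scale (Suc j) x"
proof -
  have L: "lnp x \<ge> 1" "lnlnp x \<ge> 1" using lnp_ge_1[OF x] lnlnp_ge_1[OF x] .
  show ?thesis
    unfolding error_scale_def using x L by (intro divide_right_mono mult_left_mono power_increasing) auto
qed

lemma sum_ordered_facs_asymp: "\<exists>K>0. \<forall>x\<ge>1. \<bar>sum_ordered_facs (Suc j) x - real (Suc j) * (x * lnlnp x ^ j / lnp x)\<bar> \<le> K * error_scale j x"
proof -
  obtain T where T: "T > 0" "\<And>x. x \<ge> 1 \<Longrightarrow> \<bar>log_sum (Suc j) x - real (Suc j) * x * lnlnp x ^ j\<bar> \<le> T * x * lnlnp x ^ j / lnlnp x"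
    using log_sum_asymp[of j] by blast
  have "\<exists>B>0. \<forall>x\<ge>1. (\<Sum>n\<in>nats_upto x. real (ordered_facs (Suc j) n) * (1 + ln (x / real n))) \<le> B * x * lnlnp x ^ j / lnlnp x"
  proof (cases "j = 0")
    case True
    then show ?thesis using sum_ordered_facs_1_error by simp
  next
    case False
    have "(\<Sum>n\<in>nats_upto x. real (ordered_facs (Suc j) n) * (1 + ln (x / real n))) \<le> (2 * fact (Suc j)) * x * lnlnp x ^ j / lnlnp x" if x: "x \<ge> 1" for x
    proof -
      have "2 * fact (Suc j) * x * 1 \<le> 2 * fact (Suc j) * x * lnlnp x ^ (j - 1)"
        using x lnlnp_ge_1[OF x] by (intro mult_left_mono one_le_power) auto
      also have "lnlnp x ^ (j - 1) = lnlnp x ^ j / lnlnp x" using False lnlnp_ge_1[OF x] by (cases j) auto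
      finally show ?thesis using sum_ordered_facs_lnp_error(2)[OF x, of "Suc j"] by simp
    qed
    then show ?thesis by (intro exI[of _ "2 * fact (Suc j)"]) (auto simp del: fact_Suc)
  qed
  then obtain B where B: "B > 0" "\<And>x. x \<ge> 1 \<Longrightarrow> (\<Sum>n\<in>nats_upto x. real (ordered_facs (Suc j) n) * (1 + ln (x / real n))) \<le> B * x * lnlnp x ^ j / lnlnp x"
    by blast
  have "\<bar>sum_ordered_facs (Suc j) x - real (Suc j) * (x * lnlnp x ^ j / lnp x)\<bar> \<le> (T + B) * error_scale j x" if x: "x \<ge> 1" for x
  proof -
    have L: "lnp x > 0" "lnlnp x > 0" using lnp_ge_1[OF x] lnlnp_ge_1[OF x] by auto
    have "\<bar>sum_ordered_facs (Suc j) x * lnp x - real (Suc j) * x * lnlnp x ^ j\<bar> \<le> T * x * lnlnp x ^ j / lnlnp x + B * x * lnlnp x ^ j / lnlnp x"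
      using sum_ordered_facs_lnp[OF x, of "Suc j"] T(2)[OF x] B(2)[OF x] sum_ordered_facs_lnp_error(1)[OF x, of "Suc j"] by linarith
    then have "\<bar>sum_ordered_facs (Suc j) x * lnp x - real (Suc j) * x * lnlnp x ^ j\<bar> / lnp x \<le> (T * x * lnlnp x ^ j / lnlnp x + B * x * lnlnp x ^ j / lnlnp x) / lnp x"
      using L by (intro divide_right_mono) auto
    moreover have "\<bar>sum_ordered_facs (Suc j) x * lnp x - real (Suc j) * x * lnlnp x ^ j\<bar> / lnp x = \<bar>sum_ordered_facs (Suc j) x - real (Suc j) * (x * lnlnp x ^ j / lnp x)\<bar>"
    proof -
      have "sum_ordered_facs (Suc j) x - real (Suc j) * (x * lnlnp x ^ j / lnp x) = (sum_ordered_facs (Suc j) x * lnp x - real (Suc j) * x * lnlnp x ^ j) / lnp x"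
        using L by (simp add: diff_divide_distrib del: of_nat_Suc)
      then show ?thesis using L by (simp only: abs_divide abs_of_pos)
    qed
    moreover have "(T * x * lnlnp x ^ j / lnlnp x + B * x * lnlnp x ^ j / lnlnp x) / lnp x = (T + B) * error_scale j x"
      unfolding add_divide_distrib distrib_right error_scale_def by (simp add: mult_ac)
    ultimately show ?thesis by linarith
  qed
  then show ?thesis using T(1) B(1) by (intro exI[of _ "T + B"]) auto
qed

text \<open>Passing from \<open>x\<close> to \<open>x / q\<close> shrinks each of \<open>lnp\<close>
  and \<open>lnlnp\<close> by a factor of at most \<open>1 + ln q\<close>. The two denominators
  account for the square, and the linear factor for the division by \<open>q\<close>.\<close>

lemma error_scale_quot:
  assumes q: "q \<ge> 1" and xq: "q \<le> x"
  shows "error_scale j (x / q) \<le> error_scale j x * ((1 + ln q)\<^sup>2 / q)"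
proof -
  define y where "y = x / q"
  have x: "x \<ge> 1" using assms by linarith
  have "x / q \<le> x / 1" using q x by (intro divide_left_mono) auto
  then have y: "y \<ge> 1" "y \<le> x" using q xq by (auto simp: y_def)
  have L: "lnp y \<ge> 1" "lnlnp y \<ge> 1" "lnp x \<ge> 1" "lnlnp x \<ge> 1"
    using lnp_ge_1 lnlnp_ge_1 y(1) x by auto
  define r where "r = 1 + ln q"
  have r: "r \<ge> 1" using q by (simp add: r_def)
  have "ln x = ln y + ln q" using q x by (simp add: y_def ln_div)
  moreover have "0 \<le> ln y * ln q" using q y by simp
  ultimately have 1: "lnp x \<le> lnp y * r" by (simp add: lnp_def r_def algebra_simps)
  have "ln (lnp x) \<le> ln (lnp y * r)" using 1 L by simp
  also have "\<dots> = ln (lnp y) + ln r" using L r by (simp add: ln_mult)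
  also have "ln r \<le> r - 1" using r by (intro ln_le_minus_one) auto
  finally have "lnlnp x \<le> lnlnp y + (r - 1)" by (simp add: lnlnp_def)
  also have "r - 1 \<le> lnlnp y * (r - 1)" using L r mult_right_mono[of 1 "lnlnp y" "r - 1"] by simp
  finally have 2: "lnlnp x \<le> lnlnp y * r" by (simp add: algebra_simps)
  have 3: "lnp x * lnlnp x \<le> (lnp y * lnlnp y) * r\<^sup>2"
    using mult_mono[OF 1 2] L r by (simp add: power2_eq_square mult_ac)
  have "error_scale j y = y * lnlnp y ^ j / (lnp y * lnlnp y)" by (simp add: error_scale_def)
  also have "\<dots> \<le> y * lnlnp x ^ j / (lnp y * lnlnp y)"
    using y L lnlnp_mono[OF y] by (intro divide_right_mono mult_left_mono power_mono) auto
  also have "\<dots> \<le> y * lnlnp x ^ j / (lnp x * lnlnp x / r\<^sup>2)"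
    using 3 y L r by (intro divide_left_mono) (auto simp: divide_le_eq intro!: mult_pos_pos divide_pos_pos)
  also have "\<dots> = error_scale j x * (r\<^sup>2 / q)" by (simp add: error_scale_def y_def)
  finally show ?thesis unfolding y_def r_def .
qed

text \<open>For \<open>q = m ^ e\<close>, the bound \<open>1 + ln q \<le> 8 * q powr (1/8)\<close>
  reduces the weight to \<open>64 * q powr (-3/4)\<close>. The geometric sum over
  \<open>e \<ge> 2\<close> is then O(m powr (-3/2)), and this is summable over
  \<open>m\<close>.\<close>

lemma prime_power_weights:
  "\<exists>W>0. \<forall>T. finite T \<and> (\<forall>(m,e)\<in>T. m \<ge> (2::nat) \<and> e \<ge> (2::nat)) \<longrightarrow>
     (\<Sum>(m,e)\<in>T. (1 + ln (real m ^ e))\<^sup>2 / real m ^ e) \<le> W"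
proof -
  have sm: "summable (\<lambda>n. real n powr (-3/2))" by (simp add: summable_real_powr_iff)
  define Z where "Z = (\<Sum>n. real n powr (-3/2))"
  have Z0: "Z \<ge> 0" unfolding Z_def by (rule suminf_nonneg[OF sm]) auto
  have tb: "(1 + ln (real m ^ e))\<^sup>2 / real m ^ e \<le> 64 * (real m powr (-3/4)) ^ e" if m: "m \<ge> 2" for m e :: nat
  proof -
    define q where "q = real m ^ e"
    have q: "q \<ge> 1" unfolding q_def using m by (intro one_le_power) auto
    define s where "s = q powr (1/8)"
    have s: "s \<ge> 1" unfolding s_def using q by (intro ge_one_powr_ge_zero) auto
    have "ln q = 8 * ln s" using q by (simp add: s_def ln_powr)
    also have "ln s \<le> s - 1" using s by (intro ln_le_minus_one) auto
    finally have "1 + ln q \<le> 8 * s" by simp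
    then have "(1 + ln q)\<^sup>2 \<le> (8 * s)\<^sup>2" using q by (intro power_mono) auto
    also have "\<dots> = 64 * q powr (1/4)" using q by (simp add: s_def power_mult_distrib power2_eq_square flip: powr_add)
    finally have "(1 + ln q)\<^sup>2 / q \<le> 64 * q powr (1/4) / q" using q by (intro divide_right_mono) auto
    also have "\<dots> = 64 * q powr (-3/4)" using q powr_diff[of q "1/4" 1] by simp
    also have "q powr (-3/4) = (real m powr (-3/4)) ^ e"
      using m unfolding q_def by (simp add: powr_powr mult.commute flip: powr_realpow)
    finally show ?thesis by (simp add: q_def)
  qed
  \<comment> \<open>The 4 is 1 / (1 - 3/4). Subtracting \<open>r ^ Suc B\<close> strengthens the
    claim enough for the induction to go through.\<close>
  have geo: "(\<Sum>e=2..B. r ^ e) \<le> 4 * (r ^ 2 - r ^ Suc B)" if r: "0 \<le> r" "r \<le> 3/4" and B: "B \<ge> 1" for r :: real and B :: nat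
    using B
  proof (induction B rule: dec_induct)
    case (step n)
    have "(\<Sum>e=2..Suc n. r ^ e) = (\<Sum>e=2..n. r ^ e) + r ^ Suc n" using step.hyps by simp
    also have "\<dots> \<le> 4 * (r ^ 2 - r ^ Suc n) + r ^ Suc n" using step.IH by simp
    also have "r ^ Suc (Suc n) \<le> 3/4 * r ^ Suc n" using r mult_right_mono[of r "3/4" "r ^ Suc n"] by simp
    then have "4 * (r ^ 2 - r ^ Suc n) + r ^ Suc n \<le> 4 * (r ^ 2 - r ^ Suc (Suc n))" by simp
    finally show ?case .
  qed (simp add: numeral_2_eq_2)
  have "(\<Sum>(m,e)\<in>T. (1 + ln (real m ^ e))\<^sup>2 / real m ^ e) \<le> 256 * Z + 1"
    if T: "finite T" "\<And>m e. (m, e) \<in> T \<Longrightarrow> m \<ge> 2 \<and> e \<ge> 2" for T :: "(nat \<times> nat) set"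
  proof -
    define A where "A = fst ` T"
    define B where "B = Max (insert 1 (snd ` T))"
    have B1: "B \<ge> 1" unfolding B_def using T(1) by (intro Max_ge) auto
    have sub: "T \<subseteq> A \<times> {2..B}"
    proof
      fix a assume a: "a \<in> T"
      then have "snd a \<le> B" unfolding B_def using T(1) by (intro Max_ge) auto
      then show "a \<in> A \<times> {2..B}" using T(2)[of "fst a" "snd a"] a by (cases a) (force simp: A_def)
    qed
    have A2: "m \<ge> 2" if "m \<in> A" for m using that T(2) by (auto simp: A_def)
    have fA: "finite A" using T(1) by (simp add: A_def)
    have "(\<Sum>(m,e)\<in>T. (1 + ln (real m ^ e))\<^sup>2 / real m ^ e) \<le> (\<Sum>(m,e)\<in>T. 64 * (real m powr (-3/4)) ^ e)"
      using T(2) tb by (intro sum_mono) auto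
    also have "\<dots> \<le> (\<Sum>(m,e)\<in>A \<times> {2..B}. 64 * (real m powr (-3/4)) ^ e)"
      using sub fA by (intro sum_mono2) auto
    also have "\<dots> = (\<Sum>m\<in>A. 64 * (\<Sum>e=2..B. (real m powr (-3/4)) ^ e))"
      by (simp add: sum.cartesian_product [symmetric] sum_distrib_left)
    also have "\<dots> \<le> (\<Sum>m\<in>A. 256 * real m powr (-3/2))"
    proof (rule sum_mono)
      fix m assume m: "m \<in> A"
      define r where "r = real m powr (-3/4)"
      have "r \<le> 2 powr (-3/4)" unfolding r_def using A2[OF m] by (intro powr_mono2') auto
      also have "\<dots> \<le> 2 powr (-1/2)" by (intro powr_mono) auto
      also have "\<dots> \<le> 3/4"
      proof (rule power2_le_imp_le)
        have "((2::real) powr (-1/2))\<^sup>2 = 2 powr (-1)" by (simp add: power2_eq_square flip: powr_add)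
        also have "\<dots> = 1/2" by (simp add: powr_minus)
        finally show "((2::real) powr (-1/2))\<^sup>2 \<le> (3/4)\<^sup>2" by (simp add: power2_eq_square)
      qed simp
      finally have r: "0 \<le> r" "r \<le> 3/4" by (auto simp: r_def)
      have "(\<Sum>e=2..B. r ^ e) \<le> 4 * (r ^ 2 - r ^ Suc B)" by (rule geo[OF r B1])
      also have "\<dots> \<le> 4 * r ^ 2" using r by simp
      also have "r ^ 2 = real m powr (-3/2)" by (simp add: r_def power2_eq_square flip: powr_add)
      finally show "64 * (\<Sum>e=2..B. (real m powr (-3/4)) ^ e) \<le> 256 * real m powr (-3/2)"
        by (simp add: r_def)
    qed
    also have "\<dots> = 256 * (\<Sum>m\<in>A. real m powr (-3/2))" by (simp add: sum_distrib_left)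
    also have "\<dots> \<le> 256 * Z" unfolding Z_def using fA sm by (intro mult_left_mono sum_le_suminf) auto
    finally show ?thesis by simp
  qed
  then show ?thesis using Z0 by (intro exI[of _ "256 * Z + 1"]) auto
qed

section \<open>Odd numbers with few prime factors\<close>

definition few_primes :: "nat \<Rightarrow> real \<Rightarrow> nat set" where
  "few_primes j x = {n \<in> nats_upto x. odd n \<and> card (prime_factors n) \<le> j}"

lemma finite_few_primes [simp]: "finite (few_primes j x)" by (rule finite_subset[OF _ finite_nats_upto[of x]]) (auto simp: few_primes_def)

lemma size_ne_card_imp_count:
  assumes "size A \<noteq> card (set_mset A)"
  shows "\<exists>p\<in>#A. count A p \<ge> 2"
proof (rule ccontr)
  assume *: "\<not> (\<exists>p\<in>#A. count A p \<ge> 2)"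
  have "size A = (\<Sum>p\<in>set_mset A. count A p)" by (rule size_multiset_overloaded_eq)
  also have "\<dots> = (\<Sum>p\<in>set_mset A. 1)"
  proof (rule sum.cong)
    fix p assume "p \<in> set_mset A"
    then show "count A p = 1" using * count_greater_zero_iff[of A p] by (metis One_nat_def Suc_1 Suc_leI le_less_linear less_Suc_eq_le nat_less_le not_less_eq_eq)
  qed simp
  finally show False using assms by simp
qed

definition bad_pairs :: "real \<Rightarrow> (nat \<times> nat) set" where
  "bad_pairs x = {(p, e). prime p \<and> e \<ge> 2 \<and> real p ^ e \<le> x}"

lemma finite_bad_pairs [simp]: "finite (bad_pairs x)"
proof (rule finite_subset)
  show "bad_pairs x \<subseteq> {..nat \<lfloor>x\<rfloor>} \<times> {..nat \<lfloor>x\<rfloor>}"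
  proof
    fix a assume "a \<in> bad_pairs x"
    then obtain p e where a: "a = (p, e)" "prime p" "e \<ge> 2" "real p ^ e \<le> x" by (auto simp: bad_pairs_def)
    have p2: "p \<ge> 2" using a(2) prime_ge_2_nat by blast
    have "real p \<le> real p ^ e" using power_increasing[of 1 e "real p"] p2 a(3) by simp
    then have "real p \<le> x" using a(4) by linarith
    moreover have "real e \<le> x"
    proof -
      have "e < 2 ^ e" by (rule less_exp)
      also have "2 ^ e \<le> p ^ e" using p2 by (rule power_mono) simp
      finally have "real e < real (p ^ e)" by (simp only: of_nat_less_iff)
      then have "real e < real p ^ e" by (simp only: of_nat_power)
      then show ?thesis using a(4) by linarith
    qed
    ultimately show "a \<in> {..nat \<lfloor>x\<rfloor>} \<times> {..nat \<lfloor>x\<rfloor>}" using a(1) by (auto simp: le_nat_floor)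
  qed
qed simp

text \<open>Such an \<open>n\<close> has a repeated prime \<open>p\<close>. Removing its full power
  \<open>p ^ e\<close> leaves an odd cofactor with at most \<open>j\<close> prime factors, and the
  pair together with the cofactor determines \<open>n\<close>.\<close>

lemma card_bad:
  "card {n \<in> nats_upto x. odd n \<and> card (prime_factors n) = Suc j \<and> size (prime_factorization n) \<noteq> Suc j}
     \<le> (\<Sum>(p,e)\<in>bad_pairs x. card (few_primes j (x / real p ^ e)))"
proof -
  let ?B = "{n \<in> nats_upto x. odd n \<and> card (prime_factors n) = Suc j \<and> size (prime_factorization n) \<noteq> Suc j}"
  let ?I = "\<lambda>(p,e). (\<lambda>m. p ^ e * m) ` few_primes j (x / real p ^ e)"
  have "?B \<subseteq> (\<Union>a\<in>bad_pairs x. ?I a)"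
  proof
    fix n assume n: "n \<in> ?B"
    then have n0: "n > 0" "odd n" "real n \<le> x" by (auto simp: nats_upto_def)
    obtain p where p: "p \<in># prime_factorization n" "count (prime_factorization n) p \<ge> 2"
      using size_ne_card_imp_count[of "prime_factorization n"] n by auto
    define e where "e = multiplicity p n"
    have pp: "prime p" using p(1) by (simp add: in_prime_factors_iff)
    have e2: "e \<ge> 2" using p(2) pp by (simp add: e_def count_prime_factorization_prime)
    have nz: "n \<noteq> 0" and nu: "\<not> is_unit p" using n0 prime_gt_1_nat[OF pp] by auto
    obtain m where m: "n = p ^ e * m" "\<not> p dvd m"
      using multiplicity_decompose'[OF nz nu] unfolding e_def by (metis mult.commute)
    have m0: "m > 0" using m(1) n0 by (auto intro: Nat.gr0I)
    have p0: "p > 0" using pp prime_gt_0_nat by blast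
    have pf: "prime_factors n = insert p (prime_factors m)"
    proof -
      have "prime_factors n = prime_factors (p ^ e) \<union> prime_factors m"
        unfolding m(1) using m0 p0 by (intro prime_factors_product) auto
      also have "prime_factors (p ^ e) = {p}" using pp e2 by (simp add: prime_factors_power prime_prime_factors)
      finally show ?thesis by simp
    qed
    have "p \<notin> prime_factors m" using m(2) by (auto simp: in_prime_factors_iff)
    then have "card (prime_factors m) \<le> j" using n pf by simp
    moreover have "odd m" using n0 m(1) by simp
    moreover have mx: "real p ^ e * real m \<le> x" using n0(3) m(1) by simp
    then have "real m \<le> x / real p ^ e" using p0 by (simp add: field_simps)
    ultimately have "m \<in> few_primes j (x / real p ^ e)" using m0 by (simp add: few_primes_def nats_upto_def)
    moreover have "(p, e) \<in> bad_pairs x"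
    proof -
      have "real p ^ e * 1 \<le> real p ^ e * real m" using m0 by (intro mult_left_mono) auto
      then show ?thesis using mx pp e2 by (simp add: bad_pairs_def)
    qed
    ultimately show "n \<in> (\<Union>a\<in>bad_pairs x. ?I a)" using m(1) by blast
  qed
  then have "card ?B \<le> card (\<Union>a\<in>bad_pairs x. ?I a)" by (intro card_mono) auto
  also have "\<dots> \<le> (\<Sum>a\<in>bad_pairs x. card (?I a))" by (rule card_UN_le) simp
  also have "\<dots> \<le> (\<Sum>(p,e)\<in>bad_pairs x. card (few_primes j (x / real p ^ e)))"
    by (intro sum_mono) (auto intro: card_image_le)
  finally show ?thesis .
qed

text \<open>Squarefree odd numbers with exactly \<open>Suc j\<close> primes weigh
  \<open>fact (Suc j)\<close> on both sides. Every other number with nonzero weight on either side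
  has at most \<open>j\<close> prime factors or a repeated one; \<open>E\<close> bounds how many
  there are.\<close>

lemma M_vs_sum_ordered_facs:
  fixes j x
  defines "E \<equiv> real (card (few_primes j x)) + (\<Sum>(p,e)\<in>bad_pairs x. real (card (few_primes j (x / real p ^ e))))"
  shows "\<bar>sum_ordered_facs (Suc j) x - fact (Suc j) * real (card (few_primes (Suc j) x))\<bar> \<le> fact (Suc j) * E"
proof -
  define A where "A = {n \<in> nats_upto x. odd n \<and> card (prime_factors n) = Suc j \<and> size (prime_factorization n) = Suc j}"
  define B where "B = {n \<in> nats_upto x. odd n \<and> card (prime_factors n) = Suc j \<and> size (prime_factorization n) \<noteq> Suc j}"
  have fin: "finite A" "finite B" by (auto simp: A_def B_def)
  have few_primes: "few_primes (Suc j) x = A \<union> B \<union> few_primes j x" by (auto simp: few_primes_def A_def B_def)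
  have "card (few_primes (Suc j) x) \<le> card (A \<union> B) + card (few_primes j x)" unfolding few_primes by (rule card_Un_le)
  also have "card (A \<union> B) \<le> card A + card B" by (rule card_Un_le)
  finally have "real (card (few_primes (Suc j) x)) \<le> real (card A) + real (card B) + real (card (few_primes j x))" by linarith
  moreover have "real (card B) \<le> (\<Sum>(p,e)\<in>bad_pairs x. real (card (few_primes j (x / real p ^ e))))"
  proof -
    have "card B \<le> (\<Sum>(p,e)\<in>bad_pairs x. card (few_primes j (x / real p ^ e)))" unfolding B_def by (rule card_bad)
    then have "real (card B) \<le> real (\<Sum>(p,e)\<in>bad_pairs x. card (few_primes j (x / real p ^ e)))" by (simp only: of_nat_le_iff)
    then show ?thesis by (simp add: of_nat_sum case_prod_unfold)
  qed
  ultimately have up: "real (card (few_primes (Suc j) x)) \<le> real (card A) + E" unfolding E_def by linarith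
  have lo: "real (card A) \<le> real (card (few_primes (Suc j) x))"
    unfolding of_nat_le_iff by (rule card_mono[OF finite_few_primes]) (use few_primes in auto)
  have "sum_ordered_facs (Suc j) x = (\<Sum>n\<in>nats_upto x - A. real (ordered_facs (Suc j) n)) + (\<Sum>n\<in>A. real (ordered_facs (Suc j) n))"
    unfolding sum_ordered_facs_def by (rule sum.subset_diff) (auto simp: A_def)
  also have "(\<Sum>n\<in>A. real (ordered_facs (Suc j) n)) = (\<Sum>n\<in>A. fact (Suc j))"
    using nats_upto_pos by (intro sum.cong refl) (auto simp: A_def ordered_facs_eq_fact simp del: fact_Suc)
  finally have C: "sum_ordered_facs (Suc j) x = (\<Sum>n\<in>nats_upto x - A. real (ordered_facs (Suc j) n)) + fact (Suc j) * real (card A)" by simp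
  have "(\<Sum>n\<in>nats_upto x - A. real (ordered_facs (Suc j) n)) \<le> (\<Sum>n\<in>few_primes j x. fact (Suc j))"
  proof -
    have "(\<Sum>n\<in>nats_upto x - A. real (ordered_facs (Suc j) n)) = (\<Sum>n\<in>(nats_upto x - A) \<inter> few_primes j x. real (ordered_facs (Suc j) n))"
    proof (rule sum.mono_neutral_right)
      show "\<forall>n\<in>nats_upto x - A - (nats_upto x - A) \<inter> few_primes j x. real (ordered_facs (Suc j) n) = 0"
      proof (rule ballI, rule ccontr)
        fix n assume n: "n \<in> nats_upto x - A - (nats_upto x - A) \<inter> few_primes j x" and "real (ordered_facs (Suc j) n) \<noteq> 0"
        then have c: "odd n" "size (prime_factorization n) = Suc j" using ordered_facs_nonzero[of "Suc j" n] by auto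
        have "card (prime_factors n) \<le> Suc j" using card_set_mset_le[of "prime_factorization n"] c by simp
        then show False using n c by (auto simp: A_def few_primes_def)
      qed
    qed auto
    also have "\<dots> \<le> (\<Sum>n\<in>(nats_upto x - A) \<inter> few_primes j x. fact (Suc j))" by (intro sum_mono ordered_facs_le_fact_real)
    also have "\<dots> \<le> (\<Sum>n\<in>few_primes j x. fact (Suc j))" by (intro sum_mono2) auto
    finally show ?thesis .
  qed
  also have "\<dots> = fact (Suc j) * real (card (few_primes j x))" by (simp del: fact_Suc)
  also have "\<dots> \<le> fact (Suc j) * E"
    unfolding E_def by (intro mult_left_mono) (auto intro!: sum_nonneg)
  finally have D: "(\<Sum>n\<in>nats_upto x - A. real (ordered_facs (Suc j) n)) \<le> fact (Suc j) * E" .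
  have D0: "0 \<le> (\<Sum>n\<in>nats_upto x - A. real (ordered_facs (Suc j) n))" by (intro sum_nonneg) auto
  have f1: "fact (Suc j) * real (card (few_primes (Suc j) x)) \<le> fact (Suc j) * (real (card A) + E)"
    using up by (intro mult_left_mono) auto
  have f2: "fact (Suc j) * real (card A) \<le> fact (Suc j) * real (card (few_primes (Suc j) x))"
    using lo by (intro mult_left_mono) auto
  show ?thesis using f1 f2 C D D0 unfolding distrib_left abs_le_iff by linarith
qed

text \<open>\<open>error_scale_quot\<close> pulls \<open>error_scale j x\<close> out of every term,
  and the remaining weights are summable by \<open>prime_power_weights\<close>.\<close>

lemma bad_sum_bound:
  assumes K: "K \<ge> 0" "\<And>x. x \<ge> 1 \<Longrightarrow> real (card (few_primes j x)) \<le> K * error_scale j x"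
  shows "\<exists>W>0. \<forall>x\<ge>1. (\<Sum>(p,e)\<in>bad_pairs x. real (card (few_primes j (x / real p ^ e)))) \<le> W * error_scale j x"
proof -
  obtain W where W: "W > 0" "\<And>T. finite T \<Longrightarrow> (\<forall>(m,e)\<in>T. m \<ge> (2::nat) \<and> e \<ge> (2::nat)) \<Longrightarrow>
     (\<Sum>(m,e)\<in>T. (1 + ln (real m ^ e))\<^sup>2 / real m ^ e) \<le> W"
    using prime_power_weights by blast
  have "(\<Sum>(p,e)\<in>bad_pairs x. real (card (few_primes j (x / real p ^ e)))) \<le> (K * W + 1) * error_scale j x" if x: "x \<ge> 1" for x
  proof -
    have "(\<Sum>(p,e)\<in>bad_pairs x. real (card (few_primes j (x / real p ^ e)))) \<le> (\<Sum>(p,e)\<in>bad_pairs x. K * error_scale j x * ((1 + ln (real p ^ e))\<^sup>2 / real p ^ e))"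
    proof (rule sum_mono, clarify)
      fix p e assume "(p, e) \<in> bad_pairs x"
      then have pe: "prime p" "real p ^ e \<le> x" by (auto simp: bad_pairs_def)
      then have "p \<ge> 1" using prime_ge_1_nat by blast
      then have q: "real p ^ e \<ge> 1" by (intro one_le_power) simp
      have "0 < real p ^ e" using q by linarith
      then have "1 \<le> x / real p ^ e" using pe(2) by (simp only: pos_le_divide_eq mult_1)
      then have "real (card (few_primes j (x / real p ^ e))) \<le> K * error_scale j (x / real p ^ e)" by (rule K(2))
      also have "\<dots> \<le> K * (error_scale j x * ((1 + ln (real p ^ e))\<^sup>2 / real p ^ e))"
        by (intro mult_left_mono error_scale_quot q pe K(1))
      finally show "real (card (few_primes j (x / real p ^ e))) \<le> K * error_scale j x * ((1 + ln (real p ^ e))\<^sup>2 / real p ^ e)" by (simp add: mult.assoc)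
    qed
    also have "\<dots> = K * error_scale j x * (\<Sum>(p,e)\<in>bad_pairs x. (1 + ln (real p ^ e))\<^sup>2 / real p ^ e)"
      by (simp add: sum_distrib_left case_prod_unfold)
    also have "\<dots> \<le> K * error_scale j x * W"
    proof (rule mult_left_mono)
      show "(\<Sum>(p,e)\<in>bad_pairs x. (1 + ln (real p ^ e))\<^sup>2 / real p ^ e) \<le> W"
        by (rule W(2)[OF finite_bad_pairs]) (auto simp: bad_pairs_def prime_ge_2_nat)
      show "0 \<le> K * error_scale j x" using K(1) error_scale_pos[OF x, of j] by simp
    qed
    also have "\<dots> \<le> (K * W + 1) * error_scale j x" using error_scale_pos[OF x, of j] by (simp add: algebra_simps)
    finally show ?thesis .
  qed
  moreover have "K * W + 1 > 0" using K(1) W(1) by (simp add: add_nonneg_pos)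
  ultimately show ?thesis by blast
qed

text \<open>The denominator arises as \<open>Suc j / fact (Suc j) = 1 / fact j\<close>. All
  deviations reduce to counts of numbers with at most \<open>j\<close> primes, hence to the order
  assumed for them.\<close>

lemma M_step:
  assumes K: "K \<ge> 0" "\<And>x. x \<ge> 1 \<Longrightarrow> real (card (few_primes j x)) \<le> K * error_scale j x"
  shows "\<exists>B>0. \<forall>x\<ge>1. \<bar>real (card (few_primes (Suc j) x)) - error_scale (Suc j) x / fact j\<bar> \<le> B * error_scale j x"
proof -
  obtain W where W: "W > 0" "\<And>x. x \<ge> 1 \<Longrightarrow> (\<Sum>(p,e)\<in>bad_pairs x. real (card (few_primes j (x / real p ^ e)))) \<le> W * error_scale j x"
    using bad_sum_bound[OF K] by blast
  obtain C where C: "C > 0" "\<And>x. x \<ge> 1 \<Longrightarrow> \<bar>sum_ordered_facs (Suc j) x - real (Suc j) * (x * lnlnp x ^ j / lnp x)\<bar> \<le> C * error_scale j x"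
    using sum_ordered_facs_asymp by blast
  have "\<bar>real (card (few_primes (Suc j) x)) - error_scale (Suc j) x / fact j\<bar> \<le> (K + W + C) * error_scale j x" if x: "x \<ge> 1" for x
  proof -
    define f :: real where "f = fact (Suc j)"
    have f: "f \<ge> 1" by (simp add: f_def fact_ge_1 del: fact_Suc)
    define m where "m = real (card (few_primes (Suc j) x))"
    have E0: "error_scale j x \<ge> 0" using error_scale_pos[OF x, of j] by simp
    have "real (card (few_primes j x)) + (\<Sum>(p,e)\<in>bad_pairs x. real (card (few_primes j (x / real p ^ e)))) \<le> (K + W) * error_scale j x"
      using K(2)[OF x] W(2)[OF x] by (simp add: distrib_right)
    then have "f * (real (card (few_primes j x)) + (\<Sum>(p,e)\<in>bad_pairs x. real (card (few_primes j (x / real p ^ e))))) \<le> f * ((K + W) * error_scale j x)"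
      using f by (intro mult_left_mono) auto
    then have 1: "\<bar>sum_ordered_facs (Suc j) x - f * m\<bar> \<le> f * ((K + W) * error_scale j x)"
      using M_vs_sum_ordered_facs[of j x] unfolding f_def m_def by linarith
    have "C * error_scale j x * 1 \<le> C * error_scale j x * f" using C(1) E0 f by (intro mult_left_mono) auto
    then have 2: "\<bar>sum_ordered_facs (Suc j) x - real (Suc j) * error_scale (Suc j) x\<bar> \<le> f * (C * error_scale j x)"
      using C(2)[OF x] unfolding error_scale_Suc[OF x] by (simp add: mult_ac)
    have fe: "real (Suc j) * error_scale (Suc j) x = f * (error_scale (Suc j) x / fact j)"
      by (simp add: f_def)
    have "\<bar>f * m - f * (error_scale (Suc j) x / fact j)\<bar> \<le> f * ((K + W) * error_scale j x) + f * (C * error_scale j x)"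
      using 1 2 unfolding fe by linarith
    also have "\<dots> = f * ((K + W + C) * error_scale j x)" by (simp add: algebra_simps)
    finally have "\<bar>f\<bar> * \<bar>m - error_scale (Suc j) x / fact j\<bar> \<le> f * ((K + W + C) * error_scale j x)"
      by (simp only: right_diff_distrib [symmetric] abs_mult)
    then show ?thesis using f unfolding m_def by simp
  qed
  moreover have "K + W + C > 0" using K(1) W(1) C(1) by linarith
  ultimately show ?thesis by blast
qed

text \<open>Induction through \<open>M_step\<close>: the bound for \<open>j\<close> yields the
  asymptotics for \<open>Suc j\<close>, which contains the next bound.\<close>

lemma M_upper: "\<exists>K>0. \<forall>x\<ge>1. real (card (few_primes j x)) \<le> K * error_scale j x"
proof (induction j)
  case 0
  \<comment> \<open>Only \<open>n = 1\<close> has no prime factor. The 4 is the square of the 2 in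
    \<open>lnp x \<le> 2 * sqrt x\<close>.\<close>
  have "real (card (few_primes 0 x)) \<le> 4 * error_scale 0 x" if x: "x \<ge> 1" for x
  proof -
    have L: "lnp x \<ge> 1" "lnlnp x \<ge> 1" using lnp_ge_1[OF x] lnlnp_ge_1[OF x] .
    have "few_primes 0 x \<subseteq> {1}"
    proof
      fix n assume "n \<in> few_primes 0 x"
      then have "n > 0" "prime_factorization n = {#}" by (auto simp: few_primes_def nats_upto_def)
      then show "n \<in> {1}" by (simp add: prime_factorization_empty_iff)
    qed
    then have "card (few_primes 0 x) \<le> 1" using card_mono[of "{1}" "few_primes 0 x"] by simp
    moreover have "ln (sqrt x) \<le> sqrt x - 1" using x by (intro ln_le_minus_one) auto
    then have "lnp x \<le> 2 * sqrt x" using x by (simp add: lnp_def ln_sqrt)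
    then have "(lnp x)\<^sup>2 \<le> (2 * sqrt x)\<^sup>2" using L by (intro power_mono) auto
    then have "(lnp x)\<^sup>2 \<le> 4 * x" using x by (simp add: power_mult_distrib)
    moreover have "lnlnp x \<le> lnp x" using ln_le_minus_one[of "lnp x"] L by (simp add: lnlnp_def)
    then have "lnp x * lnlnp x \<le> (lnp x)\<^sup>2" using L by (simp add: power2_eq_square)
    ultimately have "1 \<le> 4 * x / (lnp x * lnlnp x)" using L by (simp add: field_simps)
    then show ?thesis using \<open>card (few_primes 0 x) \<le> 1\<close> by (simp add: error_scale_def)
  qed
  then show ?case by (intro exI[of _ 4]) auto
next
  case (Suc j)
  then obtain K where K: "K > 0" "\<And>x. x \<ge> 1 \<Longrightarrow> real (card (few_primes j x)) \<le> K * error_scale j x" by blast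
  obtain B where B: "B > 0" "\<And>x. x \<ge> 1 \<Longrightarrow> \<bar>real (card (few_primes (Suc j) x)) - error_scale (Suc j) x / fact j\<bar> \<le> B * error_scale j x"
    using M_step[of K j] K by (meson less_imp_le)
  have "real (card (few_primes (Suc j) x)) \<le> (B + 1) * error_scale (Suc j) x" if x: "x \<ge> 1" for x
  proof -
    have "error_scale (Suc j) x / fact j \<le> error_scale (Suc j) x / 1"
      using error_scale_pos[OF x, of "Suc j"] by (intro divide_left_mono) (auto simp: fact_ge_1)
    moreover have "B * error_scale j x \<le> B * error_scale (Suc j) x" using error_scale_le_Suc[OF x] B(1) by (intro mult_left_mono) auto
    ultimately show ?thesis using B(2)[OF x] by (simp add: distrib_right)
  qed
  then show ?case using B(1) by (intro exI[of _ "B + 1"]) auto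
qed

lemma M_asymp: "\<exists>B>0. \<forall>x\<ge>1. \<bar>real (card (few_primes (Suc j) x)) - error_scale (Suc j) x / fact j\<bar> \<le> B * error_scale j x"
proof -
  obtain K where "K > 0" "\<And>x. x \<ge> 1 \<Longrightarrow> real (card (few_primes j x)) \<le> K * error_scale j x" using M_upper by blast
  then show ?thesis using M_step[of K j] by (meson less_imp_le)
qed

section \<open>Elementary abelian 2-subgroups\<close>

text \<open>The identity is included, so in an abelian group this is the 2-torsion subgroup.\<close>

definition involutions :: "('a, 'c) monoid_scheme \<Rightarrow> 'a set" where
  "involutions K = {x \<in> carrier K. x \<otimes>\<^bsub>K\<^esub> x = \<one>\<^bsub>K\<^esub>}"

lemma carrier_cyclic_power: "carrier (cyclic_power 2 k) = (\<Pi>\<^sub>E i\<in>{..<k}. {0..<2})"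
  by (simp add: cyclic_power_def carrier_integer_mod_group)

lemma mult_cyclic_power: "f \<otimes>\<^bsub>cyclic_power 2 k\<^esub> g = (\<lambda>i\<in>{..<k}. (f i + g i) mod 2)"
  by (simp add: cyclic_power_def)

lemma one_cyclic_power: "\<one>\<^bsub>cyclic_power 2 k\<^esub> = (\<lambda>i\<in>{..<k}. 0)"
  by (simp add: cyclic_power_def)

lemma group_cyclic_power: "group (cyclic_power 2 k)"
  by (simp add: cyclic_power_def)

lemma card_cyclic_power: "card (carrier (cyclic_power 2 k)) = 2 ^ k"
  by (simp add: carrier_cyclic_power card_PiE)

lemma cyclic_power_involution:
  assumes "f \<in> carrier (cyclic_power 2 k)"
  shows "f \<otimes>\<^bsub>cyclic_power 2 k\<^esub> f = \<one>\<^bsub>cyclic_power 2 k\<^esub>"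
proof -
  have "(f i + f i) mod 2 = 0" if "i < k" for i by simp
  then show ?thesis unfolding mult_cyclic_power one_cyclic_power by (intro restrict_ext) auto
qed

lemma embeds_imp_card_involutions:
  assumes K: "group K" "finite (carrier K)" and e: "embeds_in (cyclic_power 2 k) K"
  shows "2 ^ k \<le> card (involutions K)"
proof -
  obtain H where H: "subgroup H K" "cyclic_power 2 k \<cong> K\<lparr>carrier := H\<rparr>"
    using e unfolding embeds_in_def by blast
  then obtain h where h: "h \<in> iso (cyclic_power 2 k) (K\<lparr>carrier := H\<rparr>)" by (auto simp: is_iso_def)
  have bij: "bij_betw h (carrier (cyclic_power 2 k)) H" and hom: "h \<in> hom (cyclic_power 2 k) (K\<lparr>carrier := H\<rparr>)"
    using h by (auto simp: iso_def)
  have gH: "group (K\<lparr>carrier := H\<rparr>)" using K(1) H(1) by (simp add: group.subgroup_imp_group)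
  have h1: "h \<one>\<^bsub>cyclic_power 2 k\<^esub> = \<one>\<^bsub>K\<^esub>"
    using hom_one[OF hom group_cyclic_power gH] by simp
  have "H \<subseteq> involutions K"
  proof
    fix y assume y: "y \<in> H"
    then obtain f where f: "f \<in> carrier (cyclic_power 2 k)" "y = h f" using bij by (auto simp: bij_betw_def)
    have "h (f \<otimes>\<^bsub>cyclic_power 2 k\<^esub> f) = h f \<otimes>\<^bsub>K\<^esub> h f"
      using hom_mult[OF hom f(1) f(1)] by simp
    then have "y \<otimes>\<^bsub>K\<^esub> y = \<one>\<^bsub>K\<^esub>" using f cyclic_power_involution[OF f(1)] h1 by simp
    then show "y \<in> involutions K" using y subgroup.subset[OF H(1)] by (auto simp: involutions_def)
  qed
  moreover have "card H = 2 ^ k" using bij_betw_same_card[OF bij] card_cyclic_power by simp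
  moreover have "finite (involutions K)" using K(2) by (simp add: involutions_def)
  ultimately show ?thesis using card_mono by metis
qed

text \<open>The embedding is grown one generator at a time. An image with \<open>2 ^ k\<close>
  elements cannot exhaust \<open>2 ^ Suc k\<close> involutions, and any involution outside it can
  serve as the image of the new coordinate.\<close>

lemma cyclic_power_hom_ex:
  assumes K: "comm_group K" "finite (carrier K)" and "2 ^ k \<le> card (involutions K)"
  shows "\<exists>\<phi>. \<phi> \<in> hom (cyclic_power 2 k) K \<and> inj_on \<phi> (carrier (cyclic_power 2 k)) \<and> \<phi> ` carrier (cyclic_power 2 k) \<subseteq> involutions K"
  using assms(3)
proof (induction k)
  interpret comm_group K by (rule K(1))
  case 0
  have "carrier (cyclic_power 2 0) = {\<lambda>_. undefined}" by (simp add: carrier_cyclic_power)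
  then show ?case by (intro exI[of _ "\<lambda>_. \<one>\<^bsub>K\<^esub>"]) (auto simp: hom_def involutions_def)
next
  interpret comm_group K by (rule K(1))
  case (Suc k)
  let ?C = "carrier (cyclic_power 2 k)" and ?D = "carrier (cyclic_power 2 (Suc k))"
  obtain \<phi> where \<phi>: "\<phi> \<in> hom (cyclic_power 2 k) K" "inj_on \<phi> ?C" "\<phi> ` ?C \<subseteq> involutions K"
    using Suc by auto
  have finI: "finite (involutions K)" using K(2) by (simp add: involutions_def)
  have "card (\<phi> ` ?C) = 2 ^ k" using card_image[OF \<phi>(2)] card_cyclic_power by simp
  then have "card (\<phi> ` ?C) < card (involutions K)" using Suc.prems zero_less_power[of "2::nat" k]
    by (simp only: power_Suc) linarith
  then obtain x where x: "x \<in> involutions K" "x \<notin> \<phi> ` ?C"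
  proof -
    have "finite (\<phi> ` ?C)" using \<phi>(3) finI by (rule finite_subset)
    then have "\<not> involutions K \<subseteq> \<phi> ` ?C" using \<open>card (\<phi> ` ?C) < card (involutions K)\<close> card_mono[of "\<phi> ` ?C" "involutions K"] by linarith
    then show ?thesis using that by blast
  qed
  have xc: "x \<in> carrier K" "x \<otimes>\<^bsub>K\<^esub> x = \<one>\<^bsub>K\<^esub>" using x(1) by (auto simp: involutions_def)
  define r where "r = (\<lambda>f::nat\<Rightarrow>int. restrict f {..<k})"
  have D: "f i \<in> {0..<2}" if "f \<in> ?D" "i < Suc k" for f i
    using PiE_mem[OF that(1)[unfolded carrier_cyclic_power], of i] that(2) by simp
  have rC: "r f \<in> ?C" if "f \<in> ?D" for f
    unfolding r_def carrier_cyclic_power restrict_PiE_iff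
    using D[OF that] by (meson lessThan_iff less_SucI)
  have fk: "f k = 0 \<or> f k = 1" if "f \<in> ?D" for f
  proof -
    have "0 \<le> f k" "f k < 2" using D[OF that, of k] by simp_all
    then show ?thesis by linarith
  qed
  define e where "e = (\<lambda>a::int. if a = 1 then x else \<one>\<^bsub>K\<^esub>)"
  have ec: "e a \<in> carrier K" for a using xc by (simp add: e_def)
  define \<psi> where "\<psi> = (\<lambda>f. \<phi> (r f) \<otimes>\<^bsub>K\<^esub> e (f k))"
  have \<phi>c: "\<phi> f \<in> carrier K" if "f \<in> ?C" for f using hom_in_carrier[OF \<phi>(1) that] .
  have \<phi>2: "\<phi> f \<otimes>\<^bsub>K\<^esub> \<phi> f = \<one>\<^bsub>K\<^esub>" if "f \<in> ?C" for f using \<phi>(3) that by (auto simp: involutions_def)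
  have rm: "r (f \<otimes>\<^bsub>cyclic_power 2 (Suc k)\<^esub> g) = r f \<otimes>\<^bsub>cyclic_power 2 k\<^esub> r g" for f g
    by (auto simp: r_def mult_cyclic_power fun_eq_iff)
  have em: "e ((f \<otimes>\<^bsub>cyclic_power 2 (Suc k)\<^esub> g) k) = e (f k) \<otimes>\<^bsub>K\<^esub> e (g k)" if "f \<in> ?D" "g \<in> ?D" for f g
    using fk[OF that(1)] fk[OF that(2)] xc by (auto simp: mult_cyclic_power e_def)
  have hom: "\<psi> \<in> hom (cyclic_power 2 (Suc k)) K"
  proof (rule homI)
    fix f assume "f \<in> ?D"
    then show "\<psi> f \<in> carrier K" using \<phi>c rC ec by (simp add: \<psi>_def)
  next
    fix f g assume fg: "f \<in> ?D" "g \<in> ?D"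
    have "\<psi> (f \<otimes>\<^bsub>cyclic_power 2 (Suc k)\<^esub> g) = (\<phi> (r f) \<otimes>\<^bsub>K\<^esub> \<phi> (r g)) \<otimes>\<^bsub>K\<^esub> (e (f k) \<otimes>\<^bsub>K\<^esub> e (g k))"
      unfolding \<psi>_def rm em[OF fg] hom_mult[OF \<phi>(1) rC[OF fg(1)] rC[OF fg(2)]] ..
    also have "\<dots> = \<psi> f \<otimes>\<^bsub>K\<^esub> \<psi> g"
      unfolding \<psi>_def using \<phi>c rC fg ec by (simp add: m_ac)
    finally show "\<psi> (f \<otimes>\<^bsub>cyclic_power 2 (Suc k)\<^esub> g) = \<psi> f \<otimes>\<^bsub>K\<^esub> \<psi> g" .
  qed
  \<comment> \<open>Two arguments differing in the new coordinate cannot collide: \<open>x\<close>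
    would be a product of two elements of the old image and so lie in it.\<close>
  have key: False if fg: "f \<in> ?D" "g \<in> ?D" "\<psi> f = \<psi> g" "f k = 1" "g k = 0" for f g
  proof -
    have c: "\<phi> (r f) \<in> carrier K" "\<phi> (r g) \<in> carrier K" using \<phi>c rC fg by auto
    have "\<phi> (r f) \<otimes>\<^bsub>K\<^esub> x = \<phi> (r g)" using fg(3-5) c xc by (simp add: \<psi>_def e_def)
    then have "\<phi> (r f) \<otimes>\<^bsub>K\<^esub> (\<phi> (r f) \<otimes>\<^bsub>K\<^esub> x) = \<phi> (r f) \<otimes>\<^bsub>K\<^esub> \<phi> (r g)" by simp
    then have "x = \<phi> (r f) \<otimes>\<^bsub>K\<^esub> \<phi> (r g)"
      using c xc \<phi>2[OF rC[OF fg(1)]] by (simp flip: m_assoc)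
    also have "\<dots> = \<phi> (r f \<otimes>\<^bsub>cyclic_power 2 k\<^esub> r g)" using hom_mult[OF \<phi>(1) rC[OF fg(1)] rC[OF fg(2)]] by simp
    also have "\<dots> \<in> \<phi> ` ?C"
      using rC[OF fg(1)] rC[OF fg(2)] group.is_monoid[OF group_cyclic_power, of k] by (intro imageI monoid.m_closed)
    finally show False using x(2) by simp
  qed
  have inj: "inj_on \<psi> ?D"
  proof (rule inj_onI)
    fix f g assume fg: "f \<in> ?D" "g \<in> ?D" "\<psi> f = \<psi> g"
    have eqk: "f k = g k" using key[OF fg] key[OF fg(2,1) fg(3)[symmetric]] fk[OF fg(1)] fk[OF fg(2)] by auto
    have c: "\<phi> (r f) \<in> carrier K" "\<phi> (r g) \<in> carrier K" using \<phi>c rC fg by auto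
    have "\<phi> (r f) = \<phi> (r g)" using fg(3) eqk c ec by (simp add: \<psi>_def)
    then have "r f = r g" using inj_onD[OF \<phi>(2)] rC fg by blast
    show "f = g"
    proof (rule PiE_ext)
      show "f \<in> (\<Pi>\<^sub>E i\<in>{..<Suc k}. {0..<2})" "g \<in> (\<Pi>\<^sub>E i\<in>{..<Suc k}. {0..<2})"
        using fg by (auto simp: carrier_cyclic_power)
      fix i assume "i \<in> {..<Suc k}"
      then consider "i < k" | "i = k" by fastforce
      then show "f i = g i"
      proof cases
        case 1
        then show ?thesis using fun_cong[OF \<open>r f = r g\<close>, of i] by (simp add: r_def)
      qed (use eqk in simp)
    qed
  qed
  have "\<psi> f \<in> involutions K" if f: "f \<in> ?D" for f
  proof -
    have "\<psi> f \<otimes>\<^bsub>K\<^esub> \<psi> f = (\<phi> (r f) \<otimes>\<^bsub>K\<^esub> \<phi> (r f)) \<otimes>\<^bsub>K\<^esub> (e (f k) \<otimes>\<^bsub>K\<^esub> e (f k))"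
      unfolding \<psi>_def using \<phi>c rC f ec by (simp add: m_ac)
    also have "\<dots> = \<one>\<^bsub>K\<^esub>" using \<phi>2[OF rC[OF f]] xc by (simp add: e_def)
    finally show ?thesis using \<phi>c rC f ec by (simp add: involutions_def \<psi>_def)
  qed
  then show ?case using hom inj by (intro exI[of _ \<psi>]) auto
qed

text \<open>Counting the 2-torsion replaces the structure theorem for finite abelian groups.\<close>

lemma embeds_cyclic_power_iff:
  assumes K: "comm_group K" "finite (carrier K)"
  shows "embeds_in (cyclic_power 2 k) K \<longleftrightarrow> 2 ^ k \<le> card (involutions K)"
proof
  show "2 ^ k \<le> card (involutions K)" if "embeds_in (cyclic_power 2 k) K"
    using embeds_imp_card_involutions[OF comm_group.axioms(2)[OF K(1)] K(2) that] .
next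
  interpret comm_group K by (rule K(1))
  assume "2 ^ k \<le> card (involutions K)"
  then obtain \<phi> where \<phi>: "\<phi> \<in> hom (cyclic_power 2 k) K" "inj_on \<phi> (carrier (cyclic_power 2 k))"
    using cyclic_power_hom_ex[OF K] by blast
  let ?H = "\<phi> ` carrier (cyclic_power 2 k)"
  interpret h: group_hom "cyclic_power 2 k" K \<phi>
    by (intro group_hom.intro group_cyclic_power group_axioms group_hom_axioms.intro \<phi>(1))
  have "subgroup ?H K" by (rule h.img_is_subgroup)
  moreover have "\<phi> \<in> iso (cyclic_power 2 k) (K\<lparr>carrier := ?H\<rparr>)"
    using \<phi> by (auto simp: iso_def hom_def bij_betw_def)
  ultimately show "embeds_in (cyclic_power 2 k) K"
    unfolding embeds_in_def is_iso_def by blast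
qed

section \<open>Square roots of unity modulo n\<close>

text \<open>Solutions are represented by least nonnegative residues. For \<open>n = 1\<close> the
  residue 0 qualifies, as all integers are congruent modulo 1.\<close>

definition sqrt_ones :: "int \<Rightarrow> int set" where
  "sqrt_ones n = {a \<in> {0..<n}. [a * a = 1] (mod n)}"

lemma finite_sqrt_ones [simp]: "finite (sqrt_ones n)"
  by (rule finite_subset[of _ "{0..<n}"]) (auto simp: sqrt_ones_def)

lemma ZMod_ring_hom: "ZMod n \<in> ring_hom \<Z> (ZFact n)"
proof -
  have "ideal (Idl\<^bsub>\<Z>\<^esub> {n}) \<Z>" by (rule int.genideal_ideal) simp
  from ideal.rcos_ring_hom[OF this] show ?thesis
    unfolding ZFact_def by (simp add: ZMod_def[abs_def])
qed

lemma ZMod_mult: "ZMod n a \<otimes>\<^bsub>ZFact n\<^esub> ZMod n b = ZMod n (a * b)"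
  using ring_hom_mult[OF ZMod_ring_hom, of a b n] by simp

lemma ZMod_one: "\<one>\<^bsub>ZFact n\<^esub> = ZMod n 1"
  using ring_hom_one[OF ZMod_ring_hom, of n] by simp

lemma carrier_ZFact: "n > 0 \<Longrightarrow> carrier (ZFact n) = ZMod n ` {0..<n}"
proof -
  assume n: "n > 0"
  have "carrier (ZFact n) = range (ZMod n)"
    by (auto simp: ZFact_def FactRing_def A_RCOSETS_def' ZMod_def)
  also have "\<dots> = ZMod n ` {0..<n}"
  proof
    show "range (ZMod n) \<subseteq> ZMod n ` {0..<n}"
    proof
      fix y assume "y \<in> range (ZMod n)"
      then obtain a where "y = ZMod n a" by blast
      then have "y = ZMod n (a mod n)" using ZMod_mod[of n a] by simp
      then show "y \<in> ZMod n ` {0..<n}" using n by auto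
    qed
  qed auto
  finally show ?thesis .
qed

lemma inj_on_ZMod: "inj_on (ZMod n) {0..<n}"
  by (rule inj_onI) (auto simp: ZMod_eq_mod)

lemma comm_group_unit_group_mod: "comm_group (unit_group_mod n)"
proof -
  interpret cring "ZFact (int n)" by (rule ZFact_is_cring)
  show ?thesis unfolding unit_group_mod_def by (rule units_comm_group)
qed

lemma finite_unit_group_mod: "n > 0 \<Longrightarrow> finite (carrier (unit_group_mod n))"
  by (rule finite_subset[of _ "carrier (ZFact (int n))"])
     (auto simp: unit_group_mod_def units_of_def Units_def carrier_ZFact)

text \<open>A square root of 1 is its own inverse and hence automatically a unit, so it suffices to
  count residues.\<close>

lemma card_involutions_unit_group_mod:
  assumes n: "n > 0"
  shows "card (involutions (unit_group_mod n)) = card (sqrt_ones (int n))"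
proof -
  interpret cring "ZFact (int n)" by (rule ZFact_is_cring)
  have n': "int n > 0" using n by simp
  have "involutions (unit_group_mod n) = {x \<in> carrier (ZFact (int n)). x \<otimes>\<^bsub>ZFact (int n)\<^esub> x = \<one>\<^bsub>ZFact (int n)\<^esub>}"
    by (auto simp: involutions_def unit_group_mod_def units_of_def Units_def)
  also have "\<dots> = ZMod (int n) ` sqrt_ones (int n)"
  proof -
    have eqv: "ZMod (int n) (a * a) = ZMod (int n) 1 \<longleftrightarrow> [a * a = 1] (mod (int n))" for a
      by (simp only: ZMod_eq_mod cong_def)
    have "{x \<in> f ` A. P x} = f ` {a \<in> A. P (f a)}" for f :: "int \<Rightarrow> int set" and A P by blast
    then show ?thesis unfolding carrier_ZFact[OF n'] ZMod_one sqrt_ones_def ZMod_mult eqv by (simp only: ZMod_mult eqv)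
  qed
  also have "card \<dots> = card (sqrt_ones (int n))"
    by (rule card_image, rule inj_on_subset[OF inj_on_ZMod]) (auto simp: sqrt_ones_def)
  finally show ?thesis .
qed

text \<open>The Chinese remainder theorem: being a square root of 1 modulo \<open>m * n\<close> is
  the same as being one modulo both factors.\<close>

lemma card_sqrt_ones_mult:
  assumes mn: "m > 0" "n > 0" "coprime m n"
  shows "card (sqrt_ones (m * n)) = card (sqrt_ones m) * card (sqrt_ones n)"
proof -
  define f where "f = (\<lambda>a. (a mod m, a mod n))"
  have "bij_betw f (sqrt_ones (m * n)) (sqrt_ones m \<times> sqrt_ones n)"
    unfolding bij_betw_def
  proof
    show "inj_on f (sqrt_ones (m * n))"
    proof (rule inj_onI)
      fix a b assume ab: "a \<in> sqrt_ones (m * n)" "b \<in> sqrt_ones (m * n)" "f a = f b"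
      then have "[a = b] (mod m)" "[a = b] (mod n)" by (auto simp: f_def cong_def)
      then have "[a = b] (mod (m * n))" using mn(3) by (rule coprime_cong_mult)
      then show "a = b" using ab by (auto simp: sqrt_ones_def cong_def)
    qed
    show "f ` sqrt_ones (m * n) = sqrt_ones m \<times> sqrt_ones n"
    proof
      show "f ` sqrt_ones (m * n) \<subseteq> sqrt_ones m \<times> sqrt_ones n"
      proof
        fix y assume "y \<in> f ` sqrt_ones (m * n)"
        then obtain a where a: "a \<in> sqrt_ones (m * n)" "y = f a" by blast
        then have "[a * a = 1] (mod (m * n))" by (simp add: sqrt_ones_def)
        then have "[a * a = 1] (mod m)" "[a * a = 1] (mod n)"
          by (auto elim: cong_dvd_modulus)
        then have "[(a mod m) * (a mod m) = 1] (mod m)" "[(a mod n) * (a mod n) = 1] (mod n)"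
          unfolding cong_def by (simp_all add: mod_mult_eq)
        then show "y \<in> sqrt_ones m \<times> sqrt_ones n" using mn a(2) by (simp add: f_def sqrt_ones_def)
      qed
      show "sqrt_ones m \<times> sqrt_ones n \<subseteq> f ` sqrt_ones (m * n)"
      proof clarify
        fix u v assume u: "u \<in> sqrt_ones m" and v: "v \<in> sqrt_ones n"
        obtain x where x: "[x = u] (mod m)" "[x = v] (mod n)"
          using binary_chinese_remainder_int[OF mn(3)] by blast
        define a where "a = x mod (m * n)"
        have am: "[a = x] (mod m)" "[a = x] (mod n)"
          by (simp_all add: a_def cong_def mod_mod_cancel)
        have a1: "[a = u] (mod m)" "[a = v] (mod n)" using am x cong_trans by blast+
        have "[a * a = u * u] (mod m)" "[a * a = v * v] (mod n)" using a1 by (auto intro: cong_mult)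
        then have "[a * a = 1] (mod m)" "[a * a = 1] (mod n)"
          using u v cong_trans unfolding sqrt_ones_def by blast+
        then have "[a * a = 1] (mod (m * n))" using mn(3) by (rule coprime_cong_mult)
        then have "a \<in> sqrt_ones (m * n)" using mn by (simp add: sqrt_ones_def a_def)
        moreover have "f a = (u, v)" using a1 u v by (auto simp: f_def cong_def sqrt_ones_def)
        ultimately show "(u, v) \<in> f ` sqrt_ones (m * n)" by (metis image_eqI)
      qed
    qed
  qed
  then show ?thesis by (simp add: bij_betw_same_card card_cartesian_product)
qed

lemma sqrt_ones_1: "card (sqrt_ones 1) = 1"
proof -
  have "sqrt_ones 1 = {0}" by (auto simp: sqrt_ones_def)
  then show ?thesis by simp
qed

lemma cong_square_1_iff: "[a * a = 1] (mod n) \<longleftrightarrow> n dvd (a - 1) * (a + 1)" for a n :: int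
  by (simp add: cong_iff_dvd_diff algebra_simps)

lemma dvd_range_eq: "(n::int) dvd a - c \<Longrightarrow> 0 \<le> a \<Longrightarrow> a < n \<Longrightarrow> 0 \<le> c \<Longrightarrow> c < n \<Longrightarrow> a = c"
  by (metis cong_iff_dvd_diff cong_less_imp_eq_int)

text \<open>An odd prime cannot divide both \<open>a - 1\<close> and \<open>a + 1\<close>, whose
  difference is 2. So the whole prime power divides one of them.\<close>

lemma card_sqrt_ones_prime_power:
  assumes p: "prime (p::nat)" "odd p" and e: "e \<ge> 1"
  shows "card (sqrt_ones (int (p ^ e))) = 2"
proof -
  define q where "q = int (p ^ e)"
  have p3: "p \<ge> 3" using p prime_ge_2_nat[of p] by (cases "p = 2") auto
  have "p ^ 1 \<le> p ^ e" using p3 e by (intro power_increasing) auto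
  then have "3 \<le> p ^ e" using p3 by simp
  then have "int 3 \<le> int (p ^ e)" by (simp only: of_nat_le_iff)
  then have q3: "q \<ge> 3" by (simp add: q_def)
  have "sqrt_ones q = {1, q - 1}"
  proof (intro equalityI subsetI)
    fix a assume "a \<in> sqrt_ones q"
    then have a: "0 \<le> a" "a < q" "q dvd (a - 1) * (a + 1)" by (auto simp: sqrt_ones_def cong_square_1_iff)
    have pi: "prime (int p)" using p by simp
    have qp: "q = int p ^ e" by (simp add: q_def)
    show "a \<in> {1, q - 1}"
    proof (cases "int p dvd a - 1")
      case False
      then have "coprime q (a - 1)" unfolding qp using pi by (simp add: prime_imp_coprime coprime_power_left_iff)
      then have "q dvd a + 1" using a(3) by (simp add: coprime_dvd_mult_right_iff)
      then have "q dvd a - (q - 1)" by (simp add: algebra_simps)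
      then have "a = q - 1" by (rule dvd_range_eq) (use a q3 in auto)
      then show ?thesis by simp
    next
      case True
      have "\<not> int p dvd a + 1"
      proof
        assume "int p dvd a + 1"
        then have "int p dvd (a + 1) - (a - 1)" using True by (rule dvd_diff)
        then have "int p dvd 2" by simp
        then show False using p3 zdvd_imp_le by fastforce
      qed
      then have "coprime q (a + 1)" unfolding qp using pi by (simp add: prime_imp_coprime coprime_power_left_iff)
      then have "q dvd a - 1" using a(3) by (simp add: coprime_dvd_mult_left_iff)
      then have "a = 1" by (rule dvd_range_eq) (use a q3 in auto)
      then show ?thesis by simp
    qed
  next
    fix a assume "a \<in> {1, q - 1}"
    then show "a \<in> sqrt_ones q" using q3 by (auto simp: sqrt_ones_def cong_square_1_iff)
  qed
  then have "card (sqrt_ones q) = 2" using q3 by simp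
  then show ?thesis unfolding q_def .
qed

lemma sqrt_ones_2: "card (sqrt_ones 2) = 1"
proof -
  have "{0..<2::int} = {0, 1}" by auto
  then have "sqrt_ones 2 = {1}" by (auto simp: sqrt_ones_def cong_def)
  then show ?thesis by simp
qed

lemma sqrt_ones_4: "card (sqrt_ones 4) = 2"
proof -
  have "{0..<4::int} = {0, 1, 2, 3}" by auto
  then have "sqrt_ones 4 = {1, 3}" by (auto simp: sqrt_ones_def cong_def)
  then show ?thesis by simp
qed

text \<open>For \<open>a = 2 * b + 1\<close> the condition becomes \<open>g dvd b * (b + 1)\<close>
  with \<open>g = 2 ^ (e - 2)\<close>. One of the two consecutive factors is odd, so
  \<open>g\<close> divides the other. Since \<open>0 \<le> b < 2 * g\<close>, each alternative
  leaves two values of \<open>b\<close>, and \<open>e \<ge> 3\<close> keeps all four roots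
  distinct.\<close>

lemma sqrt_ones_2_power:
  assumes e: "e \<ge> 3"
  shows "card (sqrt_ones (2 ^ e)) = 4"
proof -
  define h where "h = (2::int) ^ (e - 1)"
  define g where "g = (2::int) ^ (e - 2)"
  have eq: "(2::int) ^ e = 2 * h" "h = 2 * g" "2 dvd g"
  proof -
    show "(2::int) ^ e = 2 * h" unfolding h_def using e by (cases e) auto
    have "e - 1 = Suc (e - 2)" using e by simp
    then show "h = 2 * g" by (simp add: h_def g_def)
    show "2 dvd g" unfolding g_def using e by simp
  qed
  have g2: "g \<ge> 2" using eq(3) zero_less_power[of "2::int" "e - 2"] unfolding g_def[symmetric] by (intro zdvd_imp_le) auto
  have "sqrt_ones (2 * h) = {1, h - 1, h + 1, 2 * h - 1}"
  proof (intro equalityI subsetI)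
    fix a assume "a \<in> sqrt_ones (2 * h)"
    then have a: "0 \<le> a" "a < 2 * h" "2 * h dvd (a - 1) * (a + 1)" by (auto simp: sqrt_ones_def cong_square_1_iff)
    have "even ((a - 1) * (a + 1))" using a(3) dvd_mult_left by blast
    then have "odd a" by auto
    then obtain b where b: "a = 2 * b + 1" by (rule oddE)
    have "(a - 1) * (a + 1) = 2 * (2 * (b * (b + 1)))" by (simp add: b algebra_simps)
    then have "h dvd 2 * (b * (b + 1))" using a(3) by (simp only: dvd_times_left_cancel_iff[of "2::int"])
    then have gb: "g dvd b * (b + 1)" unfolding eq(2) by simp
    have bb: "0 \<le> b" "b < h" using a b by auto
    have "g dvd b \<or> g dvd b + 1"
    proof (cases "even b")
      case True
      then have "coprime g (b + 1)" unfolding g_def by (simp add: coprime_power_left_iff)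
      then show ?thesis using gb by (simp add: coprime_dvd_mult_left_iff)
    next
      case False
      then have "coprime g b" unfolding g_def by (simp add: coprime_power_left_iff)
      then show ?thesis using gb by (simp add: coprime_dvd_mult_right_iff)
    qed
    then show "a \<in> {1, h - 1, h + 1, 2 * h - 1}"
    proof
      assume "g dvd b"
      then obtain c where c: "b = g * c" by blast
      have "0 \<le> c" using bb g2 c by (simp add: zero_le_mult_iff)
      moreover have "c < 2" using bb g2 c eq(2) by (simp add: mult.commute[of 2])
      ultimately have "c = 0 \<or> c = 1" by linarith
      then show ?thesis using b c eq(2) by auto
    next
      assume "g dvd b + 1"
      then obtain c where c: "b + 1 = g * c" by blast
      have "0 < g * c" using bb c by linarith
      then have "0 < c" using g2 by (simp add: zero_less_mult_iff)
      moreover have "g * c \<le> g * 2" using bb c eq(2) by linarith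
      then have "c \<le> 2" using g2 by simp
      ultimately have "c = 1 \<or> c = 2" by linarith
      then show ?thesis using b c eq(2) by auto
    qed
  next
    fix a assume a: "a \<in> {1, h - 1, h + 1, 2 * h - 1}"
    have hh: "2 * h dvd h * (h - 2)" "2 * h dvd h * (h + 2)"
      using eq(2) by (auto simp: mult.commute[of 2])
    have "2 * h dvd (a - 1) * (a + 1)"
    proof -
      have "(h - 1 - 1) * (h - 1 + 1) = h * (h - 2)" "(h + 1 - 1) * (h + 1 + 1) = h * (h + 2)"
        "(2 * h - 1 - 1) * (2 * h - 1 + 1) = 2 * h * (2 * h - 2)" by (simp_all add: algebra_simps)
      then show ?thesis using a hh by (elim insertE emptyE) auto
    qed
    then show "a \<in> sqrt_ones (2 * h)" using a g2 eq(2) by (auto simp: sqrt_ones_def cong_square_1_iff)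
  qed
  moreover have "card {1, h - 1, h + 1, 2 * h - 1} = 4" using g2 eq(2) by auto
  ultimately show ?thesis unfolding eq(1) by simp
qed

lemma prime_power_split:
  fixes n p :: nat
  assumes "n > 0" "prime p" "p dvd n"
  obtains e m where "n = p ^ e * m" "e \<ge> 1" "m > 0" "\<not> p dvd m" "prime_factors n = insert p (prime_factors m)" "p \<notin> prime_factors m"
proof -
  have nu: "\<not> is_unit p" using prime_gt_1_nat[OF assms(2)] by auto
  obtain m where m: "n = p ^ multiplicity p n * m" "\<not> p dvd m"
    using multiplicity_decompose'[OF _ nu, of n] assms(1) by (metis mult.commute neq0_conv)
  have e: "multiplicity p n \<ge> 1" proof -
    have "p \<in> prime_factors n" using assms by (simp add: in_prime_factors_iff)
    then show ?thesis unfolding prime_factors_multiplicity by simp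
  qed
  have m0: "m > 0" using m(1) assms(1) by (cases m) auto
  have p0: "p > 0" using assms(2) prime_gt_0_nat by blast
  have "prime_factors n = prime_factors (p ^ multiplicity p n * m)" using m(1) by simp
  also have "\<dots> = prime_factors (p ^ multiplicity p n) \<union> prime_factors m"
    using m0 p0 by (intro prime_factors_product) auto
  also have "prime_factors (p ^ multiplicity p n) = {p}" using assms(2) e by (simp add: prime_factors_power prime_prime_factors)
  finally have "prime_factors n = insert p (prime_factors m)" by simp
  moreover have "p \<notin> prime_factors m" using m(2) by (auto simp: in_prime_factors_iff)
  ultimately show thesis using that[OF m(1) e m0 m(2)] by blast
qed

lemma card_sqrt_ones_odd: "m > 0 \<Longrightarrow> odd m \<Longrightarrow> card (sqrt_ones (int m)) = 2 ^ card (prime_factors m)"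
proof (induction m rule: less_induct)
  case (less n)
  show ?case
  proof (cases "n = 1")
    case True
    then show ?thesis by (simp add: sqrt_ones_1)
  next
    case False
    then obtain p where p: "prime p" "p dvd n" using prime_factor_nat by blast
    obtain e m where m: "n = p ^ e * m" "e \<ge> 1" "m > 0" "\<not> p dvd m" "prime_factors n = insert p (prime_factors m)" "p \<notin> prime_factors m"
      by (rule prime_power_split[OF less.prems(1) p])
    have "1 < p ^ e" using prime_gt_1_nat[OF p(1)] m(2) by (intro one_less_power) auto
    then have "1 * m < p ^ e * m" using m(3) by (intro mult_strict_right_mono) auto
    then have mn: "m < n" using m(1) by simp
    have om: "odd m" and op: "odd p" using less.prems(2) m(1,2) by auto
    have "coprime (p ^ e) m" using p(1) m(4) by (simp add: prime_imp_coprime coprime_power_left_iff)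
    then have cop: "coprime (int (p ^ e)) (int m)" by (simp only: coprime_int_iff)
    have "int n = int (p ^ e) * int m" using m(1) by simp
    then have "card (sqrt_ones (int n)) = card (sqrt_ones (int (p ^ e))) * card (sqrt_ones (int m))"
      using card_sqrt_ones_mult[OF _ _ cop] prime_gt_0_nat[OF p(1)] m(3) by simp
    also have "\<dots> = 2 * 2 ^ card (prime_factors m)"
      using card_sqrt_ones_prime_power[OF p(1) op m(2)] less.IH[OF mn m(3) om] by simp
    finally show ?thesis using m(5,6) by simp
  qed
qed

text \<open>The 2-rank of the unit group modulo \<open>2 ^ a\<close>.\<close>

definition two_rank :: "nat \<Rightarrow> nat" where "two_rank a = (if a \<le> 1 then 0 else if a = 2 then 1 else 2)"

lemma card_sqrt_ones_two_power: "card (sqrt_ones (2 ^ a)) = 2 ^ two_rank a"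
proof -
  consider "a = 0" | "a = 1" | "a = 2" | "a \<ge> 3" by linarith
  then show ?thesis
    by cases (auto simp: two_rank_def sqrt_ones_1 sqrt_ones_2 sqrt_ones_4 sqrt_ones_2_power)
qed

theorem embeds_cyclic_power_unit_group_iff:
  assumes m: "m > 0" "odd m"
  shows "embeds_in (cyclic_power 2 k) (unit_group_mod (2 ^ a * m)) \<longleftrightarrow> k \<le> card (prime_factors m) + two_rank a"
proof -
  have n: "2 ^ a * m > 0" using m by simp
  have cop: "coprime (2 ^ a :: int) (int m)" using m by (simp add: coprime_power_left_iff)
  have "card (sqrt_ones (int (2 ^ a * m))) = card (sqrt_ones (2 ^ a)) * card (sqrt_ones (int m))"
    using card_sqrt_ones_mult[OF _ _ cop] m by simp
  also have "\<dots> = 2 ^ (card (prime_factors m) + two_rank a)"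
    using card_sqrt_ones_odd[OF m] card_sqrt_ones_two_power[of a] by (simp add: power_add)
  finally show ?thesis
    using embeds_cyclic_power_iff[OF comm_group_unit_group_mod finite_unit_group_mod[OF n], of k]
      card_involutions_unit_group_mod[OF n] by simp
qed

section \<open>The counting function\<close>

definition main_term :: "nat \<Rightarrow> real \<Rightarrow> real" where "main_term i x = x * ln (ln x) ^ i / ln x"

text \<open>With \<open>i + 2\<close> factors, an embedding fails iff the number of odd primes plus
  the rank at 2 is at most \<open>i + 1\<close>. Exponents 0 and 1 of the prime 2 have rank 0 and
  give \<open>A0\<close> and \<open>A1\<close>, the numbers counted by \<open>M\<close>. From
  exponent 2 on the rank is at least 1, so at most \<open>i\<close> odd primes remain and the number
  lies in \<open>R\<close>.\<close>

lemma count_bounds: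
  fixes i x
  assumes x: "x \<ge> 2"
  defines "N \<equiv> S x (cyclic_power 2 (Suc (Suc i)))"
  defines "M \<equiv> card (few_primes (Suc i) x) + card (few_primes (Suc i) (x / 2))"
  shows "M \<le> N" "N \<le> M + (\<Sum>(p,e)\<in>bad_pairs x. card (few_primes i (x / real p ^ e)))"
proof -
  define SS where "SS = {n. 0 < n \<and> real n \<le> x \<and> \<not> embeds_in (cyclic_power 2 (Suc (Suc i))) (unit_group_mod n)}"
  have N: "N = card SS" by (simp add: N_def S_def SS_def)
  have finSS: "finite SS" by (rule finite_subset[OF _ finite_nats_upto[of x]]) (auto simp: SS_def nats_upto_def)
  have SS_iff: "2 ^ a * m \<in> SS \<longleftrightarrow> real (2 ^ a * m) \<le> x \<and> card (prime_factors m) + two_rank a \<le> Suc i"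
    if "m > 0" "odd m" for a m
    using embeds_cyclic_power_unit_group_iff[OF that, of "Suc (Suc i)" a] that(1) by (auto simp: SS_def)
  define A0 where "A0 = few_primes (Suc i) x"
  define A1 where "A1 = (\<lambda>m. 2 * m) ` few_primes (Suc i) (x / 2)"
  define R where "R = (\<Union>(p,e)\<in>bad_pairs x. (\<lambda>m. p ^ e * m) ` few_primes i (x / real p ^ e))"
  have fin: "finite A0" "finite A1" "finite R" by (auto simp: A0_def A1_def R_def)
  have c1: "card A1 = card (few_primes (Suc i) (x / 2))" unfolding A1_def by (rule card_image) (auto simp: inj_on_def)
  have "A0 \<inter> A1 = {}" by (auto simp: A0_def A1_def few_primes_def)
  then have c: "card (A0 \<union> A1) = M" using fin c1 by (simp add: card_Un_disjoint M_def A0_def)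
  have "A0 \<subseteq> SS"
  proof
    fix n assume n: "n \<in> A0"
    then show "n \<in> SS" using SS_iff[of n 0] by (simp add: A0_def few_primes_def nats_upto_def two_rank_def)
  qed
  moreover have "A1 \<subseteq> SS"
  proof
    fix n assume "n \<in> A1"
    then obtain m where m: "n = 2 * m" "m \<in> few_primes (Suc i) (x / 2)" by (auto simp: A1_def)
    then show "n \<in> SS" using SS_iff[of m 1] by (simp add: few_primes_def nats_upto_def two_rank_def)
  qed
  ultimately have "card (A0 \<union> A1) \<le> card SS" using finSS by (intro card_mono) auto
  then show "M \<le> N" using c N by simp
  have "SS \<subseteq> A0 \<union> A1 \<union> R"
  proof
    fix n assume n: "n \<in> SS"
    then have n0: "n > 0" "real n \<le> x" by (auto simp: SS_def)
    define a where "a = multiplicity 2 n"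
    obtain m where m: "n = 2 ^ a * m" "odd m"
      using multiplicity_decompose'[of n 2] n0(1) unfolding a_def by (metis is_unit_mult_iff mult.commute neq0_conv nat_dvd_1_iff_1 numeral_eq_one_iff semiring_norm(85))
    have m0: "m > 0" using m(1) n0(1) by (cases m) auto
    have w: "card (prime_factors m) + two_rank a \<le> Suc i" using SS_iff[OF m0 m(2), of a] n m(1) by simp
    have mx: "2 ^ a * real m \<le> x" using n0(2) m(1) by simp
    consider "a = 0" | "a = 1" | "a \<ge> 2" by linarith
    then show "n \<in> A0 \<union> A1 \<union> R"
    proof cases
      case 1
      then have "n \<in> A0" using m m0 mx w by (simp add: A0_def few_primes_def nats_upto_def two_rank_def)
      then show ?thesis by simp
    next
      case 2
      then have "m \<in> few_primes (Suc i) (x / 2)" using m m0 mx w by (simp add: few_primes_def nats_upto_def two_rank_def)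
      then have "n \<in> A1" using m(1) 2 by (simp add: A1_def)
      then show ?thesis by simp
    next
      case 3
      then have "two_rank a \<ge> 1" by (simp add: two_rank_def)
      then have "card (prime_factors m) \<le> i" using w by linarith
      moreover have "real m \<le> x / real 2 ^ a" using mx by (simp add: pos_le_divide_eq mult.commute)
      ultimately have mM: "m \<in> few_primes i (x / real 2 ^ a)" using m m0 by (simp add: few_primes_def nats_upto_def)
      have "2 ^ a * 1 \<le> 2 ^ a * real m" using m0 by (intro mult_left_mono) auto
      then have "2 ^ a \<le> x" using mx by linarith
      then have b: "(2, a) \<in> bad_pairs x" using 3 by (simp add: bad_pairs_def)
      have "n \<in> R" unfolding R_def using b mM m(1) by (intro UN_I[OF b]) auto
      then show ?thesis by simp
    qed
  qed
  then have "card SS \<le> card (A0 \<union> A1 \<union> R)" using fin by (intro card_mono) auto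
  also have "\<dots> \<le> card (A0 \<union> A1) + card R" by (rule card_Un_le)
  also have "card R \<le> (\<Sum>(p,e)\<in>bad_pairs x. card (few_primes i (x / real p ^ e)))"
  proof -
    have "card R \<le> (\<Sum>a\<in>bad_pairs x. card (case a of (p,e) \<Rightarrow> (\<lambda>m. p ^ e * m) ` few_primes i (x / real p ^ e)))"
      unfolding R_def by (rule card_UN_le) simp
    also have "\<dots> \<le> (\<Sum>(p,e)\<in>bad_pairs x. card (few_primes i (x / real p ^ e)))"
      by (intro sum_mono) (auto intro: card_image_le)
    finally show ?thesis .
  qed
  finally show "N \<le> M + (\<Sum>(p,e)\<in>bad_pairs x. card (few_primes i (x / real p ^ e)))" using c N by simp
qed

lemma count_uniform:
  "\<exists>B>0. \<forall>x\<ge>2. \<bar>real (S x (cyclic_power 2 (Suc (Suc i)))) - (error_scale (Suc i) x + error_scale (Suc i) (x / 2)) / fact i\<bar> \<le> B * error_scale i x"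
proof -
  obtain K where K: "K > 0" "\<And>x. x \<ge> 1 \<Longrightarrow> real (card (few_primes i x)) \<le> K * error_scale i x" using M_upper by blast
  have K0: "K \<ge> 0" using K(1) by simp
  obtain W where W: "W > 0" "\<And>x. x \<ge> 1 \<Longrightarrow> (\<Sum>(p,e)\<in>bad_pairs x. real (card (few_primes i (x / real p ^ e)))) \<le> W * error_scale i x"
    using bad_sum_bound[OF K0 K(2)] by blast
  obtain B where B: "B > 0" "\<And>x. x \<ge> 1 \<Longrightarrow> \<bar>real (card (few_primes (Suc i) x)) - error_scale (Suc i) x / fact i\<bar> \<le> B * error_scale i x"
    using M_asymp by blast
  have "\<bar>real (S x (cyclic_power 2 (Suc (Suc i)))) - (error_scale (Suc i) x + error_scale (Suc i) (x / 2)) / fact i\<bar> \<le> (W + B + 2 * B) * error_scale i x"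
    if x: "x \<ge> 2" for x
  proof -
    define N where "N = real (S x (cyclic_power 2 (Suc (Suc i))))"
    have E0: "error_scale i x > 0" using error_scale_pos[of x i] x by simp
    \<comment> \<open>\<open>error_scale_quot\<close> at \<open>q = 2\<close> moves the error from
      \<open>x / 2\<close> back to \<open>x\<close>; its factor \<open>(1 + ln 2)^2 / 2\<close> is
      at most 2.\<close>
    have "(1 + ln 2)\<^sup>2 \<le> (2::real)\<^sup>2" using ln_le_minus_one[of "2::real"] by (intro power_mono) auto
    then have "error_scale i x * ((1 + ln 2)\<^sup>2 / 2) \<le> error_scale i x * 2" using E0 by (intro mult_left_mono) auto
    then have "error_scale i (x / 2) \<le> 2 * error_scale i x" using error_scale_quot[of 2 x i] x by simp
    then have "B * error_scale i (x / 2) \<le> B * (2 * error_scale i x)" using B(1) by (intro mult_left_mono) auto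
    then have b: "\<bar>real (card (few_primes (Suc i) (x / 2))) - error_scale (Suc i) (x / 2) / fact i\<bar> \<le> 2 * B * error_scale i x"
      using B(2)[of "x / 2"] x by simp
    have a: "\<bar>real (card (few_primes (Suc i) x)) - error_scale (Suc i) x / fact i\<bar> \<le> B * error_scale i x" using B(2)[of x] x by simp
    have n1: "real (card (few_primes (Suc i) x)) + real (card (few_primes (Suc i) (x / 2))) \<le> N"
      using count_bounds(1)[OF x, of i] unfolding N_def by linarith
    have "N \<le> real (card (few_primes (Suc i) x) + card (few_primes (Suc i) (x / 2)) + (\<Sum>(p,e)\<in>bad_pairs x. card (few_primes i (x / real p ^ e))))"
      unfolding N_def of_nat_le_iff by (rule count_bounds(2)[OF x])
    also have "\<dots> = real (card (few_primes (Suc i) x)) + real (card (few_primes (Suc i) (x / 2))) + (\<Sum>(p,e)\<in>bad_pairs x. real (card (few_primes i (x / real p ^ e))))"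
      by (simp add: case_prod_unfold)
    also have "\<dots> \<le> real (card (few_primes (Suc i) x)) + real (card (few_primes (Suc i) (x / 2))) + W * error_scale i x"
      using W(2)[of x] x by simp
    finally have n2: "N \<le> real (card (few_primes (Suc i) x)) + real (card (few_primes (Suc i) (x / 2))) + W * error_scale i x" .
    have w0: "W * error_scale i x \<ge> 0" using W(1) E0 by simp
    show ?thesis unfolding N_def[symmetric] using n1 n2 a b w0
      unfolding add_divide_distrib distrib_right by linarith
  qed
  then show ?thesis using W(1) B(1) by (intro exI[of _ "W + B + 2 * B"]) auto
qed

text \<open>Replacing the shifted logarithms by \<open>ln x\<close> and \<open>ln (ln x)\<close>
  stays within the error. The term at \<open>x / 2\<close> contributes half of the main term, so the
  densities add up to 3/2.\<close>

lemma main_asymptotics: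
  "\<exists>C X. C > 0 \<and> X \<ge> 3 \<and> (\<forall>x\<ge>X. \<bar>real (S x (cyclic_power 2 (Suc (Suc i)))) - 3 / (2 * fact i) * main_term i x\<bar> \<le> C * (main_term i x / ln (ln x)))"
proof -
  obtain B where B: "B > 0" "\<And>x. x \<ge> 2 \<Longrightarrow> \<bar>real (S x (cyclic_power 2 (Suc (Suc i)))) - (error_scale (Suc i) x + error_scale (Suc i) (x / 2)) / fact i\<bar> \<le> B * error_scale i x"
    using count_uniform by blast
  have "(\<lambda>x::real. x * (1 + ln (1 + ln x)) ^ i / (1 + ln x) - x * ln (ln x) ^ i / ln x) \<in> O(\<lambda>x. x * ln (ln x) ^ i / ln x / ln (ln x))"
    by real_asymp
  then obtain C1 where C1: "C1 > 0" "\<forall>\<^sub>F x in at_top. norm (x * (1 + ln (1 + ln x)) ^ i / (1 + ln x) - x * ln (ln x) ^ i / ln x) \<le> C1 * norm (x * ln (ln x) ^ i / ln x / ln (ln x) :: real)"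
    by (elim landau_o.bigE) auto
  have "(\<lambda>x::real. (x / 2) * (1 + ln (1 + ln (x / 2))) ^ i / (1 + ln (x / 2)) - (x * ln (ln x) ^ i / ln x) / 2) \<in> O(\<lambda>x. x * ln (ln x) ^ i / ln x / ln (ln x))"
    by real_asymp
  then obtain C2 where C2: "C2 > 0" "\<forall>\<^sub>F x in at_top. norm ((x / 2) * (1 + ln (1 + ln (x / 2))) ^ i / (1 + ln (x / 2)) - (x * ln (ln x) ^ i / ln x) / 2) \<le> C2 * norm (x * ln (ln x) ^ i / ln x / ln (ln x) :: real)"
    by (elim landau_o.bigE) auto
  have "(\<lambda>x::real. x * (1 + ln (1 + ln x)) ^ i / ((1 + ln x) * (1 + ln (1 + ln x)))) \<in> O(\<lambda>x. x * ln (ln x) ^ i / ln x / ln (ln x))"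
    by real_asymp
  then obtain C3 where C3: "C3 > 0" "\<forall>\<^sub>F x in at_top. norm (x * (1 + ln (1 + ln x)) ^ i / ((1 + ln x) * (1 + ln (1 + ln x)))) \<le> C3 * norm (x * ln (ln x) ^ i / ln x / ln (ln x) :: real)"
    by (elim landau_o.bigE) auto
  have pos: "\<forall>\<^sub>F x::real in at_top. ln (ln x) > 0" by real_asymp
  have pos1: "\<forall>\<^sub>F x::real in at_top. ln x > 0" by real_asymp
  have "\<forall>\<^sub>F x in at_top. x \<ge> 3 \<and> \<bar>error_scale (Suc i) x - main_term i x\<bar> \<le> C1 * (main_term i x / ln (ln x)) \<and>
      \<bar>error_scale (Suc i) (x / 2) - main_term i x / 2\<bar> \<le> C2 * (main_term i x / ln (ln x)) \<and> error_scale i x \<le> C3 * (main_term i x / ln (ln x))"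
    using C1(2) C2(2) C3(2) pos pos1 eventually_ge_at_top[of 3]
  proof eventually_elim
    case (elim x)
    have T0: "\<bar>main_term i x / ln (ln x)\<bar> = main_term i x / ln (ln x)"
      using elim by (simp add: main_term_def)
    have "error_scale (Suc i) x = x * (1 + ln (1 + ln x)) ^ i / (1 + ln x)" "error_scale (Suc i) (x / 2) = (x / 2) * (1 + ln (1 + ln (x / 2))) ^ i / (1 + ln (x / 2))"
      using error_scale_Suc[of x i] error_scale_Suc[of "x / 2" i] elim by (simp_all add: lnlnp_def lnp_def)
    moreover have "error_scale i x = x * (1 + ln (1 + ln x)) ^ i / ((1 + ln x) * (1 + ln (1 + ln x)))"
      by (simp add: error_scale_def lnlnp_def lnp_def)
    ultimately show ?case
      using elim(1-3,6) unfolding real_norm_def main_term_def[symmetric] T0 by (auto intro: order.trans[OF abs_ge_self])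
  qed
  then obtain X where X: "\<And>x. x \<ge> X \<Longrightarrow> x \<ge> 3 \<and> \<bar>error_scale (Suc i) x - main_term i x\<bar> \<le> C1 * (main_term i x / ln (ln x)) \<and>
      \<bar>error_scale (Suc i) (x / 2) - main_term i x / 2\<bar> \<le> C2 * (main_term i x / ln (ln x)) \<and> error_scale i x \<le> C3 * (main_term i x / ln (ln x))"
    unfolding eventually_at_top_linorder by blast
  have "\<bar>real (S x (cyclic_power 2 (Suc (Suc i)))) - 3 / (2 * fact i) * main_term i x\<bar> \<le> (B * C3 + (C1 + C2)) * (main_term i x / ln (ln x))" if x: "x \<ge> X" for x
  proof -
    define Q where "Q = main_term i x / ln (ln x)"
    define f :: real where "f = fact i"
    have f: "f \<ge> 1" by (simp add: f_def fact_ge_1)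
    have X': "x \<ge> 3" "\<bar>error_scale (Suc i) x - main_term i x\<bar> \<le> C1 * Q" "\<bar>error_scale (Suc i) (x / 2) - main_term i x / 2\<bar> \<le> C2 * Q" "error_scale i x \<le> C3 * Q"
      using X[OF x] by (auto simp: Q_def)
    have "\<bar>error_scale (Suc i) x + error_scale (Suc i) (x / 2) - 3 / 2 * main_term i x\<bar> \<le> (C1 + C2) * Q"
      using X'(2,3) unfolding distrib_right by linarith
    then have "\<bar>error_scale (Suc i) x + error_scale (Suc i) (x / 2) - 3 / 2 * main_term i x\<bar> / f \<le> (C1 + C2) * Q / 1"
      using f by (intro frac_le) auto
    moreover have "\<bar>error_scale (Suc i) x + error_scale (Suc i) (x / 2) - 3 / 2 * main_term i x\<bar> / f = \<bar>(error_scale (Suc i) x + error_scale (Suc i) (x / 2)) / f - 3 / (2 * f) * main_term i x\<bar>"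
    proof -
      have "(error_scale (Suc i) x + error_scale (Suc i) (x / 2)) / f - 3 / (2 * f) * main_term i x = (error_scale (Suc i) x + error_scale (Suc i) (x / 2) - 3 / 2 * main_term i x) / f"
        by (simp add: diff_divide_distrib)
      then show ?thesis using f by simp
    qed
    ultimately have 1: "\<bar>(error_scale (Suc i) x + error_scale (Suc i) (x / 2)) / f - 3 / (2 * f) * main_term i x\<bar> \<le> (C1 + C2) * Q" by simp
    have "B * error_scale i x \<le> B * (C3 * Q)" using X'(4) B(1) by (intro mult_left_mono) auto
    then have 2: "\<bar>real (S x (cyclic_power 2 (Suc (Suc i)))) - (error_scale (Suc i) x + error_scale (Suc i) (x / 2)) / f\<bar> \<le> B * C3 * Q"
      using B(2)[of x] X'(1) unfolding f_def by simp
    show ?thesis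
      using 1 2 unfolding Q_def[symmetric] f_def[symmetric] distrib_right[of "B * C3"] by linarith
  qed
  moreover have "B * C3 + (C1 + C2) > 0" using B(1) C1(1) C2(1) C3(1) by (simp add: add_pos_pos)
  moreover have "X \<ge> 3" using X[of X] by simp
  ultimately show ?thesis by blast
qed

theorem theorem1p1:
  fixes k :: nat
  assumes "k \<ge> 2"
  shows "\<exists>(C::real) (E::real \<Rightarrow> real). \<forall>x\<ge>3.
           \<bar>E x\<bar> \<le> C * (1 / ln (ln x)) \<and>
           real (S x (cyclic_power 2 k)) =
             3 / (2 * fact (k - 2)) * (x * ln (ln x) ^ (k - 2) / ln x) * (1 + E x)"
proof -
  define i where "i = k - 2"
  have k: "k = Suc (Suc i)" using assms by (simp add: i_def)
  define N where "N = (\<lambda>x. real (S x (cyclic_power 2 k)))"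
  define c :: real where "c = 3 / (2 * fact i)"
  have c: "c > 0" by (simp add: c_def)
  have l: "ln x > 1" "ln (ln x) > 0" if "x \<ge> 3" for x :: real
  proof -
    have "exp 1 < (3::real)" using exp_less_mono[of 1 "272/100"] e_less_272 by simp
    then have "ln (exp 1) < ln x" using that by (intro ln_less_cancel_iff[THEN iffD2]) (auto intro: less_le_trans)
    then show "ln x > 1" by simp
    then show "ln (ln x) > 0" by simp
  qed
  have T: "main_term i x > 0" if "x \<ge> 3" for x using l[OF that] that by (simp add: main_term_def)
  obtain C X where CX: "C > 0" "X \<ge> 3" "\<And>x. x \<ge> X \<Longrightarrow> \<bar>N x - c * main_term i x\<bar> \<le> C * (main_term i x / ln (ln x))"
    using main_asymptotics[of i] unfolding N_def c_def k by blast
  \<comment> \<open>The relative error itself. On \<open>3 \<le> x < X\<close> it only has to be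
    bounded, because \<open>1 / ln (ln x)\<close> stays away from 0 there.\<close>
  define E where "E = (\<lambda>x. N x / (c * main_term i x) - 1)"
  \<comment> \<open>A lower bound for the main term between 3 and \<open>X\<close>, with the
    numerator taken at 3 and the denominator at \<open>X\<close>.\<close>
  define t where "t = 3 * ln (ln 3) ^ i / ln X"
  have t: "t > 0" unfolding t_def using l[of 3] l[of X] CX(2) by simp
  \<comment> \<open>The quotient comes from the trivial estimate \<open>N x \<le> X\<close> over the
    main term, the 1 from the subtraction in \<open>E\<close>. The factor \<open>ln (ln X)\<close>
    offsets the smallest value of \<open>1 / ln (ln x)\<close> on this range.\<close>
  define D where "D = (X / (c * t) + 1) * ln (ln X)"
  have D: "D \<ge> 0" unfolding D_def using l[of X] CX(2) c t by simp
  have main: "\<bar>E x\<bar> \<le> (C / c + D) * (1 / ln (ln x))" if x: "x \<ge> 3" for x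
  proof (cases "x \<ge> X")
    case True
    have "\<bar>E x\<bar> = \<bar>N x - c * main_term i x\<bar> / (c * main_term i x)"
    proof -
      have "E x = (N x - c * main_term i x) / (c * main_term i x)" using T[OF x] c by (simp add: E_def diff_divide_distrib)
      then show ?thesis using T[OF x] c by simp
    qed
    also have "\<dots> \<le> C * (main_term i x / ln (ln x)) / (c * main_term i x)"
      using CX(3)[OF True] T[OF x] c by (intro divide_right_mono) auto
    also have "\<dots> = C / c * (1 / ln (ln x))" using T[OF x] by simp
    also have "\<dots> \<le> (C / c + D) * (1 / ln (ln x))" using D l[OF x] by (intro mult_right_mono) auto
    finally show ?thesis .
  next
    case False
    have N0: "0 \<le> N x" by (simp add: N_def)
    have "S x (cyclic_power 2 k) \<le> card (nats_upto x)"
      unfolding S_def by (intro card_mono) (auto simp: nats_upto_def)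
    then have "N x \<le> x" using card_nats_upto[of x] x unfolding N_def by linarith
    then have NX: "N x \<le> X" using False by simp
    have "t \<le> main_term i x"
      unfolding t_def main_term_def using x l[of 3] l[OF x] False
      by (intro frac_le mult_mono power_mono) (auto simp: ln_mono)
    then have "N x / (c * main_term i x) \<le> X / (c * t)"
      using NX c t CX(2) by (intro frac_le mult_left_mono) auto
    moreover have "0 \<le> N x / (c * main_term i x)" using N0 T[OF x] c by simp
    moreover have "0 \<le> X / (c * t)" using c t CX(2) by simp
    ultimately have "\<bar>E x\<bar> \<le> X / (c * t) + 1" unfolding E_def by linarith
    also have "\<dots> = D * (1 / ln (ln X))" using l[of X] CX(2) by (simp add: D_def)
    also have "\<dots> \<le> D * (1 / ln (ln x))"
    proof (intro mult_left_mono divide_left_mono D)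
      have "ln x \<le> ln X" using False x by simp
      then show "ln (ln x) \<le> ln (ln X)" using l[OF x] by simp
      show "0 < ln (ln X) * ln (ln x)" using l[OF x] l[of X] CX(2) by simp
    qed simp
    also have "\<dots> \<le> (C / c + D) * (1 / ln (ln x))" using CX(1) c l[OF x] by (intro mult_right_mono) auto
    finally show ?thesis .
  qed
  have "N x = c * main_term i x * (1 + E x)" if "x \<ge> 3" for x
    using T[OF that] c by (simp add: E_def)
  then have "\<forall>x\<ge>3. \<bar>E x\<bar> \<le> (C / c + D) * (1 / ln (ln x)) \<and> N x = c * main_term i x * (1 + E x)"
    using main by blast
  then show ?thesis unfolding N_def c_def main_term_def i_def by blast
qed

end
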